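(* Let $O\in\mathbb P$, let $u$ be a coordinate on $\mathbb P$ vanishing at $O$, and for $n\in\mathbb Z$ let $L_n={}_O\mathbf L^{X_n}:{}_O\mathbf W\to{}_O\mathbf W$, where $X_n=-u^{n+1}\,d/du$. Then for all $l,m\in\mathbb Z$ $$[L_l,L_m]=(l-m)L_{l+m}+\frac{l^3-l}{12}\,\delta_{l+m,0}.$$
   Context: $\mathbb P$ is a complex projective line and $O\in\mathbb P$; a coordinate is a meromorphic function with exactly one pole, which is simple. A meromorphic 1-form is of the second kind if all its residues vanish. ${}_O\mathbf K$ is the space of meromorphic 1-forms on $\mathbb P$ regular outside $O$ (these are automatically of the second kind), and ${}_O\mathbf W=S^*({}_O\mathbf K)$ is its symmetric algebra, with product $\otimes^s$ and vacuum $\mathbf 1=1\in\mathbb C$. Elements of $S^2$ are regarded as symmetric bidifferentials in two points $u_1,u_2$ (products being symmetrised by averaging). Hats mark omitted factors; $\mathcal L_X$ is the Lie derivative and $i_X$ is contraction. For a meromorphic vector field $X$ on $\mathbb P$, the operator ${}_O\mathbf L^X=\mathcal X^-+\mathcal X^0+\mathcal X^+:{}_O\mathbf W\to{}_O\mathbf W$, linear in $X$, is defined by $$\mathcal X^-(\alpha_1\otimes^s\cdots\otimes^s\alpha_p)=-\sum_{i<j}(\alpha_1\otimes^s\cdots\widehat{\alpha_i}\cdots\widehat{\alpha_j}\cdots\otimes^s\alpha_p)\,\mathrm{Res}_O\bigl((i_X\alpha_i)\alpha_j\bigr),$$ $$\mathcal X^0(\alpha_1\otimes^s\cdots\otimes^s\alpha_p)=\sum_i\alpha_1\otimes^s\cdots\otimes^s{}_O[\mathcal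 L_X\alpha_i]\otimes^s\cdots\otimes^s\alpha_p,$$ $$\mathcal X^+(\alpha_1\otimes^s\cdots\otimes^s\alpha_p)=\mathcal X^+(\mathbf 1)\otimes^s\alpha_1\otimes^s\cdots\otimes^s\alpha_p .$$ Here ${}_O[\cdot]$ is the linear projection on meromorphic forms of the second kind with ${}_O[\eta]=\eta$ if $\eta$ is regular away from $O$ and ${}_O[\eta]=0$ if $\eta$ is regular at $O$. Further, $\mathcal X^+(\mathbf 1)=0$ if $X$ is regular at $O$, and $\mathcal X^+(\mathbf 1)=\omega_X$ if $X=\xi(u)\,d/du$ is regular away from $O$, where $$\omega_X=\left\{\frac{2(\xi(u_1)-\xi(u_2))-(\xi'(u_1)+\xi'(u_2))(u_1-u_2)}{2(u_1-u_2)}\right\}\frac{du_1\otimes^s du_2}{(u_1-u_2)^2}\in S^2({}_O\mathbf K).$$ The form $\omega_X$ vanishes for vector fields regular on all of $\mathbb P$, so the two cases are consistent and extend linearly to all meromorphic $X$.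
   Formalization: The sign of X^- is changed: it is taken with +Res_O instead of -Res_O, because with the printed sign [L_2,L_{-2}]1 = -1/2 while the stated relation requires +1/2. *)

theory Defs
  imports "HOL-Complex_Analysis.Complex_Analysis" "HOL-Library.Poly_Mapping" "HOL-Library.Multiset"
begin

section \<open>Meromorphic functions, 1-forms and vector fields on the projective line\<close>

text \<open>The projective line is modelled as the complex plane plus a point at infinity, with the affine
  coordinate \<open>z\<close>, and with \<open>1/z\<close> as the chart at infinity.\<close>

datatype cp1 = Pt complex | Infty

definition meromorphic_cp1 :: "(complex \<Rightarrow> complex) set" where
  "meromorphic_cp1 = {f. f meromorphic_on UNIV \<and> (\<lambda>t. f (inverse t)) meromorphic_on {0}}"

text \<open>A meromorphic function is represented by its restriction to the affine part. Functions that are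
  nicely meromorphic are continuous except at their poles, where they take the value 0, so that each
  meromorphic function has exactly one representative.\<close>

typedef mero = "{f \<in> meromorphic_cp1. f nicely_meromorphic_on UNIV}"
  morphisms mval Abs_mero
  by (rule exI[of _ "\<lambda>_. 0"])
     (auto simp: meromorphic_cp1_def intro!: meromorphic_intros)

definition mk :: "(complex \<Rightarrow> complex) \<Rightarrow> mero" where
  "mk f = Abs_mero (remove_sings f)"

lemma mval_cp1: "mval f \<in> meromorphic_cp1"
  and mval_nice: "mval f nicely_meromorphic_on UNIV"
  using mval[of f] by auto

lemma remove_sings_cp1:
  assumes "f \<in> meromorphic_cp1"
  shows "remove_sings f \<in> meromorphic_cp1"
proof -
  have f1: "f meromorphic_on UNIV" and f2: "(\<lambda>t. f (inverse t)) meromorphic_on {0}"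
    using assms by (auto simp: meromorphic_cp1_def)
  from f2 have "isolated_singularity_at (\<lambda>t. f (inverse t)) 0"
    by (simp add: meromorphic_at_iff)
  then obtain r where r: "r > 0" "(\<lambda>t. f (inverse t)) analytic_on ball 0 r - {0}"
    unfolding isolated_singularity_at_def by blast
  have eq: "remove_sings f (inverse t) = f (inverse t)" if t: "t \<in> ball 0 r - {0}" for t
  proof -
    have 1: "(\<lambda>t. f (inverse t)) analytic_on inverse ` {inverse t}"
      using analytic_on_subset[OF r(2), of "{t}"] t by simp
    have 2: "inverse analytic_on {inverse t}"
      using t by (intro analytic_intros) auto
    have "((\<lambda>t. f (inverse t)) \<circ> inverse) analytic_on {inverse t}"
      by (rule analytic_on_compose[OF 2 1])
    hence "f analytic_on {inverse t}"
      by (simp add: o_def)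
    thus ?thesis by simp
  qed
  have "eventually (\<lambda>t. t \<in> ball 0 r - {0}) (at (0::complex))"
    using r(1) eventually_at_ball'[of r 0 UNIV] by (auto elim!: eventually_mono)
  hence "eventually (\<lambda>t. remove_sings f (inverse t) = f (inverse t)) (at 0)"
    by (rule eventually_mono) (use eq in auto)
  hence "(\<lambda>t. remove_sings f (inverse t)) meromorphic_on {0} \<longleftrightarrow>
         (\<lambda>t. f (inverse t)) meromorphic_on {0}"
    by (intro meromorphic_on_cong) auto
  thus ?thesis
    using f1 f2 by (auto simp: meromorphic_cp1_def intro: remove_sings_meromorphic)
qed

lemma mval_mk:
  assumes "f \<in> meromorphic_cp1"
  shows "mval (mk f) = remove_sings f"
  unfolding mk_def
  using remove_sings_cp1[OF assms] assms
  by (intro Abs_mero_inverse)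
     (auto intro: remove_sings_nicely_meromorphic simp: meromorphic_cp1_def)

lemma mval_mk_eventually:
  assumes "f \<in> meromorphic_cp1"
  shows "\<forall>\<^sub>\<approx>z\<in>UNIV. mval (mk f) z = f z"
  unfolding mval_mk[OF assms]
  using assms by (intro eventually_remove_sings_eq) (auto simp: meromorphic_cp1_def)

lemma mero_eqI:
  assumes "\<forall>\<^sub>\<approx>z\<in>UNIV. mval f z = mval g z"
  shows "f = g"
proof -
  have "mval f z = mval g z" for z
  proof -
    have ev: "eventually (\<lambda>w. mval f w = mval g w) (at z)"
      using assms by (auto simp: eventually_cosparse_open_eq)
    have *: "mval h z = remove_sings (mval h) z" for h
    proof (cases "is_pole (mval h) z")
      case True
      then show ?thesis
        using mval_nice[of h] by (auto simp: nicely_meromorphic_on_def is_pole_def 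
            dest: not_tendsto_and_filterlim_at_infinity[OF at_neq_bot])
    next
      case False
      then have "mval h analytic_on {z}"
        using mval_nice nicely_meromorphic_on_imp_analytic_at by blast
      then show ?thesis by simp
    qed
    show ?thesis
      unfolding * by (rule remove_sings_cong[OF ev]) simp
  qed
  thus ?thesis by (simp add: mval_inject[symmetric] fun_eq_iff)
qed

lemma mero_const: "(\<lambda>_. c) \<in> meromorphic_cp1"
  by (auto simp: meromorphic_cp1_def)

lemma mero_binop:
  assumes "f \<in> meromorphic_cp1" "g \<in> meromorphic_cp1"
  shows "(\<lambda>z. f z + g z) \<in> meromorphic_cp1" "(\<lambda>z. f z - g z) \<in> meromorphic_cp1"
    "(\<lambda>z. f z * g z) \<in> meromorphic_cp1" "(\<lambda>z. f z / g z) \<in> meromorphic_cp1"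
  using assms by (auto simp: meromorphic_cp1_def intro!: meromorphic_intros)

lemma mero_unop:
  assumes "f \<in> meromorphic_cp1"
  shows "(\<lambda>z. - f z) \<in> meromorphic_cp1" "(\<lambda>z. inverse (f z)) \<in> meromorphic_cp1"
  using assms by (auto simp: meromorphic_cp1_def intro!: meromorphic_intros)

lemma mero_deriv:
  assumes "f \<in> meromorphic_cp1"
  shows "deriv f \<in> meromorphic_cp1"
proof -
  have f1: "f meromorphic_on UNIV" and f2: "(\<lambda>t. f (inverse t)) meromorphic_on {0}"
    using assms by (auto simp: meromorphic_cp1_def)
  let ?g = "\<lambda>t. f (inverse t)"
  from f2 have "isolated_singularity_at ?g 0"
    by (simp add: meromorphic_at_iff)
  then obtain r where r: "r > 0" "?g analytic_on ball 0 r - {0}"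
    unfolding isolated_singularity_at_def by blast
  have eq: "deriv f (inverse t) = - (t ^ 2) * deriv ?g t" if t: "t \<in> ball 0 r - {0}" for t
  proof -
    have g: "?g analytic_on {t}" using r(2) t analytic_on_subset by blast
    have t0: "t \<noteq> 0" using t by auto
    have dg: "(?g has_field_derivative deriv ?g t) (at (inverse (inverse t)))"
      using g t0 analytic_derivI[of ?g t UNIV] by simp
    have di: "(inverse has_field_derivative - (t^2)) (at (inverse t))"
      using DERIV_inverse[of "inverse t"] t0
      by (simp add: power_inverse numeral_2_eq_2)
    have "((\<lambda>w. ?g (inverse w)) has_field_derivative deriv ?g t * (- (t^2))) (at (inverse t))"
      by (rule DERIV_chain2[OF dg di])
    hence "(f has_field_derivative deriv ?g t * (- (t^2))) (at (inverse t))"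
      by simp
    thus ?thesis by (simp add: DERIV_imp_deriv)
  qed
  have "eventually (\<lambda>t. t \<in> ball 0 r - {0}) (at (0::complex))"
    using r(1) eventually_at_ball'[of r 0 UNIV] by (auto elim!: eventually_mono)
  hence ev: "eventually (\<lambda>t. deriv f (inverse t) = - (t ^ 2) * deriv ?g t) (at 0)"
    by (rule eventually_mono) (use eq in auto)
  have "(\<lambda>t. deriv f (inverse t)) meromorphic_on {0} \<longleftrightarrow>
         (\<lambda>t. - (t ^ 2) * deriv ?g t) meromorphic_on {0}"
    by (intro meromorphic_on_cong) (use ev in auto)
  moreover have "(\<lambda>t. - (t ^ 2) * deriv ?g t) meromorphic_on {0}"
    using f2 by (auto intro!: meromorphic_intros)
  ultimately show ?thesis
    using f1 by (auto simp: meromorphic_cp1_def intro!: meromorphic_intros)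
qed

instantiation mero :: field
begin

definition "0 = mk (\<lambda>_. 0)"
definition "1 = mk (\<lambda>_. 1)"
definition "f + g = mk (\<lambda>z. mval f z + mval g z)"
definition "f - g = mk (\<lambda>z. mval f z - mval g z)"
definition "- f = mk (\<lambda>z. - mval f z)"
definition "f * g = mk (\<lambda>z. mval f z * mval g z)"
definition "inverse f = mk (\<lambda>z. inverse (mval f z))"
definition "f div g = mk (\<lambda>z. mval f z / mval g z)" for f g :: mero

lemma mval_const [simp]: "mval (mk (\<lambda>_. c)) = (\<lambda>_. c)"
  by (subst mval_mk) (auto intro!: mero_const)

lemma mval_ops:
  "\<forall>\<^sub>\<approx>z\<in>UNIV. mval (f + g) z = mval f z + mval g z"
  "\<forall>\<^sub>\<approx>z\<in>UNIV. mval (f - g) z = mval f z - mval g z"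
  "\<forall>\<^sub>\<approx>z\<in>UNIV. mval (- f) z = - mval f z"
  "\<forall>\<^sub>\<approx>z\<in>UNIV. mval (f * g) z = mval f z * mval g z"
  "\<forall>\<^sub>\<approx>z\<in>UNIV. mval (inverse f) z = inverse (mval f z)"
  "\<forall>\<^sub>\<approx>z\<in>UNIV. mval (f div g) z = mval f z / mval g z"
  unfolding plus_mero_def minus_mero_def uminus_mero_def times_mero_def inverse_mero_def
    divide_mero_def
  by (intro mval_mk_eventually mero_binop mero_unop mval_cp1)+

lemma mval_01: "mval 0 = (\<lambda>_. 0)" "mval 1 = (\<lambda>_. 1)"
  by (simp_all add: zero_mero_def one_mero_def)

instance
proof
  fix a b c :: mero
  show "a * b * c = a * (b * c)"
    by (rule mero_eqI, use mval_ops(4)[of a b] mval_ops(4)[of b c]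
        mval_ops(4)[of "a * b" c] mval_ops(4)[of a "b * c"] in eventually_elim)
       (simp add: mult.assoc)
  show "a * b = b * a"
    by (rule mero_eqI, use mval_ops(4)[of a b] mval_ops(4)[of b a] in eventually_elim)
       simp
  show "1 * a = a"
    by (rule mero_eqI, use mval_ops(4)[of 1 a] in eventually_elim)
       (simp add: mval_01)
  show "a + b + c = a + (b + c)"
    by (rule mero_eqI, use mval_ops(1)[of a b] mval_ops(1)[of b c]
        mval_ops(1)[of "a + b" c] mval_ops(1)[of a "b + c"] in eventually_elim)
       (simp add: add.assoc)
  show "a + b = b + a"
    by (rule mero_eqI, use mval_ops(1)[of a b] mval_ops(1)[of b a] in eventually_elim)
       simp
  show "0 + a = a"
    by (rule mero_eqI, use mval_ops(1)[of 0 a] in eventually_elim)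
       (simp add: mval_01)
  show "- a + a = 0"
    by (rule mero_eqI, use mval_ops(1)[of "- a" a] mval_ops(3)[of a] in eventually_elim)
       (simp add: mval_01)
  show "a - b = a + - b"
    by (rule mero_eqI, use mval_ops(1)[of a "- b"]
        mval_ops(3)[of b] mval_ops(2)[of a b] in eventually_elim)
       simp
  show "(a + b) * c = a * c + b * c"
    by (rule mero_eqI, use mval_ops(1)[of a b] mval_ops(4)[of "a + b" c]
        mval_ops(1)[of "a * c" "b * c"] mval_ops(4)[of a c] mval_ops(4)[of b c] in eventually_elim)
       (simp add: ring_distribs)
  show "(0::mero) \<noteq> 1"
    using mval_01 by (metis zero_neq_one)
  show "a div b = a * inverse b"
    by (rule mero_eqI, use mval_ops(6)[of a b]
        mval_ops(5)[of b] mval_ops(4)[of a "inverse b"] in eventually_elim)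
       (simp add: field_simps)
  show "inverse (0::mero) = 0"
    by (rule mero_eqI, use mval_ops(5)[of 0] in eventually_elim)
       (simp add: mval_01)
  assume a: "a \<noteq> 0"
  have nz: "\<forall>\<^sub>\<approx>z\<in>UNIV. mval a z \<noteq> 0"
  proof -
    have "mval a constant_on UNIV \<or> (\<forall>\<^sub>\<approx>z\<in>UNIV. mval a z \<noteq> 0)"
      using nicely_meromorphic_imp_constant_or_avoid[OF mval_nice[of a], of 0]
      by (auto simp: constant_on_def)
    moreover have "\<forall>\<^sub>\<approx>z\<in>UNIV. mval a z \<noteq> 0" if "mval a constant_on UNIV"
    proof -
      obtain c where c: "\<And>z. mval a z = c" using \<open>mval a constant_on UNIV\<close>
        by (auto simp: constant_on_def)
      have "c \<noteq> 0"
      proof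
        assume "c = 0"
        hence "mval a = mval 0" using c by (auto simp: mval_01)
        with a show False by (simp add: mval_inject)
      qed
      thus ?thesis using c by simp
    qed
    ultimately show ?thesis by blast
  qed
  show "inverse a * a = 1"
    by (rule mero_eqI, use nz mval_ops(5)[of a] mval_ops(4)[of "inverse a" a] in eventually_elim)
       (simp add: mval_01)
qed

end

definition mconst :: "complex \<Rightarrow> mero" where
  "mconst c = mk (\<lambda>_. c)"

definition mderiv :: "mero \<Rightarrow> mero" where
  "mderiv f = mk (deriv (mval f))"

text \<open>The 1-form \<open>f dz\<close> and the vector field \<open>f d/dz\<close> are represented by their coefficient \<open>f\<close> in the
  affine coordinate. What distinguishes them from functions is their expression in the chart at
  infinity.\<close>

type_synonym mform = mero
type_synonym mvf = mero

text \<open>Coefficient in a chart centred at the given point: \<open>z - a\<close> at \<open>Pt a\<close>, and \<open>t = 1/z\<close> at \<open>Infty\<close>,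
  where \<open>dz = - dt / t\<^sup>2\<close> and \<open>d/dz = - t\<^sup>2 d/dt\<close>.\<close>

fun fun_at :: "cp1 \<Rightarrow> mero \<Rightarrow> complex \<Rightarrow> complex" where
  "fun_at (Pt a) f = (\<lambda>t. mval f (a + t))"
| "fun_at Infty f = (\<lambda>t. mval f (inverse t))"

fun form_at :: "cp1 \<Rightarrow> mform \<Rightarrow> complex \<Rightarrow> complex" where
  "form_at (Pt a) \<alpha> = (\<lambda>t. mval \<alpha> (a + t))"
| "form_at Infty \<alpha> = (\<lambda>t. - mval \<alpha> (inverse t) / t\<^sup>2)"

fun vf_at :: "cp1 \<Rightarrow> mvf \<Rightarrow> complex \<Rightarrow> complex" where
  "vf_at (Pt a) X = (\<lambda>t. mval X (a + t))"
| "vf_at Infty X = (\<lambda>t. - t\<^sup>2 * mval X (inverse t))"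

definition fun_pole :: "cp1 \<Rightarrow> mero \<Rightarrow> bool" where
  "fun_pole P f \<longleftrightarrow> is_pole (fun_at P f) 0"

definition form_regular :: "cp1 \<Rightarrow> mform \<Rightarrow> bool" where
  "form_regular P \<alpha> \<longleftrightarrow> \<not> is_pole (form_at P \<alpha>) 0"

definition vf_regular :: "cp1 \<Rightarrow> mvf \<Rightarrow> bool" where
  "vf_regular P X \<longleftrightarrow> \<not> is_pole (vf_at P X) 0"

definition form_residue :: "cp1 \<Rightarrow> mform \<Rightarrow> complex" where
  "form_residue P \<alpha> = residue (form_at P \<alpha>) 0"

definition second_kind :: "mform \<Rightarrow> bool" where
  "second_kind \<alpha> \<longleftrightarrow> (\<forall>P. form_residue P \<alpha> = 0)"

definition coordinate :: "mero \<Rightarrow> bool" where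
  "coordinate u \<longleftrightarrow>
     (\<exists>P. fun_pole P u \<and> zorder (fun_at P u) 0 = -1 \<and> (\<forall>Q. Q \<noteq> P \<longrightarrow> \<not> fun_pole Q u))"

definition vanishes_at :: "cp1 \<Rightarrow> mero \<Rightarrow> bool" where
  "vanishes_at P f \<longleftrightarrow> (fun_at P f \<longlongrightarrow> 0) (at 0)"

text \<open>Contraction \<open>(g d/dz, f dz) \<mapsto> f g\<close>.\<close>

definition contract :: "mvf \<Rightarrow> mform \<Rightarrow> mero" where
  "contract X \<alpha> = X * \<alpha>"

text \<open>Lie derivative: \<open>\<L>\<^sub>X (f dz) = (g f' + g' f) dz\<close> for \<open>X = g d/dz\<close>.\<close>

definition lie_deriv :: "mvf \<Rightarrow> mform \<Rightarrow> mform" where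
  "lie_deriv X \<alpha> = X * mderiv \<alpha> + mderiv X * \<alpha>"

definition forms_K :: "cp1 \<Rightarrow> mform set" where
  "forms_K P = {\<alpha>. \<forall>Q. Q \<noteq> P \<longrightarrow> form_regular Q \<alpha>}"

text \<open>The projection \<open>\<^sub>O[\<cdot>]\<close>, set to 0 off the forms of the second kind.\<close>

definition principal_part :: "cp1 \<Rightarrow> mform \<Rightarrow> mform" where
  "principal_part P = (THE \<pi>.
     (\<forall>\<eta> \<theta>. second_kind \<eta> \<longrightarrow> second_kind \<theta> \<longrightarrow> \<pi> (\<eta> + \<theta>) = \<pi> \<eta> + \<pi> \<theta>) \<and>
     (\<forall>c \<eta>. second_kind \<eta> \<longrightarrow> \<pi> (mconst c * \<eta>) = mconst c * \<pi> \<eta>) \<and>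
     (\<forall>\<eta>. second_kind \<eta> \<longrightarrow> (\<forall>Q. Q \<noteq> P \<longrightarrow> form_regular Q \<eta>) \<longrightarrow> \<pi> \<eta> = \<eta>) \<and>
     (\<forall>\<eta>. second_kind \<eta> \<longrightarrow> form_regular P \<eta> \<longrightarrow> \<pi> \<eta> = 0) \<and>
     (\<forall>\<eta>. \<not> second_kind \<eta> \<longrightarrow> \<pi> \<eta> = 0))"

section \<open>The symmetric algebra\<close>

text \<open>The symmetric algebra of the space of all meromorphic 1-forms: the free commutative complex
  algebra on the set of forms (the monoid algebra of finite multisets of forms) modulo the ideal
  generated by the linear relations between forms.\<close>

type_synonym free_alg = "mform multiset \<Rightarrow>\<^sub>0 complex"

inductive_set sym_ideal :: "free_alg set" where
  zero: "0 \<in> sym_ideal"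
| add: "Poly_Mapping.single {#\<alpha> + \<beta>#} 1 - Poly_Mapping.single {#\<alpha>#} 1
          - Poly_Mapping.single {#\<beta>#} 1 \<in> sym_ideal"
| scale: "Poly_Mapping.single {#mconst c * \<alpha>#} 1 - Poly_Mapping.single {#\<alpha>#} c \<in> sym_ideal"
| plus: "a \<in> sym_ideal \<Longrightarrow> b \<in> sym_ideal \<Longrightarrow> a + b \<in> sym_ideal"
| mult: "a \<in> sym_ideal \<Longrightarrow> r * a \<in> sym_ideal"

lemma sym_ideal_uminus: "a \<in> sym_ideal \<Longrightarrow> - a \<in> sym_ideal"
  using sym_ideal.mult[of a "-1"] by simp

definition sym_rel :: "free_alg \<Rightarrow> free_alg \<Rightarrow> bool" where
  "sym_rel a b \<longleftrightarrow> a - b \<in> sym_ideal"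

lemma equivp_sym_rel: "equivp sym_rel"
proof (rule equivpI)
  show "reflp sym_rel" by (auto simp: reflp_def sym_rel_def sym_ideal.zero)
  show "symp sym_rel"
    unfolding symp_def sym_rel_def using sym_ideal_uminus by (metis minus_diff_eq)
  show "transp sym_rel"
    unfolding transp_def sym_rel_def using sym_ideal.plus by (metis diff_add_cancel add_diff_eq)
qed

quotient_type sym_alg = free_alg / sym_rel
  by (rule equivp_sym_rel)

instantiation sym_alg :: comm_ring_1
begin

lift_definition zero_sym_alg :: sym_alg is 0 .
lift_definition one_sym_alg :: sym_alg is 1 .
lift_definition plus_sym_alg :: "sym_alg \<Rightarrow> sym_alg \<Rightarrow> sym_alg" is "(+)"
  unfolding sym_rel_def using sym_ideal.plus by (metis add_diff_add)
lift_definition uminus_sym_alg :: "sym_alg \<Rightarrow> sym_alg" is uminus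
  unfolding sym_rel_def using sym_ideal_uminus by (metis minus_diff_minus)
lift_definition minus_sym_alg :: "sym_alg \<Rightarrow> sym_alg \<Rightarrow> sym_alg" is "(-)"
  unfolding sym_rel_def
  by (metis (no_types, lifting) sym_ideal.plus sym_ideal_uminus add_diff_add minus_diff_minus
      uminus_add_conv_diff add.commute)
lift_definition times_sym_alg :: "sym_alg \<Rightarrow> sym_alg \<Rightarrow> sym_alg" is "(*)"
proof -
  fix a b c d :: free_alg
  assume "sym_rel a b" "sym_rel c d"
  hence "c * (a - b) + b * (c - d) \<in> sym_ideal"
    unfolding sym_rel_def by (intro sym_ideal.plus sym_ideal.mult)
  moreover have "c * (a - b) + b * (c - d) = a * c - b * d" by (simp add: algebra_simps)
  ultimately show "sym_rel (a * c) (b * d)" by (simp add: sym_rel_def)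
qed

lemma not_one_in_sym_ideal: "1 \<notin> sym_ideal"
proof
  have "Poly_Mapping.lookup a {#} = 0" if "a \<in> sym_ideal" for a
    using that
  proof induction
    case (mult a r)
    have "Poly_Mapping.lookup (r * a) {#} =
            (\<Sum>l. (Poly_Mapping.lookup r l * Poly_Mapping.lookup a {#}) when l = {#})"
      unfolding lookup_mult by (rule Sum_any.cong) (auto simp: when_def)
    then show ?case using mult by simp
  qed (simp_all add: lookup_add lookup_minus lookup_single)
  moreover assume "1 \<in> sym_ideal"
  ultimately show False by (metis lookup_one_zero zero_multiset_def zero_neq_one)
qed

instance
proof
  show "(0::sym_alg) \<noteq> 1"
    by transfer (use not_one_in_sym_ideal sym_ideal_uminus[of "-1"] in \<open>auto simp: sym_rel_def\<close>)
qed (transfer; simp add: sym_rel_def sym_ideal.zero algebra_simps)+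

end

lift_definition sym_const :: "complex \<Rightarrow> sym_alg" is "\<lambda>c. Poly_Mapping.single {#} c" .
lift_definition sym_incl :: "mform \<Rightarrow> sym_alg" is "\<lambda>\<alpha>. Poly_Mapping.single {#\<alpha>#} 1" .

abbreviation sym_scale :: "complex \<Rightarrow> sym_alg \<Rightarrow> sym_alg" (infixr \<open>\<bullet>\<^sub>S\<close> 75) where
  "c \<bullet>\<^sub>S w \<equiv> sym_const c * w"

definition sym_prod :: "mform list \<Rightarrow> sym_alg" where
  "sym_prod \<alpha>s = prod_list (map sym_incl \<alpha>s)"

text \<open>Over a field the symmetric algebra of a subspace embeds into that of the ambient space, so
  \<open>S\<^sup>*(\<^sub>O\<^bold>K)\<close> is the subalgebra generated by \<open>\<^sub>O\<^bold>K\<close>.\<close>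

inductive_set sym_W :: "cp1 \<Rightarrow> sym_alg set" for P where
  const: "sym_const c \<in> sym_W P"
| incl: "\<alpha> \<in> forms_K P \<Longrightarrow> sym_incl \<alpha> \<in> sym_W P"
| plus: "v \<in> sym_W P \<Longrightarrow> w \<in> sym_W P \<Longrightarrow> v + w \<in> sym_W P"
| mult: "v \<in> sym_W P \<Longrightarrow> w \<in> sym_W P \<Longrightarrow> v * w \<in> sym_W P"

text \<open>The linear operator on \<open>S\<^sup>*(\<^sub>O\<^bold>K)\<close> with prescribed values on products of forms, set to 0 outside.\<close>

definition operator_W :: "cp1 \<Rightarrow> (mform list \<Rightarrow> sym_alg) \<Rightarrow> sym_alg \<Rightarrow> sym_alg" where
  "operator_W P F = (THE T.
     (\<forall>v\<in>sym_W P. T v \<in> sym_W P) \<and>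
     (\<forall>v\<in>sym_W P. \<forall>w\<in>sym_W P. T (v + w) = T v + T w) \<and>
     (\<forall>c. \<forall>v\<in>sym_W P. T (c \<bullet>\<^sub>S v) = c \<bullet>\<^sub>S T v) \<and>
     (\<forall>\<alpha>s. set \<alpha>s \<subseteq> forms_K P \<longrightarrow> T (sym_prod \<alpha>s) = F \<alpha>s) \<and>
     (\<forall>v. v \<notin> sym_W P \<longrightarrow> T v = 0))"

section \<open>The operators\<close>

text \<open>The coefficient of \<open>dz\<^sub>1 dz\<^sub>2\<close> at \<open>(z\<^sub>1, z\<^sub>2)\<close> of the bidifferential defining \<open>\<omega>\<^sub>X\<close> in the
  coordinate \<open>u\<close>. If \<open>X = \<xi>(u) d/du\<close>, then \<open>\<xi> \<circ> u = du(X)\<close> and \<open>\<xi>' \<circ> u = d(\<xi> \<circ> u) / du\<close>.\<close>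

definition omega_coeff :: "mero \<Rightarrow> mvf \<Rightarrow> complex \<Rightarrow> complex \<Rightarrow> complex" where
  "omega_coeff u X z1 z2 =
    (let \<xi> = mval (contract X (mderiv u));
         \<xi>' = mval (mderiv (contract X (mderiv u)) / mderiv u);
         u1 = mval u z1; u2 = mval u z2
     in (2 * (\<xi> z1 - \<xi> z2) - (\<xi>' z1 + \<xi>' z2) * (u1 - u2)) / (2 * (u1 - u2))
        * (mval (mderiv u) z1 * mval (mderiv u) z2 / (u1 - u2)\<^sup>2))"

text \<open>\<open>\<omega>\<^sub>X\<close> is the element \<open>\<Sum>\<^sub>i \<alpha>\<^sub>i \<otimes> \<beta>\<^sub>i\<close> of \<open>S\<^sup>2(\<^sub>O\<^bold>K)\<close> whose symmetrised bidifferential is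
  given by the formula in every coordinate \<open>u\<close>, wherever the latter and \<open>X\<close> are regular and off the
  diagonal.\<close>

definition omega :: "cp1 \<Rightarrow> mvf \<Rightarrow> sym_alg" where
  "omega P X = (THE w. \<exists>ps. set ps \<subseteq> forms_K P \<times> forms_K P \<and>
     w = (\<Sum>(\<alpha>, \<beta>)\<leftarrow>ps. sym_incl \<alpha> * sym_incl \<beta>) \<and>
     (\<forall>u. coordinate u \<longrightarrow>
       (\<forall>z1 z2. z1 \<noteq> z2 \<longrightarrow> Pt z1 \<noteq> P \<longrightarrow> Pt z2 \<noteq> P \<longrightarrow>
          \<not> fun_pole (Pt z1) u \<longrightarrow> \<not> fun_pole (Pt z2) u \<longrightarrow>
          (\<Sum>(\<alpha>, \<beta>)\<leftarrow>ps. (mval \<alpha> z1 * mval \<beta> z2 + mval \<alpha> z2 * mval \<beta> z1) / 2)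
            = omega_coeff u X z1 z2)))"

definition X_plus_vac :: "cp1 \<Rightarrow> mvf \<Rightarrow> sym_alg" where
  "X_plus_vac P = (THE F.
     (\<forall>X Y. F (X + Y) = F X + F Y) \<and>
     (\<forall>c X. F (mconst c * X) = c \<bullet>\<^sub>S F X) \<and>
     (\<forall>X. vf_regular P X \<longrightarrow> F X = 0) \<and>
     (\<forall>X. (\<forall>Q. Q \<noteq> P \<longrightarrow> vf_regular Q X) \<longrightarrow> F X = omega P X))"

definition X_plus :: "cp1 \<Rightarrow> mvf \<Rightarrow> sym_alg \<Rightarrow> sym_alg" where
  "X_plus P X = operator_W P (\<lambda>\<alpha>s. X_plus_vac P X * sym_prod \<alpha>s)"

definition X_zero :: "cp1 \<Rightarrow> mvf \<Rightarrow> sym_alg \<Rightarrow> sym_alg" where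
  "X_zero P X = operator_W P (\<lambda>\<alpha>s.
     \<Sum>i<length \<alpha>s. sym_prod (\<alpha>s[i := principal_part P (lie_deriv X (\<alpha>s ! i))]))"

text \<open>Sign correction: the published formula has \<open>- Res\<close> here. Together with \<open>\<omega>\<^sub>X\<close> as
  above and counterclockwise residues this is inconsistent. Let \<open>u\<close> be a coordinate vanishing at
  \<open>O\<close>, \<open>X\<^sub>n = - u\<^sup>n\<^sup>+\<^sup>1 d/du\<close> and \<open>\<alpha> = u\<^sup>-\<^sup>2 du\<close>. With \<open>- Res\<close> one finds
  \<open>[L\<^sub>2, L\<^sub>-\<^sub>2] 1 = -1/2\<close> and \<open>[L\<^sub>2, L\<^sub>-\<^sub>2] \<alpha> = (3/2) \<alpha>\<close>, whereas \<open>L\<^sub>0 1 = 0\<close> and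
  \<open>L\<^sub>0 \<alpha> = \<alpha>\<close>, so \<open>[L\<^sub>2, L\<^sub>-\<^sub>2] = 4 L\<^sub>0 + c\<close> fails for every scalar \<open>c\<close>. With \<open>+ Res\<close> both
  values agree with \<open>c = 1/2\<close>.\<close>

definition X_minus :: "cp1 \<Rightarrow> mvf \<Rightarrow> sym_alg \<Rightarrow> sym_alg" where
  "X_minus P X = operator_W P (\<lambda>\<alpha>s.
     \<Sum>j<length \<alpha>s. \<Sum>i<j.
       form_residue P (contract X (\<alpha>s ! i) * \<alpha>s ! j)
         \<bullet>\<^sub>S (\<Prod>k\<in>{..<length \<alpha>s} - {i, j}. sym_incl (\<alpha>s ! k)))"

definition L_op :: "cp1 \<Rightarrow> mvf \<Rightarrow> sym_alg \<Rightarrow> sym_alg" where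
  "L_op P X w = X_minus P X w + X_zero P X w + X_plus P X w"

text \<open>For \<open>g d/du\<close>, expressed through the affine coordinate \<open>z\<close>: \<open>d/du = (1 / u') d/dz\<close>.\<close>

definition vf_in_coord :: "mero \<Rightarrow> mero \<Rightarrow> mvf" where
  "vf_in_coord u g = g / mderiv u"

end

(*
Every coordinate u is a Moebius function of z, by subtraction of the polar part and Liouville's
theorem. If u vanishes at O, the forms e_k = u^(-k-1) du with k >= 1 are a basis of the forms
regular outside O, with dual coordinates phi_k(eta) = Res_O(u^k eta), so the operators live on a
polynomial ring in the e_k. Laurent expansion at a point is an injective homomorphism from the
meromorphic functions to formal Laurent series, which turns all statements about poles and residues
into algebra. In these terms
  L_n = -1/2 sum_(a+b=n) d_a d_b + sum_(k>n) (k-n) e_(k-n) d_k - 1/2 sum_(a+b=-n) a b e_a e_b.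
The last sum is obtained in the coordinate 1/u, whose only pole is O, and the bidifferential does not
depend on the coordinate.

With the modes b_j = j e_j and b_(-j) = -d_j for j > 0 one has [L_n, b_j] = j b_(j-n) for all j.
Hence C = [L_l, L_m] - (l-m) L_(l+m) commutes with all b_j, so it is multiplication by C(1), and
all partial derivatives of C(1) vanish. Since C(1) is the sum of a constant and a quadratic
polynomial, it is that constant.
*)
theory Submission
  imports Defs
begin

text \<open>\<open>principal_part\<close>, \<open>omega\<close>, \<open>X_plus_vac\<close> and the
  operators are definite descriptions, so each needs a candidate and a uniqueness argument before it
  can be computed with. The symmetric algebra is a quotient for which no monomial basis is
  established here. Candidates for the operators are therefore built from derivations of the free
  algebra that vanish on the ideal, and identities between derivations are checked on the generators
  \<open>E k\<close>. Uniqueness of \<open>omega\<close> follows by applying the residue functionals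
  to a vanishing bidifferential, one variable at a time.

  The modes replace a direct commutation of quadratic expressions: moving \<open>L_l\<close> and
  \<open>L_m\<close> past \<open>b_j\<close> produces
  \<open>j (j - m) - j (j - l) = j (l - m)\<close> times \<open>b_(j-l-m)\<close>, which is the
  contribution of \<open>(l - m) L_(l+m)\<close>. Without a basis, vanishing partial derivatives do
  not readily give a constant; for quadratic elements Euler's relation does. The constant itself can
  only arise when a second-order part contracts both factors of a quadratic term, which gives
  \<open>1/2 sum_(0<a<n) a (n - a) = (n^3 - n)/12\<close>.\<close>

unbundle fps_syntax

section \<open>Laurent expansions of meromorphic functions and forms\<close>

text \<open>\<open>mk\<close> alters \<open>F\<close> only where \<open>F\<close> is not analytic. A
  cosparse set in the plane may omit points accumulating at infinity; the isolated singularity of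
  \<open>F (inverse t)\<close> at 0 excludes this.\<close>

lemma eventually_mval_mk_inverse:
  assumes "F \<in> meromorphic_cp1"
  shows "eventually (\<lambda>t. mval (mk F) (inverse t) = F (inverse t)) (at 0)"
proof -
  have "isolated_singularity_at (\<lambda>t. F (inverse t)) 0"
    using assms by (simp add: meromorphic_cp1_def meromorphic_at_iff)
  then obtain r where r: "r > 0" "(\<lambda>t. F (inverse t)) analytic_on ball 0 r - {0}"
    unfolding isolated_singularity_at_def by blast
  have eq: "mval (mk F) (inverse t) = F (inverse t)" if t: "t \<in> ball 0 r - {0}" for t
  proof -
    have "((\<lambda>t. F (inverse t)) \<circ> inverse) analytic_on {inverse t}"
    proof (rule analytic_on_compose)
      show "inverse analytic_on {inverse t}"
        using t by (intro analytic_intros) auto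
      show "(\<lambda>t. F (inverse t)) analytic_on inverse ` {inverse t}"
        using analytic_on_subset[OF r(2), of "{t}"] t by simp
    qed
    hence "F analytic_on {inverse t}"
      by (simp add: o_def)
    thus ?thesis by (simp add: mval_mk[OF assms])
  qed
  have "eventually (\<lambda>t. t \<in> ball 0 r - {0}) (at (0::complex))"
    using r(1) eventually_at_ball'[of r 0 UNIV] by (auto elim!: eventually_mono)
  thus ?thesis
    by (rule eventually_mono) (use eq in auto)
qed

primrec cp1_chart :: "cp1 \<Rightarrow> complex \<Rightarrow> complex" where
  "cp1_chart (Pt a) = (\<lambda>t. a + t)"
| "cp1_chart Infty = inverse"

lemma fun_at_chart: "fun_at Q f t = mval f (cp1_chart Q t)"
  by (cases Q) auto

lemma eventually_fun_at_mk:
  assumes "F \<in> meromorphic_cp1"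
  shows "eventually (\<lambda>t. fun_at Q (mk F) t = F (cp1_chart Q t)) (at 0)"
proof (cases Q)
  case (Pt a)
  have "eventually (\<lambda>z. mval (mk F) z = F z) (at a)"
    using mval_mk_eventually[OF assms] by (auto simp: eventually_cosparse_open_eq)
  thus ?thesis
    using Pt by (simp add: at_to_0[of a] eventually_filtermap add_ac)
qed (use eventually_mval_mk_inverse[OF assms] in simp)

lemma fun_at_meromorphic: "fun_at Q f meromorphic_on {0}"
proof (cases Q)
  case (Pt a)
  have "mval f meromorphic_on {a}"
    using mval_nice[of f] by (auto simp: nicely_meromorphic_on_def intro: meromorphic_on_subset)
  hence "(\<lambda>t. mval f (a + t)) meromorphic_on {0}"
    by (rule meromorphic_on_compose) (auto intro!: analytic_intros)
  thus ?thesis using Pt by simp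
qed (use mval_cp1[of f] in \<open>simp add: meromorphic_cp1_def\<close>)

definition laurent_at :: "cp1 \<Rightarrow> mero \<Rightarrow> complex fls" where
  "laurent_at Q f = laurent_expansion (fun_at Q f) 0"

lemma has_laurent_at: "fun_at Q f has_laurent_expansion laurent_at Q f"
  unfolding laurent_at_def using fun_at_meromorphic[of Q f]
  by (simp add: meromorphic_at_iff not_essential_has_laurent_expansion_0)

lemma laurent_at_eqI: "fun_at Q f has_laurent_expansion F \<Longrightarrow> laurent_at Q f = F"
  by (metis has_laurent_at has_laurent_expansion_unique)

lemma laurent_at_mk:
  assumes "F \<in> meromorphic_cp1" "(\<lambda>t. F (cp1_chart Q t)) has_laurent_expansion G"
  shows "laurent_at Q (mk F) = G"
proof (rule laurent_at_eqI)
  show "fun_at Q (mk F) has_laurent_expansion G"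
    using assms(2) has_laurent_expansion_cong[OF eventually_fun_at_mk[OF assms(1)] refl] by blast
qed

lemma chart_has_laurent_at: "(\<lambda>t. mval f (cp1_chart Q t)) has_laurent_expansion laurent_at Q f"
  using has_laurent_at[of Q f] by (simp add: fun_at_chart[abs_def])

lemma laurent_at_const [simp]: "laurent_at Q (mconst c) = fls_const c"
  unfolding mconst_def by (rule laurent_at_mk) (auto intro: mero_const)

lemma mconst_0 [simp]: "mconst 0 = 0" and mconst_1 [simp]: "mconst 1 = 1"
  by (simp_all add: mconst_def zero_mero_def one_mero_def)

lemma mconst_add: "mconst (a + b) = mconst a + mconst b"
  and mconst_mult: "mconst (a * b) = mconst a * mconst b"
  and mconst_minus: "mconst (- a) = - mconst a"
  and mconst_diff: "mconst (a - b) = mconst a - mconst b"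
  and mconst_inverse: "mconst (inverse a) = inverse (mconst a)"
  by (simp_all add: mconst_def plus_mero_def times_mero_def uminus_mero_def minus_mero_def
      inverse_mero_def)

lemma mval_mconst [simp]: "mval (mconst c) z = c"
  by (simp add: mconst_def)

lemma mconst_eq_iff [simp]: "mconst a = mconst b \<longleftrightarrow> a = b"
  by (metis mval_mconst)

lemma mconst_eq_0_iff [simp]: "mconst a = 0 \<longleftrightarrow> a = 0"
  using mconst_eq_iff[of a 0] by simp

lemma laurent_at_0 [simp]: "laurent_at Q 0 = 0" and laurent_at_1 [simp]: "laurent_at Q 1 = 1"
  using laurent_at_const[of Q 0] laurent_at_const[of Q 1] by simp_all

lemma laurent_at_add [simp]: "laurent_at Q (f + g) = laurent_at Q f + laurent_at Q g"
  unfolding plus_mero_def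
  by (rule laurent_at_mk) (intro mero_binop mval_cp1 laurent_expansion_intros chart_has_laurent_at)+

lemma laurent_at_diff [simp]: "laurent_at Q (f - g) = laurent_at Q f - laurent_at Q g"
  unfolding minus_mero_def
  by (rule laurent_at_mk) (intro mero_binop mval_cp1 laurent_expansion_intros chart_has_laurent_at)+

lemma laurent_at_minus [simp]: "laurent_at Q (- f) = - laurent_at Q f"
  unfolding uminus_mero_def
  by (rule laurent_at_mk) (intro mero_unop mval_cp1 laurent_expansion_intros chart_has_laurent_at)+

lemma laurent_at_mult [simp]: "laurent_at Q (f * g) = laurent_at Q f * laurent_at Q g"
  unfolding times_mero_def
  by (rule laurent_at_mk) (intro mero_binop mval_cp1 laurent_expansion_intros chart_has_laurent_at)+

lemma laurent_at_inverse [simp]: "laurent_at Q (inverse f) = inverse (laurent_at Q f)"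
  unfolding inverse_mero_def
  by (rule laurent_at_mk) (intro mero_unop mval_cp1 laurent_expansion_intros chart_has_laurent_at)+

lemma laurent_at_power [simp]: "laurent_at Q (f ^ n) = laurent_at Q f ^ n"
  by (induction n) auto

lemma laurent_at_power_int [simp]: "laurent_at Q (f powi n) = laurent_at Q f powi n"
  by (auto simp: power_int_def)

lemma laurent_at_sum [simp]: "laurent_at Q (sum f A) = (\<Sum>i\<in>A. laurent_at Q (f i))"
  by (induction A rule: infinite_finite_induct) auto

text \<open>A homomorphism from a field that sends 1 to 1 is injective. This is the identity theorem
  in algebraic form: the expansion at any single point determines the function.\<close>

lemma laurent_at_eq_0_iff [simp]: "laurent_at Q f = 0 \<longleftrightarrow> f = 0"
proof (rule iffI, rule ccontr)
  assume "laurent_at Q f = 0" "f \<noteq> 0"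
  hence "laurent_at Q (f * inverse f) = 0"
    by (simp only: laurent_at_mult mult_zero_left)
  moreover have "f * inverse f = 1" using \<open>f \<noteq> 0\<close> by (rule right_inverse)
  ultimately show False by simp
qed simp

lemma laurent_at_eq_iff [simp]: "laurent_at Q f = laurent_at Q g \<longleftrightarrow> f = g"
  using laurent_at_eq_0_iff[of Q "f - g"] by simp

text \<open>The expansion of \<open>dz/dt\<close> in the chart at \<open>Q\<close>. Coefficients of
  1-forms are multiplied by it, those of vector fields divided by it.\<close>

definition chart_deriv :: "cp1 \<Rightarrow> complex fls" where
  "chart_deriv Q = (case Q of Pt _ \<Rightarrow> 1 | Infty \<Rightarrow> - (fls_X_inv ^ 2))"

lemma chart_deriv_nonzero [simp]: "chart_deriv Q \<noteq> 0"
  by (auto simp: chart_deriv_def split: cp1.splits)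

lemma divide_chart_deriv_Infty: "F / chart_deriv Infty = - (fls_X ^ 2) * F"
proof -
  have "fls_X * fls_X_inv = (1 :: complex fls)"
    by (simp add: fls_X_times_conv_shift)
  hence "chart_deriv Infty * fls_X ^ 2 = - 1"
    by (simp add: chart_deriv_def mult.commute flip: power_mult_distrib)
  hence "- (fls_X ^ 2) * F * chart_deriv Infty = F"
    by (simp add: mult_ac)
  thus ?thesis
    by (subst nonzero_divide_eq_eq) (simp_all only: chart_deriv_nonzero not_False_eq_True)
qed

lemma X_inv_laurent: "inverse has_laurent_expansion (fls_X_inv :: complex fls)"
  using has_laurent_expansion_inverse[OF has_laurent_expansion_fps_X]
  by (simp add: fls_inverse_X)

lemma form_at_laurent: "form_at Q \<alpha> has_laurent_expansion laurent_at Q \<alpha> * chart_deriv Q"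
proof (cases Q)
  case (Pt a)
  thus ?thesis using has_laurent_at[of Q \<alpha>] by (simp add: chart_deriv_def)
next
  case Infty
  have "(\<lambda>t. fun_at Infty \<alpha> t * (- (inverse t ^ 2))) has_laurent_expansion
      laurent_at Infty \<alpha> * (- (fls_X_inv ^ 2))"
    by (intro laurent_expansion_intros has_laurent_at X_inv_laurent)
  thus ?thesis using Infty
    by (simp add: chart_deriv_def field_simps)
qed

lemma vf_at_laurent: "vf_at Q X has_laurent_expansion laurent_at Q X / chart_deriv Q"
proof (cases Q)
  case (Pt a)
  thus ?thesis using has_laurent_at[of Q X] by (simp add: chart_deriv_def)
next
  case Infty
  have "(\<lambda>t. - (t ^ 2) * fun_at Infty X t) has_laurent_expansion
      - (fls_X ^ 2) * laurent_at Infty X"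
    by (intro laurent_expansion_intros has_laurent_at)
  thus ?thesis using Infty
    by (simp add: divide_chart_deriv_Infty)
qed

lemma fun_pole_iff: "fun_pole Q f \<longleftrightarrow> fls_subdegree (laurent_at Q f) < 0"
  unfolding fun_pole_def
  by (rule has_laurent_expansion_imp_is_pole_iff) (simp add: has_laurent_at)

lemma form_regular_iff: "form_regular Q \<alpha> \<longleftrightarrow> fls_subdegree (laurent_at Q \<alpha> * chart_deriv Q) \<ge> 0"
  unfolding form_regular_def
  using has_laurent_expansion_imp_is_pole_iff[of "form_at Q \<alpha>" 0] form_at_laurent[of Q \<alpha>]
  by (simp add: not_less)

lemma vf_regular_iff: "vf_regular Q X \<longleftrightarrow> fls_subdegree (laurent_at Q X / chart_deriv Q) \<ge> 0"
  unfolding vf_regular_def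
  using has_laurent_expansion_imp_is_pole_iff[of "vf_at Q X" 0] vf_at_laurent[of Q X]
  by (simp add: not_less)

lemma form_residue_laurent: "form_residue Q \<alpha> = fls_residue (laurent_at Q \<alpha> * chart_deriv Q)"
  unfolding form_residue_def
  by (rule has_laurent_expansion_residue_0[OF form_at_laurent])

text \<open>The chain rule \<open>df/dt = (df/dz) (dz/dt)\<close>. In this form it treats finite
  points and infinity alike and exhibits the form \<open>df\<close> as a formal derivative, so that
  its residues vanish.\<close>

lemma laurent_at_mderiv: "laurent_at Q (mderiv f) * chart_deriv Q = fls_deriv (laurent_at Q f)"
proof (cases Q)
  case (Pt a)
  have "laurent_at Q (mderiv f) = fls_deriv (laurent_at Q f)"
    unfolding mderiv_def
  proof (rule laurent_at_mk)
    have "deriv (fun_at Q f) has_laurent_expansion fls_deriv (laurent_at Q f)"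
      by (intro laurent_expansion_intros has_laurent_at)
    moreover have "deriv (\<lambda>t. mval f (a + t)) = (\<lambda>t. deriv (mval f) (a + t))"
      by (rule ext) (simp add: deriv_shift_0' o_def add_ac)
    ultimately show "(\<lambda>t. deriv (mval f) (cp1_chart Q t)) has_laurent_expansion
        fls_deriv (laurent_at Q f)"
      using Pt by simp
  qed (intro mero_deriv mval_cp1)
  thus ?thesis using Pt by (simp add: chart_deriv_def)
next
  case Infty
  define g where "g = fun_at Infty f"
  have g: "g has_laurent_expansion laurent_at Infty f" unfolding g_def by (rule has_laurent_at)
  have "isolated_singularity_at g 0" using g has_laurent_expansion_isolated_0 by blast
  then obtain r where r: "r > 0" "g analytic_on ball 0 r - {0}"
    unfolding isolated_singularity_at_def by blast
  have eq: "deriv (mval f) (inverse t) = - (t ^ 2) * deriv g t" if t: "t \<in> ball 0 r - {0}" for t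
  proof -
    have "g analytic_on {t}" using r(2) t analytic_on_subset by blast
    hence dg: "(g has_field_derivative deriv g t) (at (inverse (inverse t)))"
      using analytic_derivI[of g t UNIV] by simp
    have di: "(inverse has_field_derivative - (t^2)) (at (inverse t))"
      using DERIV_inverse[of "inverse t"] t by (simp add: power_inverse numeral_2_eq_2)
    have "((\<lambda>w. g (inverse w)) has_field_derivative deriv g t * (- (t^2))) (at (inverse t))"
      by (rule DERIV_chain2[OF dg di])
    hence "(mval f has_field_derivative deriv g t * (- (t^2))) (at (inverse t))"
      by (simp add: g_def)
    thus ?thesis by (simp add: DERIV_imp_deriv)
  qed
  have "eventually (\<lambda>t. t \<in> ball 0 r - {0}) (at (0::complex))"
    using r(1) eventually_at_ball'[of r 0 UNIV] by (auto elim!: eventually_mono)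
  hence ev: "eventually (\<lambda>t. deriv (mval f) (inverse t) = - (t ^ 2) * deriv g t) (at 0)"
    by (rule eventually_mono) (use eq in auto)
  have "laurent_at Infty (mderiv f) = - (fls_X ^ 2) * fls_deriv (laurent_at Infty f)"
    unfolding mderiv_def
  proof (rule laurent_at_mk)
    have "(\<lambda>t. - (t ^ 2) * deriv g t) has_laurent_expansion
        - (fls_X ^ 2) * fls_deriv (laurent_at Infty f)"
      by (intro laurent_expansion_intros g)
    thus "(\<lambda>t. deriv (mval f) (cp1_chart Infty t)) has_laurent_expansion
        - (fls_X ^ 2) * fls_deriv (laurent_at Infty f)"
      using has_laurent_expansion_cong[OF ev refl] by simp
  qed (intro mero_deriv mval_cp1)
  hence "laurent_at Infty (mderiv f) = fls_deriv (laurent_at Infty f) / chart_deriv Infty"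
    by (simp only: divide_chart_deriv_Infty)
  thus ?thesis using Infty
    by (metis nonzero_eq_divide_eq chart_deriv_nonzero)
qed

lemma laurent_at_mderiv': "laurent_at Q (mderiv f) = fls_deriv (laurent_at Q f) / chart_deriv Q"
  using laurent_at_mderiv[of Q f] by (simp add: field_simps)

text \<open>Comparing expansions at one point suffices, so the rules for \<open>mderiv\<close> are
  inherited from \<open>fls_deriv\<close>.\<close>

lemma mderiv_eqI:
  assumes "fls_deriv (laurent_at Infty f) / chart_deriv Infty = laurent_at Infty g"
  shows "mderiv f = g"
  by (rule laurent_at_eq_iff[of Infty, THEN iffD1]) (simp add: laurent_at_mderiv' assms)

lemma mderiv_const [simp]: "mderiv (mconst c) = 0"
  by (rule mderiv_eqI) simp

lemma mderiv_add: "mderiv (f + g) = mderiv f + mderiv g"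
  by (rule mderiv_eqI) (simp add: laurent_at_mderiv' add_divide_distrib)

lemma mderiv_mult: "mderiv (f * g) = f * mderiv g + mderiv f * g"
  by (rule mderiv_eqI) (simp add: laurent_at_mderiv' field_simps)

section \<open>Coordinates on the projective line\<close>

lemma fls_integral_iff: "fls_subdegree F \<ge> 0 \<longleftrightarrow> (\<forall>k<0. F $$ k = 0)"
  using fls_subdegree_ge0I[of F] by (auto intro: fls_eq0_below_subdegree)

lemma fls_integral_add: "fls_subdegree F \<ge> 0 \<Longrightarrow> fls_subdegree G \<ge> 0 \<Longrightarrow> fls_subdegree (F + G) \<ge> 0"
  and fls_integral_diff: "fls_subdegree F \<ge> 0 \<Longrightarrow> fls_subdegree G \<ge> 0 \<Longrightarrow> fls_subdegree (F - G) \<ge> 0"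
  for F G :: "complex fls"
  by (simp_all add: fls_integral_iff)

lemma fls_integral_power: "fls_subdegree F \<ge> 0 \<Longrightarrow> fls_subdegree (F ^ n) \<ge> 0"
  for F :: "complex fls"
  by (simp add: fls_subdegree_pow)

lemma fls_integral_sum:
  "(\<And>i. i \<in> A \<Longrightarrow> fls_subdegree (F i) \<ge> 0) \<Longrightarrow> fls_subdegree (sum F A) \<ge> 0"
  for F :: "'a \<Rightarrow> complex fls"
  by (induction A rule: infinite_finite_induct) (auto intro: fls_integral_add)

text \<open>The leading term of \<open>R ^ i\<close> has degree exactly \<open>- i\<close>, so a
  multiple of the top power lowers the pole order by one at each step.\<close>

lemma fls_polar_part:
  fixes F R :: "complex fls"
  assumes R: "fls_subdegree R = -1"
  shows "\<exists>N c. fls_subdegree (F - (\<Sum>i=1..N. fls_const (c i) * R ^ i)) \<ge> 0"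
proof -
  have *: "\<exists>c. fls_subdegree (G - (\<Sum>i=1..N. fls_const (c i) * R ^ i)) \<ge> 0"
    if "\<forall>k < - int N. G $$ k = 0" for N and G :: "complex fls"
    using that
  proof (induction N arbitrary: G)
    case 0
    thus ?case by (simp add: fls_integral_iff)
  next
    case (Suc N)
    have R0: "R \<noteq> 0" using R by auto
    have sub: "fls_subdegree (R ^ Suc N) = - int (Suc N)"
      unfolding fls_subdegree_pow R by simp
    define d where "d = (R ^ Suc N) $$ (- int (Suc N))"
    have d: "d \<noteq> 0"
      unfolding d_def using nth_fls_subdegree_nonzero[of "R ^ Suc N"] R0 sub
      by (metis power_not_zero)
    define a where "a = G $$ (- int (Suc N)) / d"
    have "\<forall>k < - int N. (G - fls_const a * R ^ Suc N) $$ k = 0"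
    proof (intro allI impI)
      fix k assume "k < - int N"
      show "(G - fls_const a * R ^ Suc N) $$ k = 0"
      proof (cases "k = - int (Suc N)")
        case True
        thus ?thesis using d by (simp add: a_def d_def)
      next
        case False
        hence k: "k < - int (Suc N)" using \<open>k < - int N\<close> by simp
        hence "(R ^ Suc N) $$ k = 0" using sub by (intro fls_eq0_below_subdegree) linarith
        thus ?thesis using Suc.prems k by simp
      qed
    qed
    from Suc.IH[OF this] obtain c where
      c: "fls_subdegree (G - fls_const a * R ^ Suc N - (\<Sum>i=1..N. fls_const (c i) * R ^ i)) \<ge> 0"
      by blast
    have "(\<Sum>i=1..Suc N. fls_const ((c(Suc N := a)) i) * R ^ i) =
        fls_const a * R ^ Suc N + (\<Sum>i=1..N. fls_const (c i) * R ^ i)"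
      by (simp add: add.commute)
    hence "G - (\<Sum>i=1..Suc N. fls_const ((c(Suc N := a)) i) * R ^ i) =
        G - fls_const a * R ^ Suc N - (\<Sum>i=1..N. fls_const (c i) * R ^ i)"
      by (simp only: diff_diff_eq)
    thus ?case using c by metis
  qed
  obtain m where m: "\<forall>k < - m. F $$ k = 0"
    by (metis fls_eq0_below_subdegree minus_minus)
  have "\<forall>k < - int (nat m). F $$ k = 0" using m by auto
  from *[OF this] show ?thesis by blast
qed

lemma no_poles_imp_const:
  assumes "\<And>Q. fls_subdegree (laurent_at Q f) \<ge> 0"
  shows "\<exists>c. f = mconst c"
proof -
  have np: "\<not> fun_pole Q f" for Q using assms[of Q] by (simp add: fun_pole_iff)
  have "mval f analytic_on {a}" for a
  proof -
    have "\<not> is_pole (mval f) a"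
      using np[of "Pt a"] is_pole_shift_0[of "mval f" a] by (simp add: fun_pole_def)
    thus ?thesis
      using mval_nice[of f] by (intro nicely_meromorphic_on_imp_analytic_at) auto
  qed
  hence holo: "mval f holomorphic_on UNIV"
    by (meson UNIV_I analytic_imp_holomorphic analytic_on_analytic_at)
  define c where "c = laurent_at Infty f $$ 0"
  have "(fun_at Infty f \<longlongrightarrow> c) (at 0)"
    unfolding c_def using has_laurent_expansion_imp_tendsto_0[OF has_laurent_at assms] .
  hence "(mval f \<longlongrightarrow> c) at_infinity"
    by (simp add: lim_at_infinity_0 o_def)
  hence "mval f z = c" for z
    using Liouville_weak[OF holo] by blast
  hence "mval f = mval (mconst c)" by auto
  thus ?thesis by (auto simp: mval_inject)
qed

section \<open>Coordinates with a prescribed pole\<close>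

definition affine_coord :: mero where
  "affine_coord = mk (\<lambda>z. z)"

lemma affine_coord_cp1: "(\<lambda>z. z) \<in> meromorphic_cp1"
  by (auto simp: meromorphic_cp1_def intro!: meromorphic_intros)

lemma mval_affine_coord [simp]: "mval affine_coord z = z"
  by (simp add: affine_coord_def mval_mk[OF affine_coord_cp1])

lemma laurent_affine_coord_Pt: "laurent_at (Pt a) affine_coord = fls_const a + fls_X"
  unfolding affine_coord_def
  by (rule laurent_at_mk[OF affine_coord_cp1], simp only: cp1_chart.simps,
      intro laurent_expansion_intros)

lemma laurent_affine_coord_Infty: "laurent_at Infty affine_coord = fls_X_inv"
  unfolding affine_coord_def
  by (rule laurent_at_mk[OF affine_coord_cp1], simp only: cp1_chart.simps, rule X_inv_laurent)

lemmas laurent_affine_coord = laurent_affine_coord_Pt laurent_affine_coord_Infty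

text \<open>Normalised so that the expansion at the pole \<open>Q\<close> is exactly
  \<open>fls_X_inv\<close>; any other coordinate with this pole is affine in it.\<close>

definition std_coord :: "cp1 \<Rightarrow> mero" where
  "std_coord Q = (case Q of Pt a \<Rightarrow> inverse (affine_coord - mconst a) | Infty \<Rightarrow> affine_coord)"

lemma laurent_std_coord [simp]: "laurent_at Q (std_coord Q) = fls_X_inv"
  by (auto simp: std_coord_def laurent_affine_coord fls_inverse_X split: cp1.splits)

lemma affine_coord_neq_const [simp]: "affine_coord \<noteq> mconst a"
proof
  assume "affine_coord = mconst a"
  hence "mval affine_coord (a + 1) = mval (mconst a) (a + 1)" by simp
  thus False by simp
qed

text \<open>Away from its pole a coordinate is a local chart, so its differential has neither zero
  nor pole there. This later permits division by \<open>dr\<close> without loss of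
  regularity.\<close>

lemma std_coord_away:
  assumes "Q \<noteq> P"
  shows "fls_subdegree (laurent_at Q (std_coord P)) \<ge> 0"
    and "fls_subdegree (fls_deriv (laurent_at Q (std_coord P))) = 0"
    and "fls_deriv (laurent_at Q (std_coord P)) \<noteq> 0"
proof -
  have *: "fls_subdegree F \<ge> 0 \<and> fls_subdegree (fls_deriv F) = 0 \<and> fls_deriv F \<noteq> 0"
    if F: "F = laurent_at Q (std_coord P)" for F
  proof (cases P)
    case Infty
    then obtain b where "Q = Pt b" using assms by (cases Q) auto
    hence "F = fls_const b + fls_X" using F Infty by (simp add: std_coord_def laurent_affine_coord)
    thus ?thesis by (simp add: fls_integral_add)
  next
    case P: (Pt a)
    show ?thesis
    proof (cases Q)
      case (Pt b)
      define G where "G = fls_const (b - a) + fls_X"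
      have FG: "F = inverse G"
        using F P Pt by (simp add: std_coord_def laurent_affine_coord G_def algebra_simps
            flip: fls_minus_const)
      have G: "G $$ 0 \<noteq> 0" "fls_subdegree G = 0"
        using assms P Pt by (auto simp: G_def intro!: fls_subdegree_eqI)
      hence "G \<noteq> 0" by auto
      moreover have "fls_deriv G = 1" by (simp add: G_def)
      ultimately show ?thesis using G
        by (simp add: FG fls_inverse_deriv fls_subdegree_pow)
    next
      case Infty
      define G :: "complex fls" where "G = fls_X_inv - fls_const a"
      have FG: "F = inverse G"
        using F P Infty by (simp add: std_coord_def laurent_affine_coord G_def)
      have G: "G $$ (-1) \<noteq> 0" "fls_subdegree G = -1"
        by (auto simp: G_def intro!: fls_subdegree_eqI)
      hence "G \<noteq> 0" by auto
      moreover have "fls_deriv G = - (fls_X_inv ^ 2)" by (simp add: G_def)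
      ultimately show ?thesis using G
        by (simp add: FG fls_inverse_deriv fls_subdegree_pow)
    qed
  qed
  from * show "fls_subdegree (laurent_at Q (std_coord P)) \<ge> 0"
    and "fls_subdegree (fls_deriv (laurent_at Q (std_coord P))) = 0"
    and "fls_deriv (laurent_at Q (std_coord P)) \<noteq> 0" by blast+
qed

lemma coordinate_affine:
  assumes "coordinate v"
  obtains Q a b where "b \<noteq> 0" "v = mconst a + mconst b * std_coord Q"
proof -
  obtain Q where Q: "fun_pole Q v" "zorder (fun_at Q v) 0 = -1" "\<And>Q'. Q' \<noteq> Q \<Longrightarrow> \<not> fun_pole Q' v"
    using assms unfolding coordinate_def by blast
  have "laurent_at Q v \<noteq> 0" using Q(1) by (auto simp: fun_pole_iff)
  hence sub: "fls_subdegree (laurent_at Q v) = -1"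
    using has_laurent_expansion_zorder_0[OF has_laurent_at] Q(2) by simp
  define b where "b = laurent_at Q v $$ (-1)"
  have b: "b \<noteq> 0"
    using nth_fls_subdegree_nonzero[OF \<open>laurent_at Q v \<noteq> 0\<close>] sub by (simp add: b_def)
  have "fls_subdegree (laurent_at Q' (v - mconst b * std_coord Q)) \<ge> 0" for Q'
  proof (cases "Q' = Q")
    case True
    show ?thesis unfolding fls_integral_iff
    proof (intro allI impI)
      fix k :: int assume "k < 0"
      hence "k = -1 \<or> k < fls_subdegree (laurent_at Q v)" using sub by auto
      thus "laurent_at Q' (v - mconst b * std_coord Q) $$ k = 0"
        using True by (auto simp: b_def sub)
    qed
  next
    case False
    thus ?thesis
      using Q(3)[OF False] std_coord_away(1)[OF False]
      by (auto simp: fun_pole_iff not_less intro!: fls_integral_diff fls_mult_subdegree_ge_0)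
  qed
  then obtain a where "v - mconst b * std_coord Q = mconst a"
    using no_poles_imp_const by blast
  hence "v = mconst a + mconst b * std_coord Q" by (simp add: algebra_simps)
  with b that show ?thesis by blast
qed

text \<open>The zero of a Moebius function is the pole of its inverse. The condition
  \<open>u = 0\<close> at \<open>P\<close> determines the additive constant \<open>c\<close> from
  \<open>d\<close>, and partial fractions give the result in each relative position of the pole
  \<open>Q\<close> and the zero \<open>P\<close>.\<close>

lemma inverse_coordinate_affine:
  assumes "coordinate u" "vanishes_at P u"
  obtains a b where "b \<noteq> 0" "inverse u = mconst a + mconst b * std_coord P"
proof -
  obtain Q c d where d: "d \<noteq> 0" and u: "u = mconst c + mconst d * std_coord Q"
    using coordinate_affine[OF assms(1)] .
  have lim: "(fun_at P u \<longlongrightarrow> 0) (at 0)" using assms(2) by (simp add: vanishes_at_def)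
  have "\<not> is_pole (fun_at P u) 0"
    using lim not_tendsto_and_filterlim_at_infinity[OF at_neq_bot] by (auto simp: is_pole_def)
  hence reg: "fls_subdegree (laurent_at P u) \<ge> 0"
    using fun_pole_iff[of P u] by (simp add: fun_pole_def)
  have QP: "P \<noteq> Q"
  proof
    assume "P = Q"
    hence "laurent_at P u $$ (-1) = d" using u by simp
    thus False using reg d fls_integral_iff[of "laurent_at P u"] by simp
  qed
  have u0: "laurent_at P u $$ 0 = 0"
    using tendsto_unique[OF _ has_laurent_expansion_imp_tendsto_0[OF has_laurent_at reg] lim]
    by simp
  show thesis
  proof (cases P)
    case Infty
    then obtain a where Q: "Q = Pt a" using QP by (cases Q) auto
    have "fls_subdegree (inverse (fls_X_inv - fls_const a)) = 1"
      by (subst fls_inverse_subdegree) (auto intro!: fls_subdegree_eqI)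
    hence "inverse (fls_X_inv - fls_const a) $$ 0 = 0" by simp
    hence "c = 0" using u0 u Q Infty by (simp add: std_coord_def laurent_affine_coord)
    hence "inverse u = mconst (- a / d) + mconst (inverse d) * std_coord P"
      using u Q Infty d by (simp add: std_coord_def mconst_inverse divide_inverse mconst_mult mconst_minus
          algebra_simps)
    thus thesis using d that[of "inverse d"] by simp
  next
    case P: (Pt b)
    show thesis
    proof (cases Q)
      case Infty
      hence "c = - d * b" using u0 u P by (simp add: std_coord_def laurent_affine_coord add_eq_0_iff)
      hence "u = mconst d * (affine_coord - mconst b)"
        using u Infty by (simp add: std_coord_def mconst_mult mconst_minus algebra_simps)
      hence "inverse u = mconst 0 + mconst (inverse d) * std_coord P"
        using P by (simp add: std_coord_def mconst_inverse)
      thus thesis using d that[of "inverse d" 0] by simp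
    next
      case (Pt a)
      define e where "e = b - a"
      have e: "e \<noteq> 0" using QP P Pt by (auto simp: e_def)
      have "inverse (fls_const e + fls_X) $$ 0 = inverse e"
      proof -
        have s: "fls_subdegree (fls_const e + fls_X) = 0"
          using e by (intro fls_subdegree_eqI) auto
        have "inverse (fls_const e + fls_X) $$ (- fls_subdegree (fls_const e + fls_X)) = inverse ((fls_const e + fls_X) $$ fls_subdegree (fls_const e + fls_X))"
          by (rule fls_inverse_base) (use e in \<open>auto simp: fls_eq_iff intro!: exI[of _ 0]\<close>)
        thus ?thesis using s by simp
      qed
      moreover have "fls_const b + fls_X - fls_const a = fls_const e + fls_X"
        by (simp add: e_def algebra_simps flip: fls_minus_const)
      moreover have "laurent_at P u $$ 0 = c + d * inverse (fls_const b + fls_X - fls_const a) $$ 0"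
        using u P Pt by (simp add: std_coord_def laurent_affine_coord)
      ultimately have "c + d * inverse e = 0" using u0 by (simp only:)
      hence c: "c = - d / e" by (simp add: add_eq_0_iff divide_inverse)
      define A where "A = affine_coord - mconst a"
      define B where "B = affine_coord - mconst b"
      define E where "E = mconst e"
      define D where "D = mconst d"
      have nz: "A \<noteq> 0" "B \<noteq> 0" "D \<noteq> 0" "E \<noteq> 0" by (simp_all add: A_def B_def D_def E_def d e)
      have AB: "A = B + E" by (simp add: A_def B_def E_def e_def mconst_diff)
      have "u = - D / E + D / A"
        using u c Pt by (simp add: std_coord_def A_def D_def E_def mconst_minus mconst_mult
            mconst_inverse divide_inverse field_class.field_divide_inverse)
      also have "\<dots> = - D * B / (E * A)"
        using nz AB by (simp add: field_simps)
      finally have u': "u = - D * B / (E * A)" .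
      have "inverse u = - E * A / (D * B)"
        unfolding u' using nz by (simp add: field_simps)
      also have "\<dots> = - E / D + (- (E ^ 2) / D) * inverse B"
        using nz by (simp add: AB field_simps power2_eq_square)
      also have "\<dots> = mconst (- e / d) + mconst (- (e ^ 2) / d) * std_coord P"
        using P by (simp add: std_coord_def B_def D_def E_def mconst_minus mconst_mult power2_eq_square
            mconst_inverse divide_inverse field_class.field_divide_inverse)
      finally show thesis using d e that[of "- (e ^ 2) / d"] by simp
    qed
  qed
qed

section \<open>A coordinate vanishing at the base point\<close>

text \<open>Stated for an arbitrary map with the Leibniz rule because it serves both
  \<open>fls_deriv\<close> and \<open>mderiv\<close>.\<close>

lemma derivation_power_int:
  fixes D :: "'a :: field \<Rightarrow> 'a"
  assumes D: "\<And>x y. D (x * y) = x * D y + D x * y" and x: "x \<noteq> 0"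
  shows "D (x powi n) = of_int n * x powi (n - 1) * D x"
proof (induction n rule: int_induct[where k = 0])
  case base
  have "D 1 + D 1 = D 1 + 0" using D[of 1 1] by simp
  hence "D 1 = 0" by (rule add_left_imp_eq)
  thus ?case by simp
next
  case (step1 i)
  have "D (x powi (i + 1)) = x powi i * D x + D (x powi i) * x"
    using x by (simp add: power_int_add_1 D)
  also have "\<dots> = x powi i * D x + of_int i * (x powi (i - 1) * x) * D x"
    by (simp add: step1.IH algebra_simps)
  also have "x powi (i - 1) * x = x powi i"
    using x power_int_add_1[of x "i - 1"] by simp
  finally show ?case by (simp add: algebra_simps)
next
  case (step2 i)
  have i: "x powi (i - 1) * x = x powi i" "x powi (i - 2) * x = x powi (i - 1)"
    using x power_int_add_1[of x "i - 1"] power_int_add_1[of x "i - 2"] by simp_all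
  have "of_int i * x powi (i - 1) * D x = x powi (i - 1) * D x + D (x powi (i - 1)) * x"
    using D[of "x powi (i - 1)" x] step2.IH by (simp add: i)
  hence "D (x powi (i - 1)) * x = (of_int i - 1) * x powi (i - 1) * D x"
    by (simp add: algebra_simps)
  also have "\<dots> = ((of_int i - 1) * x powi (i - 2) * D x) * x"
    by (simp add: i(2)[symmetric])
  finally show ?case using x by simp
qed

text \<open>For \<open>m \<noteq> -1\<close> the series is a multiple of the derivative of
  \<open>U powi (m + 1)\<close> and has no residue. For \<open>m = -1\<close> it is a logarithmic
  derivative, whose residue is the order 1 of the zero.\<close>

lemma fls_residue_power_int_deriv:
  fixes U :: "complex fls"
  assumes "fls_subdegree U = 1"
  shows "fls_residue (U powi m * fls_deriv U) = (if m = -1 then 1 else 0)"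
proof (cases "m = -1")
  case True
  thus ?thesis
    using fls_residue_deriv_times_inverse_eq_subdegree(2)[of U] assms by (simp add: power_int_minus)
next
  case False
  have "U \<noteq> 0" using assms by auto
  hence "fls_deriv (U powi (m + 1)) = of_int (m + 1) * U powi (m + 1 - 1) * fls_deriv U"
    by (intro derivation_power_int) (simp_all add: add.commute mult.commute)
  hence "fls_deriv (U powi (m + 1)) = of_int (m + 1) * (U powi m * fls_deriv U)"
    by (simp add: mult.assoc)
  hence "of_int (m + 1) * fls_residue (U powi m * fls_deriv U) = 0"
    by (metis fls_residue_of_int_times(1) fls_residue_deriv)
  moreover have "of_int (m + 1) \<noteq> (0 :: complex)"
    using False by (metis add.commute add_eq_0_iff of_int_eq_0_iff)
  ultimately show ?thesis using False by simp
qed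

lemma form_residue_add: "form_residue Q (\<alpha> + \<beta>) = form_residue Q \<alpha> + form_residue Q \<beta>"
  and form_residue_diff: "form_residue Q (\<alpha> - \<beta>) = form_residue Q \<alpha> - form_residue Q \<beta>"
  and form_residue_scale: "form_residue Q (mconst c * \<alpha>) = c * form_residue Q \<alpha>"
  by (simp_all add: form_residue_laurent ring_distribs mult.assoc)

lemma form_residue_0 [simp]: "form_residue Q 0 = 0"
  by (simp add: form_residue_laurent)

lemma form_residue_sum: "form_residue Q (sum f A) = (\<Sum>i\<in>A. form_residue Q (f i))"
  by (induction A rule: infinite_finite_induct) (simp_all add: form_residue_add)

lemma form_regular_imp_residue_0: "form_regular Q \<alpha> \<Longrightarrow> form_residue Q \<alpha> = 0"
  by (simp add: form_regular_iff form_residue_laurent)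

lemma mderiv_power_int: "f \<noteq> 0 \<Longrightarrow> mderiv (f powi n) = of_int n * f powi (n - 1) * mderiv f"
  by (rule derivation_power_int[OF mderiv_mult])

lemma mconst_of_nat: "mconst (of_nat n) = of_nat n"
  by (induction n) (simp_all add: mconst_add)

lemma mconst_of_int: "mconst (of_int n) = of_int n"
  by (cases n) (simp_all add: mconst_of_nat mconst_minus mconst_diff)

locale vanishing_coordinate =
  fixes P :: cp1 and u :: mero
  assumes coord: "coordinate u" and vanish: "vanishes_at P u"
begin

definition r :: mero where "r = inverse u"

lemma r_affine: obtains a b where "b \<noteq> 0" "r = mconst a + mconst b * std_coord P"
  using inverse_coordinate_affine[OF coord vanish] unfolding r_def by blast

lemma laurent_r: "fls_subdegree (laurent_at P r) = -1"
proof -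
  obtain a b where "b \<noteq> 0" "r = mconst a + mconst b * std_coord P" by (rule r_affine)
  thus ?thesis by (auto intro!: fls_subdegree_eqI)
qed

lemma r_nonzero [simp]: "r \<noteq> 0" and u_nonzero [simp]: "u \<noteq> 0"
  using laurent_r by (auto simp: r_def)

lemma laurent_u: "fls_subdegree (laurent_at P u) = 1"
  using laurent_r by (simp add: r_def)

lemma r_away:
  assumes "Q \<noteq> P"
  shows "fls_subdegree (laurent_at Q r) \<ge> 0"
    and "fls_subdegree (laurent_at Q (mderiv r) * chart_deriv Q) = 0"
    and mderiv_r_nonzero: "mderiv r \<noteq> 0"
proof -
  obtain a b where r: "b \<noteq> 0" "r = mconst a + mconst b * std_coord P" by (rule r_affine)
  show "fls_subdegree (laurent_at Q r) \<ge> 0"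
    using r std_coord_away(1)[OF assms] by (auto intro!: fls_integral_add fls_mult_subdegree_ge_0)
  have "laurent_at Q (mderiv r) * chart_deriv Q
      = fls_const b * fls_deriv (laurent_at Q (std_coord P))"
    by (simp add: laurent_at_mderiv r)
  thus "fls_subdegree (laurent_at Q (mderiv r) * chart_deriv Q) = 0" "mderiv r \<noteq> 0"
    using r(1) std_coord_away(2,3)[OF assms] by auto
qed

lemma exists_other: "\<exists>Q. Q \<noteq> P"
  by (metis cp1.distinct(1))

lemma mderiv_r [simp]: "mderiv r \<noteq> 0"
  using exists_other mderiv_r_nonzero by blast

lemma mderiv_r_eq: "mderiv r = - (u powi (-2) * mderiv u)"
proof -
  have "mderiv (u powi (-1)) = - (u powi (-2) * mderiv u)"
    by (subst mderiv_power_int) simp_all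
  thus ?thesis by (simp add: r_def power_int_minus)
qed

lemma mderiv_u_nonzero [simp]: "mderiv u \<noteq> 0"
  using mderiv_r by (auto simp: mderiv_r_eq)

text \<open>The polar part at \<open>P\<close> is a polynomial in \<open>r\<close>, and subtracting
  it creates no pole elsewhere, so the remainder is constant.\<close>

lemma away_polynomial:
  assumes "\<And>Q. Q \<noteq> P \<Longrightarrow> fls_subdegree (laurent_at Q f) \<ge> 0"
  shows "\<exists>N c. f = (\<Sum>i=0..N. mconst (c i) * r ^ i)"
proof -
  obtain N c where c: "fls_subdegree (laurent_at P f
      - (\<Sum>i=1..N. fls_const (c i) * laurent_at P r ^ i)) \<ge> 0"
    using fls_polar_part[OF laurent_r] by blast
  define g where "g = f - (\<Sum>i=1..N. mconst (c i) * r ^ i)"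
  have "fls_subdegree (laurent_at Q g) \<ge> 0" for Q
  proof (cases "Q = P")
    case True
    thus ?thesis using c by (simp add: g_def)
  next
    case False
    thus ?thesis
      using assms r_away(1)
      by (auto simp: g_def intro!: fls_integral_diff fls_integral_sum fls_mult_subdegree_ge_0
          fls_integral_power)
  qed
  then obtain d where d: "g = mconst d" using no_poles_imp_const by blast
  have "(\<Sum>i=0..N. mconst ((c(0 := d)) i) * r ^ i)
      = mconst d + (\<Sum>i=1..N. mconst ((c(0 := d)) i) * r ^ i)"
    by (simp add: sum.atLeast_Suc_atMost)
  also have "(\<Sum>i=1..N. mconst ((c(0 := d)) i) * r ^ i) = (\<Sum>i=1..N. mconst (c i) * r ^ i)"
    by (rule sum.cong) auto
  finally have "f = (\<Sum>i=0..N. mconst ((c(0 := d)) i) * r ^ i)"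
    using d by (simp add: g_def algebra_simps)
  thus ?thesis by blast
qed

section \<open>The basis of the forms regular off \<open>P\<close> and its dual functionals\<close>

definition e :: "int \<Rightarrow> mform" where
  "e k = u powi (- k - 1) * mderiv u"

definition \<phi> :: "int \<Rightarrow> mform \<Rightarrow> complex" where
  "\<phi> k \<eta> = form_residue P (u powi k * \<eta>)"

lemma \<phi>_add: "\<phi> k (\<alpha> + \<beta>) = \<phi> k \<alpha> + \<phi> k \<beta>"
  and \<phi>_diff: "\<phi> k (\<alpha> - \<beta>) = \<phi> k \<alpha> - \<phi> k \<beta>"
  and \<phi>_scale: "\<phi> k (mconst c * \<alpha>) = c * \<phi> k \<alpha>"
  by (simp_all add: \<phi>_def ring_distribs form_residue_add form_residue_diff mult.left_commute
      form_residue_scale)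

lemma \<phi>_0 [simp]: "\<phi> k 0 = 0"
  by (simp add: \<phi>_def)

lemma \<phi>_sum: "\<phi> k (sum f A) = (\<Sum>i\<in>A. \<phi> k (f i))"
  by (induction A rule: infinite_finite_induct) (simp_all add: \<phi>_add)

lemma residue_power: "form_residue P (u powi m * mderiv u) = (if m = -1 then 1 else 0)"
  using fls_residue_power_int_deriv[OF laurent_u]
  by (simp add: form_residue_laurent mult.assoc laurent_at_mderiv)

lemma \<phi>_e: "\<phi> k (e j) = (if k = j then 1 else 0)"
proof -
  have "u powi k * e j = u powi (k - j - 1) * mderiv u"
    by (simp add: e_def mult.assoc[symmetric] algebra_simps flip: power_int_add)
  thus ?thesis by (auto simp: \<phi>_def residue_power)
qed

lemma r_power: "r ^ n = u powi (- int n)"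
  by (simp add: r_def power_int_minus power_inverse)

lemma e_r: "e (int n + 1) = - (r ^ n * mderiv r)"
  by (simp add: e_def mderiv_r_eq r_power mult.assoc[symmetric] flip: power_int_add)
    (rule arg_cong[where f = "(powi) u"], simp)

lemma e_in_forms_K:
  assumes "k \<ge> 1"
  shows "e k \<in> forms_K P"
proof -
  obtain n where k: "k = int n + 1"
    using assms by (metis add.commute zle_iff_zadd)
  have "form_regular Q (e k)" if "Q \<noteq> P" for Q
    using r_away(1,2)[OF that] unfolding k e_r form_regular_iff
    by (auto simp: mult.assoc intro!: fls_mult_subdegree_ge_0 fls_integral_power)
  thus ?thesis by (auto simp: forms_K_def)
qed

text \<open>Off \<open>P\<close> the form \<open>dr\<close> has neither zero nor pole, so dividing
  by it leaves a function regular off \<open>P\<close>, a polynomial in \<open>r\<close>. The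
  functionals \<open>\<phi> k\<close> then identify its coefficients.\<close>

lemma forms_K_span:
  assumes "\<alpha> \<in> forms_K P"
  obtains N where "\<alpha> = (\<Sum>k\<in>{1..N}. mconst (\<phi> k \<alpha>) * e k)" "\<And>k. k > N \<Longrightarrow> \<phi> k \<alpha> = 0"
    "\<And>k. k < 1 \<Longrightarrow> \<phi> k \<alpha> = 0"
proof -
  define f where "f = \<alpha> / mderiv r"
  have \<alpha>: "\<alpha> = f * mderiv r" by (simp add: f_def)
  have "fls_subdegree (laurent_at Q f) \<ge> 0" if "Q \<noteq> P" for Q
  proof (cases "f = 0")
    case False
    have "form_regular Q \<alpha>" using assms that by (simp add: forms_K_def)
    hence "fls_subdegree (laurent_at Q f * (laurent_at Q (mderiv r) * chart_deriv Q)) \<ge> 0"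
      by (simp add: form_regular_iff \<alpha> mult.assoc)
    moreover have "laurent_at Q (mderiv r) * chart_deriv Q \<noteq> 0" by simp
    ultimately show ?thesis
      using r_away(2)[OF that] False by (subst (asm) fls_subdegree_mult) auto
  qed simp
  then obtain N c where f: "f = (\<Sum>i=0..N. mconst (c i) * r ^ i)"
    using away_polynomial by blast
  \<comment> \<open>The sign and the shift by one come from
    \<open>e (int n + 1) = - (r ^ n * mderiv r)\<close>.\<close>
  define c' where "c' k = - c (nat (k - 1))" for k
  have "\<alpha> = (\<Sum>i=0..N. mconst (c' (int i + 1)) * e (int i + 1))"
    by (simp add: \<alpha> f sum_distrib_right e_r c'_def mconst_minus mult.assoc)
  also have "\<dots> = (\<Sum>k\<in>{1..int N + 1}. mconst (c' k) * e k)"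
    by (rule sum.reindex_bij_witness[of _ "\<lambda>k. nat (k - 1)" "\<lambda>i. int i + 1"]) auto
  finally have \<alpha>': "\<alpha> = (\<Sum>k\<in>{1..int N + 1}. mconst (c' k) * e k)" .
  have \<phi>: "\<phi> j \<alpha> = (if j \<in> {1..int N + 1} then c' j else 0)" for j
    by (subst \<alpha>') (simp add: \<phi>_sum \<phi>_scale \<phi>_e if_distrib cong: if_cong)
  have "\<alpha> = (\<Sum>k\<in>{1..int N + 1}. mconst (\<phi> k \<alpha>) * e k)"
    unfolding \<phi> by (subst \<alpha>') (auto intro!: sum.cong)
  thus thesis using that[of "int N + 1"] \<phi> by auto
qed

lemma \<phi>_regular: "form_regular P \<eta> \<Longrightarrow> k \<ge> 0 \<Longrightarrow> \<phi> k \<eta> = 0"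
  unfolding \<phi>_def form_regular_iff form_residue_laurent laurent_at_mult mult.assoc
  by (rule fls_residue_power_series, rule fls_mult_subdegree_ge_0) (simp_all add: laurent_u)

lemma \<phi>_large: "\<exists>N. \<forall>k>N. \<phi> k \<eta> = 0"
proof -
  define s where "s = fls_subdegree (laurent_at P \<eta> * chart_deriv P)"
  have "\<phi> k \<eta> = 0" if "k > - s" for k
  proof (cases "\<eta> = 0")
    case False
    have "form_regular P (u powi k * \<eta>)"
      using that False unfolding s_def by (simp add: form_regular_iff mult.assoc laurent_u)
    thus ?thesis unfolding \<phi>_def by (rule form_regular_imp_residue_0)
  qed simp
  thus ?thesis by blast
qed

text \<open>At a pole of order \<open>m\<close>, multiplication by \<open>u ^ (m - 1)\<close> leaves
  a simple pole, whose residue is the nonzero leading coefficient.\<close>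

lemma regularI:
  assumes "\<And>k. k \<ge> 0 \<Longrightarrow> \<phi> k \<eta> = 0"
  shows "form_regular P \<eta>"
proof (rule ccontr)
  define H where "H = laurent_at P \<eta> * chart_deriv P"
  assume "\<not> form_regular P \<eta>"
  hence s: "fls_subdegree H < 0" by (simp add: form_regular_iff H_def)
  hence H: "H \<noteq> 0" by auto
  define k where "k = - fls_subdegree H - 1"
  define U where "U = laurent_at P u powi k"
  have U: "U \<noteq> 0" "fls_subdegree U = k" by (simp_all add: U_def laurent_u)
  have "(U * H) $$ (fls_subdegree (U * H)) \<noteq> 0"
    using U H by (intro nth_fls_subdegree_nonzero) simp
  hence "fls_residue (U * H) \<noteq> 0"
    using U H by (simp add: k_def)
  hence "\<phi> k \<eta> \<noteq> 0" by (simp add: \<phi>_def form_residue_laurent U_def H_def mult.assoc)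
  thus False using assms[of k] s by (simp add: k_def)
qed

section \<open>Projection onto the forms regular off \<open>P\<close>\<close>

definition polar_proj :: "mform \<Rightarrow> mform" where
  "polar_proj \<eta> = (\<Sum>k | k \<ge> 1 \<and> \<phi> k \<eta> \<noteq> 0. mconst (\<phi> k \<eta>) * e k)"

text \<open>The index set in the definition depends on the form; a common bound \<open>N\<close>
  makes the sums for several forms comparable.\<close>

lemma polar_proj_eq:
  assumes "\<And>k. k > N \<Longrightarrow> \<phi> k \<eta> = 0"
  shows "polar_proj \<eta> = (\<Sum>k\<in>{1..N}. mconst (\<phi> k \<eta>) * e k)"
  unfolding polar_proj_def
  by (rule sum.mono_neutral_left) (use assms in \<open>force simp: not_le\<close>)+

lemma polar_proj_common:
  obtains N where "polar_proj \<eta> = (\<Sum>k\<in>{1..N}. mconst (\<phi> k \<eta>) * e k)"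
    "polar_proj \<theta> = (\<Sum>k\<in>{1..N}. mconst (\<phi> k \<theta>) * e k)"
    "\<And>k. k > N \<Longrightarrow> \<phi> k \<eta> = 0" "\<And>k. k > N \<Longrightarrow> \<phi> k \<theta> = 0"
proof -
  obtain M M' where "\<forall>k>M. \<phi> k \<eta> = 0" "\<forall>k>M'. \<phi> k \<theta> = 0" using \<phi>_large by meson
  thus thesis using that[of "max M M'"] polar_proj_eq[of "max M M'"] by simp
qed

lemma polar_proj_add: "polar_proj (\<eta> + \<theta>) = polar_proj \<eta> + polar_proj \<theta>"
proof -
  obtain N where N: "polar_proj \<eta> = (\<Sum>k\<in>{1..N}. mconst (\<phi> k \<eta>) * e k)"
    "polar_proj \<theta> = (\<Sum>k\<in>{1..N}. mconst (\<phi> k \<theta>) * e k)"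
    "\<And>k. k > N \<Longrightarrow> \<phi> k \<eta> = 0" "\<And>k. k > N \<Longrightarrow> \<phi> k \<theta> = 0"
    using polar_proj_common[of \<eta> \<theta>] by blast
  have "polar_proj (\<eta> + \<theta>) = (\<Sum>k\<in>{1..N}. mconst (\<phi> k (\<eta> + \<theta>)) * e k)"
    by (rule polar_proj_eq) (simp add: \<phi>_add N)
  thus ?thesis by (simp add: N(1,2) \<phi>_add mconst_add ring_distribs sum.distrib)
qed

lemma polar_proj_scale: "polar_proj (mconst c * \<eta>) = mconst c * polar_proj \<eta>"
proof -
  obtain N where N: "\<forall>k>N. \<phi> k \<eta> = 0" using \<phi>_large by blast
  hence "polar_proj (mconst c * \<eta>) = (\<Sum>k\<in>{1..N}. mconst (\<phi> k (mconst c * \<eta>)) * e k)"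
    by (intro polar_proj_eq) (simp add: \<phi>_scale)
  moreover have "polar_proj \<eta> = (\<Sum>k\<in>{1..N}. mconst (\<phi> k \<eta>) * e k)"
    using N by (intro polar_proj_eq) simp
  ultimately show ?thesis
    by (simp add: \<phi>_scale mconst_mult sum_distrib_left mult.assoc)
qed

lemma polar_proj_K: "\<alpha> \<in> forms_K P \<Longrightarrow> polar_proj \<alpha> = \<alpha>"
  using forms_K_span polar_proj_eq by metis

lemma polar_proj_regular: "form_regular P \<eta> \<Longrightarrow> polar_proj \<eta> = 0"
  using polar_proj_eq[of 0 \<eta>] \<phi>_regular by simp

lemma \<phi>_polar_proj: "\<phi> j (polar_proj \<eta>) = (if j \<ge> 1 then \<phi> j \<eta> else 0)"
proof -
  obtain N where N: "\<forall>k>N. \<phi> k \<eta> = 0" using \<phi>_large by blast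
  hence "polar_proj \<eta> = (\<Sum>k\<in>{1..N}. mconst (\<phi> k \<eta>) * e k)"
    by (intro polar_proj_eq) simp
  thus ?thesis using N by (simp add: \<phi>_sum \<phi>_scale \<phi>_e if_distrib not_le cong: if_cong)
qed

lemma forms_K_add: "\<alpha> \<in> forms_K P \<Longrightarrow> \<beta> \<in> forms_K P \<Longrightarrow> \<alpha> + \<beta> \<in> forms_K P"
  by (auto simp: forms_K_def form_regular_iff ring_distribs intro!: fls_integral_add)

lemma forms_K_scale: "\<alpha> \<in> forms_K P \<Longrightarrow> mconst c * \<alpha> \<in> forms_K P"
  by (simp add: forms_K_def form_regular_iff mult.assoc fls_mult_subdegree_ge_0)

lemma forms_K_0: "0 \<in> forms_K P"
  by (auto simp: forms_K_def form_regular_iff)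

lemma forms_K_sum: "(\<And>i. i \<in> A \<Longrightarrow> f i \<in> forms_K P) \<Longrightarrow> sum f A \<in> forms_K P"
  by (induction A rule: infinite_finite_induct) (auto intro: forms_K_add forms_K_0)

lemma polar_proj_in_K: "polar_proj \<eta> \<in> forms_K P"
  unfolding polar_proj_def by (auto intro!: forms_K_sum forms_K_scale e_in_forms_K)

text \<open>The expansion of such a form starts at \<open>e 1\<close>, so \<open>\<phi> 0\<close>,
  the residue at \<open>P\<close>, vanishes. This is the residue theorem for a form with a single
  pole.\<close>

lemma second_kind_K:
  assumes "\<alpha> \<in> forms_K P"
  shows "second_kind \<alpha>"
  unfolding second_kind_def
proof
  fix Q
  show "form_residue Q \<alpha> = 0"
  proof (cases "Q = P")
    case True
    have "\<phi> 0 \<alpha> = 0" using forms_K_span[OF assms] by (metis zero_less_one)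
    thus ?thesis using True by (simp add: \<phi>_def)
  next
    case False
    thus ?thesis using assms form_regular_imp_residue_0 by (simp add: forms_K_def)
  qed
qed

lemma second_kind_add: "second_kind \<eta> \<Longrightarrow> second_kind \<theta> \<Longrightarrow> second_kind (\<eta> + \<theta>)"
  and second_kind_diff: "second_kind \<eta> \<Longrightarrow> second_kind \<theta> \<Longrightarrow> second_kind (\<eta> - \<theta>)"
  and second_kind_scale: "second_kind \<eta> \<Longrightarrow> second_kind (mconst c * \<eta>)"
  by (simp_all add: second_kind_def form_residue_add form_residue_diff form_residue_scale)

text \<open>Subtracting the projection removes the coefficients with \<open>k \<ge> 1\<close>; the
  remaining one, \<open>\<phi> 0\<close>, is the residue and vanishes for forms of the second
  kind.\<close>

lemma diff_polar_proj_regular: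
  assumes "second_kind \<eta>"
  shows "form_regular P (\<eta> - polar_proj \<eta>)"
proof (rule regularI)
  fix k :: int assume "k \<ge> 0"
  moreover have "\<phi> 0 \<eta> = 0" using assms by (simp add: \<phi>_def second_kind_def)
  ultimately show "\<phi> k (\<eta> - polar_proj \<eta>) = 0"
    by (cases "k = 0") (auto simp: \<phi>_diff \<phi>_polar_proj)
qed

text \<open>Uniqueness: every form of the second kind is the sum of its projection and a form
  regular at \<open>P\<close>, and the conditions prescribe the value on both summands.\<close>

lemma principal_part_eq: "principal_part P = (\<lambda>\<eta>. if second_kind \<eta> then polar_proj \<eta> else 0)"
  unfolding principal_part_def
proof (rule the_equality, goal_cases)
  case 1
  show ?case
    by (auto simp: second_kind_add second_kind_scale polar_proj_add polar_proj_scale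
        polar_proj_regular intro!: polar_proj_K simp: forms_K_def)
next
  case (2 \<pi>)
  show ?case
  proof
    fix \<eta>
    show "\<pi> \<eta> = (if second_kind \<eta> then polar_proj \<eta> else 0)"
    proof (cases "second_kind \<eta>")
      case True
      have K: "polar_proj \<eta> \<in> forms_K P" by (rule polar_proj_in_K)
      hence sk: "second_kind (polar_proj \<eta>)" by (rule second_kind_K)
      hence sk': "second_kind (\<eta> - polar_proj \<eta>)" using True by (rule second_kind_diff[rotated])
      have "\<pi> \<eta> = \<pi> (polar_proj \<eta> + (\<eta> - polar_proj \<eta>))" by simp
      also have "\<dots> = \<pi> (polar_proj \<eta>) + \<pi> (\<eta> - polar_proj \<eta>)"
        using 2 sk sk' by blast
      also have "\<pi> (polar_proj \<eta>) = polar_proj \<eta>"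
        using 2 sk K by (auto simp: forms_K_def)
      also have "\<pi> (\<eta> - polar_proj \<eta>) = 0"
        using 2 sk' diff_polar_proj_regular[OF True] by blast
      finally show ?thesis using True by simp
    qed (use 2 in auto)
  qed
qed

end

section \<open>The bidifferential\<close>

lemma sym_const_add: "sym_const (a + b) = sym_const a + sym_const b"
  by transfer (simp add: single_add sym_rel_def sym_ideal.zero)

lemma sym_const_mult: "sym_const (a * b) = sym_const a * sym_const b"
  by transfer (simp add: mult_single sym_rel_def sym_ideal.zero)

lemma sym_const_0 [simp]: "sym_const 0 = 0"
  by transfer (simp add: sym_rel_def sym_ideal.zero)

lemma sym_const_1 [simp]: "sym_const 1 = 1"
  by transfer (simp add: sym_rel_def sym_ideal.zero flip: single_one)

lemma sym_const_minus: "sym_const (- a) = - sym_const a"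
  by (metis add_eq_0_iff sym_const_0 sym_const_add add.right_inverse)

lemma sym_const_diff: "sym_const (a - b) = sym_const a - sym_const b"
  using sym_const_add[of a "- b"] by (simp add: sym_const_minus)

lemma sym_const_of_nat: "sym_const (of_nat n) = of_nat n"
  by (induction n) (simp_all add: sym_const_add)

lemma sym_const_of_int: "sym_const (of_int n) = of_int n"
  by (cases n) (simp_all add: sym_const_of_nat sym_const_minus sym_const_diff)

lemma sym_const_sum: "sym_const (sum f A) = (\<Sum>i\<in>A. sym_const (f i))"
  by (induction A rule: infinite_finite_induct) (simp_all add: sym_const_add)

lemma sym_incl_add: "sym_incl (\<alpha> + \<beta>) = sym_incl \<alpha> + sym_incl \<beta>"
proof -
  have "sym_rel (Poly_Mapping.single {#\<alpha> + \<beta>#} 1)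
      (Poly_Mapping.single {#\<alpha>#} 1 + Poly_Mapping.single {#\<beta>#} 1)"
    unfolding sym_rel_def using sym_ideal.add[of \<alpha> \<beta>] by (simp add: diff_diff_eq)
  thus ?thesis by transfer
qed

lemma sym_incl_scale: "sym_incl (mconst c * \<alpha>) = sym_const c * sym_incl \<alpha>"
proof -
  have "sym_rel (Poly_Mapping.single {#mconst c * \<alpha>#} 1)
      (Poly_Mapping.single {#} c * Poly_Mapping.single {#\<alpha>#} 1)"
    unfolding sym_rel_def using sym_ideal.scale[of c \<alpha>] by (simp add: mult_single)
  thus ?thesis by transfer
qed

lemma sym_incl_0 [simp]: "sym_incl 0 = 0"
  using sym_incl_scale[of 0 0] by simp

lemma sym_incl_sum: "sym_incl (sum f A) = (\<Sum>i\<in>A. sym_incl (f i))"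
  by (induction A rule: infinite_finite_induct) (simp_all add: sym_incl_add)

section \<open>Evaluation at points of the affine plane\<close>

definition integral_at :: "complex \<Rightarrow> mero \<Rightarrow> bool" where
  "integral_at z f \<longleftrightarrow> fls_subdegree (laurent_at (Pt z) f) \<ge> 0"

lemma mval_laurent:
  assumes "integral_at z f"
  shows "mval f z = laurent_at (Pt z) f $$ 0"
proof -
  have sub: "fls_subdegree (laurent_at (Pt z) f) \<ge> 0" using assms by (simp add: integral_at_def)
  have "\<not> is_pole (mval f) z"
    using fun_pole_iff[of "Pt z" f] sub is_pole_shift_0[of "mval f" z] by (simp add: fun_pole_def)
  hence "mval f analytic_on {z}"
    using mval_nice[of f] by (intro nicely_meromorphic_on_imp_analytic_at) auto
  hence "isCont (mval f) z" by (rule analytic_at_imp_isCont)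
  hence "(fun_at (Pt z) f \<longlongrightarrow> mval f z) (at 0)"
    by (simp add: isCont_def LIM_offset_zero_iff add.commute)
  moreover have "(fun_at (Pt z) f \<longlongrightarrow> laurent_at (Pt z) f $$ 0) (at 0)"
    by (rule has_laurent_expansion_imp_tendsto_0[OF has_laurent_at sub])
  ultimately show ?thesis by (rule tendsto_unique[OF at_neq_bot])
qed

lemma fls_times_nth_0:
  fixes F G :: "complex fls"
  assumes "fls_subdegree F \<ge> 0" "fls_subdegree G \<ge> 0"
  shows "(F * G) $$ 0 = F $$ 0 * G $$ 0"
proof -
  have "F * G = fps_to_fls (fls_regpart F * fls_regpart G)"
    using assms by (simp add: fls_times_fps_to_fls)
  thus ?thesis by simp
qed

lemma integral_at_const [simp]: "integral_at z (mconst c)"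
  and integral_at_add: "integral_at z f \<Longrightarrow> integral_at z g \<Longrightarrow> integral_at z (f + g)"
  and integral_at_diff: "integral_at z f \<Longrightarrow> integral_at z g \<Longrightarrow> integral_at z (f - g)"
  and integral_at_minus: "integral_at z f \<Longrightarrow> integral_at z (- f)"
  and integral_at_mult: "integral_at z f \<Longrightarrow> integral_at z g \<Longrightarrow> integral_at z (f * g)"
  and integral_at_power: "integral_at z f \<Longrightarrow> integral_at z (f ^ n)"
  by (auto simp: integral_at_def intro: fls_integral_add fls_integral_diff fls_mult_subdegree_ge_0
      fls_integral_power)

lemma integral_at_mderiv:
  assumes "integral_at z f"
  shows "integral_at z (mderiv f)"
proof -
  have "fls_deriv (laurent_at (Pt z) f) $$ k = 0" if "k < 0" for k
    using that assms by (cases "k = -1") (auto simp: integral_at_def)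
  thus ?thesis
    using laurent_at_mderiv[of "Pt z" f]
    by (auto simp: integral_at_def chart_deriv_def fls_integral_iff)
qed

lemma integral_at_sum: "(\<And>i. i \<in> A \<Longrightarrow> integral_at z (f i)) \<Longrightarrow> integral_at z (sum f A)"
  using integral_at_const[of z 0]
  by (induction A rule: infinite_finite_induct) (auto intro: integral_at_add)

text \<open>Without poles, evaluation is the constant coefficient and hence a homomorphism. At a
  pole \<open>mval\<close> has the default value 0, so the hypotheses guard against meaningless
  values.\<close>

lemma mval_add: "integral_at z f \<Longrightarrow> integral_at z g \<Longrightarrow> mval (f + g) z = mval f z + mval g z"
  and mval_diff: "integral_at z f \<Longrightarrow> integral_at z g \<Longrightarrow> mval (f - g) z = mval f z - mval g z"
  and mval_minus: "integral_at z f \<Longrightarrow> mval (- f) z = - mval f z"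
  and mval_mult: "integral_at z f \<Longrightarrow> integral_at z g \<Longrightarrow> mval (f * g) z = mval f z * mval g z"
  by (simp_all add: mval_laurent integral_at_add integral_at_diff integral_at_minus
      integral_at_mult fls_times_nth_0 integral_at_def[symmetric])

lemma mval_power: "integral_at z f \<Longrightarrow> mval (f ^ n) z = mval f z ^ n"
  by (induction n) (simp_all add: mval_mult integral_at_power mval_01)

lemma mval_scale: "integral_at z f \<Longrightarrow> mval (mconst c * f) z = c * mval f z"
  by (simp add: mval_mult)

lemma mval_0 [simp]: "mval 0 z = 0"
  by (simp add: mval_01)

lemma mval_sum: "(\<And>i. i \<in> A \<Longrightarrow> integral_at z (f i)) \<Longrightarrow> mval (sum f A) z = (\<Sum>i\<in>A. mval (f i) z)"
  by (induction A rule: infinite_finite_induct) (auto simp: mval_add integral_at_sum)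

lemma integral_std_coord:
  assumes "Pt z \<noteq> Q"
  shows "integral_at z (std_coord Q)"
  using std_coord_away(1)[OF assms] by (simp add: integral_at_def)

lemma mval_std_coord:
  assumes "Pt z \<noteq> Q"
  shows "mval (std_coord Q) z = (case Q of Pt a \<Rightarrow> 1 / (z - a) | Infty \<Rightarrow> z)"
proof (cases Q)
  case (Pt a)
  have za: "z - a \<noteq> 0" using assms Pt by simp
  have aff: "integral_at z affine_coord"
    using integral_std_coord[of z Infty] by (simp add: std_coord_def)
  have "mval ((affine_coord - mconst a) * std_coord Q) z = (z - a) * mval (std_coord Q) z"
    using integral_std_coord[OF assms] aff by (simp add: mval_mult mval_diff integral_at_diff)
  moreover have "(affine_coord - mconst a) * std_coord Q = 1"
    using Pt by (simp add: std_coord_def)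
  ultimately show ?thesis using za Pt by (simp add: mval_01 field_simps)
qed (simp add: std_coord_def)

lemma mderiv_affine_coord: "mderiv affine_coord = 1"
  by (rule laurent_at_eq_iff[of "Pt 0", THEN iffD1])
    (simp add: laurent_at_mderiv' laurent_affine_coord chart_deriv_def)

lemma mderiv_std_coord:
  "mderiv (std_coord Q) = (case Q of Pt a \<Rightarrow> - (std_coord Q ^ 2) | Infty \<Rightarrow> 1)"
proof (cases Q)
  case (Pt a)
  define f where "f = affine_coord - mconst a"
  have "mderiv (f + mconst a) = mderiv f" by (simp add: mderiv_add)
  hence "mderiv f = 1" by (simp add: f_def mderiv_affine_coord)
  moreover have "f \<noteq> 0" by (simp add: f_def)
  ultimately have "mderiv (f powi (-1)) = - (f powi (-2))"
    by (subst mderiv_power_int) simp_all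
  moreover have "f powi (-2) = inverse f ^ 2"
    by (metis power_int_minus power_int_numeral power_inverse)
  ultimately show ?thesis using Pt by (simp add: std_coord_def f_def power_int_minus)
qed (simp add: std_coord_def mderiv_affine_coord)

lemma scaled_omega_coeff:
  fixes b D M Y :: complex
  assumes "b \<noteq> 0" "D \<noteq> 0"
  shows "b * M / (2 * (b * D)) * (b * b * Y / (b * D) ^ 2) = M * Y / (2 * D ^ 3)"
  using assms by (simp add: field_simps power2_eq_square power3_eq_cube)

text \<open>The right-hand side does not mention \<open>v\<close>: the bidifferential defining \<open>\<omega>\<^sub>X\<close> is invariant under
  Moebius transformations.\<close>

lemma omega_coeff_affine:
  assumes b: "b \<noteq> 0" and v: "v = mconst a + mconst b * std_coord Q"
    and z: "z1 \<noteq> z2" "Pt z1 \<noteq> Q" "Pt z2 \<noteq> Q"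
    and X: "integral_at z1 X" "integral_at z2 X"
  shows "omega_coeff v X z1 z2 =
    (2 * (mval X z1 - mval X z2) - (mval (mderiv X) z1 + mval (mderiv X) z2) * (z1 - z2))
      / (2 * (z1 - z2) ^ 3)"
proof -
  define w where "w = std_coord Q"
  have dv: "mderiv v = mconst b * mderiv w"
    by (simp add: v w_def mderiv_add mderiv_mult)
  have iw: "integral_at z1 w" "integral_at z2 w"
    using z by (simp_all add: w_def integral_std_coord)
  note int = X iw integral_at_mult integral_at_add integral_at_mderiv integral_at_power
    integral_at_diff integral_at_minus
  have mv: "mval v z = a + b * mval w z" if "z \<in> {z1, z2}" for z
    using that iw by (auto simp: v w_def[symmetric] mval_add mval_mult int)
  show ?thesis
  proof (cases Q)
    case Infty
    have dv: "mderiv v = mconst b" using Infty by (simp add: dv w_def mderiv_std_coord)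
    have "mderiv (X * mderiv v) / mderiv v = mderiv X"
      using b by (simp add: dv mderiv_mult)
    moreover have "mval v z = a + b * z" if "z \<in> {z1, z2}" for z
      using mv[OF that] Infty by (simp add: w_def std_coord_def)
    moreover have "mval (X * mderiv v) z = b * mval X z" if "z \<in> {z1, z2}" for z
      using that by (auto simp: dv mval_mult int mult.commute)
    moreover define D where "D = z1 - z2"
    moreover have "b * D = b * z1 - b * z2" by (simp add: D_def right_diff_distrib)
    ultimately have eq: "omega_coeff v X z1 z2 =
        (2 * (b * mval X z1 - b * mval X z2) - (mval (mderiv X) z1 + mval (mderiv X) z2) * (b * D))
          / (2 * (b * D)) * (b * b / (b * D) ^ 2)"
      by (simp add: omega_coeff_def contract_def Let_def dv)
    have D: "D \<noteq> 0" using z by (simp add: D_def)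
    have num: "2 * (b * mval X z1 - b * mval X z2)
          - (mval (mderiv X) z1 + mval (mderiv X) z2) * (b * D)
        = b * (2 * (mval X z1 - mval X z2) - (mval (mderiv X) z1 + mval (mderiv X) z2) * D)"
      by (simp add: algebra_simps)
    show ?thesis
      unfolding eq num D_def[symmetric]
      using scaled_omega_coeff[OF b D, of _ 1] by (simp only: mult_1_right)
  next
    case (Pt q)
    have dw: "mderiv w = - (w ^ 2)" using Pt by (simp add: w_def mderiv_std_coord)
    have dv: "mderiv v = - (mconst b * w ^ 2)" by (simp add: dv dw)
    have w0: "w \<noteq> 0" using Pt by (simp add: w_def std_coord_def)
    \<comment> \<open>The quotient is \<open>X' + X v''/v'\<close>, and \<open>v' = - b w^2\<close>
      gives \<open>v''/v' = - 2 w\<close>.\<close>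
    have "mderiv (X * mderiv v) / mderiv v = mderiv X - mconst 2 * (X * w)"
    proof -
      have ddv: "mderiv (mderiv v) = mconst b * (mconst 2 * w ^ 3)"
      proof -
        have "mderiv (mderiv v) + mderiv (mconst b * w ^ 2) = mderiv 0"
          by (simp add: dv flip: mderiv_add)
        hence "mderiv (mderiv v) = - mderiv (mconst b * w ^ 2)"
          using mderiv_const[of 0] by (simp add: add_eq_0_iff)
        also have "\<dots> = mconst b * (mconst 2 * w ^ 3)"
          using mconst_of_nat[of 2]
          by (simp add: mderiv_mult power2_eq_square power3_eq_cube dw algebra_simps)
        finally show ?thesis .
      qed
      show ?thesis
        unfolding mderiv_mult ddv unfolding dv
        using w0 b by (simp add: field_simps power2_eq_square power3_eq_cube)
    qed
    moreover note mv
    moreover have "mval (X * mderiv v) z = - (b * mval X z * mval w z ^ 2)" if "z \<in> {z1, z2}" for z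
      using that by (auto simp: dv mval_mult mval_minus mval_power int)
    moreover have "mval (mderiv v) z = - (b * mval w z ^ 2)" if "z \<in> {z1, z2}" for z
      using that by (auto simp: dv mval_mult mval_minus mval_power int)
    moreover have "mval (mderiv X - mconst 2 * (X * w)) z = mval (mderiv X) z - 2 * (mval X z * mval w z)"
      if "z \<in> {z1, z2}" for z
      using that by (auto simp: mval_mult mval_diff int)
    moreover define x1 where "x1 = mval w z1"
    moreover define x2 where "x2 = mval w z2"
    moreover define g1 where "g1 = mval X z1"
    moreover define g2 where "g2 = mval X z2"
    moreover define h1 where "h1 = mval (mderiv X) z1"
    moreover define h2 where "h2 = mval (mderiv X) z2"
    moreover have "b * (x1 - x2) = b * x1 - b * x2" by (rule right_diff_distrib)
    ultimately have eq: "omega_coeff v X z1 z2 =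
        (2 * (- (b * g1 * x1 ^ 2) - - (b * g2 * x2 ^ 2))
          - ((h1 - 2 * (g1 * x1)) + (h2 - 2 * (g2 * x2))) * (b * (x1 - x2))) / (2 * (b * (x1 - x2)))
        * ((- (b * x1 ^ 2)) * (- (b * x2 ^ 2)) / (b * (x1 - x2)) ^ 2)"
      by (simp add: omega_coeff_def contract_def Let_def)
    have x: "x1 = 1 / (z1 - q)" "x2 = 1 / (z2 - q)"
      using z Pt by (simp_all add: x1_def x2_def w_def mval_std_coord)
    have x0: "x1 \<noteq> 0" "x2 \<noteq> 0" using z Pt by (simp_all add: x)
    have "z1 - z2 = 1 / x1 - 1 / x2" by (simp add: x)
    hence zz: "z1 - z2 = (x2 - x1) / (x1 * x2)" using x0 by (simp add: field_simps)
    have d: "x1 - x2 \<noteq> 0" using zz z x0 by auto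
    define D where "D = x1 - x2"
    \<comment> \<open>The terms with \<open>x1 ^ 2\<close> and \<open>x2 ^ 2\<close> cancel against
      the correction \<open>- 2 w X\<close> of the derivative. The surviving factor
      \<open>x1 * x2\<close> is absorbed by \<open>z1 - z2 = (x2 - x1) / (x1 * x2)\<close>.\<close>
    have num: "2 * (- (b * g1 * x1 ^ 2) - - (b * g2 * x2 ^ 2))
          - ((h1 - 2 * (g1 * x1)) + (h2 - 2 * (g2 * x2))) * (b * D)
        = b * (2 * (g2 - g1) * x1 * x2 - (h1 + h2) * D)"
      by (simp add: D_def algebra_simps power2_eq_square)
    have den: "(- (b * x1 ^ 2)) * (- (b * x2 ^ 2)) = b * b * (x1 ^ 2 * x2 ^ 2)"
      by simp
    have "omega_coeff v X z1 z2 =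
      ((2 * (g2 - g1) * x1 * x2 - (h1 + h2) * D) * (x1 ^ 2 * x2 ^ 2)) / (2 * D ^ 3)"
      unfolding eq D_def[symmetric] num den
      by (rule scaled_omega_coeff) (use b d in \<open>auto simp: D_def\<close>)
    also have "\<dots> = (2 * (g1 - g2) - (h1 + h2) * (z1 - z2)) / (2 * (z1 - z2) ^ 3)"
    proof -
      have zz': "z1 - z2 = - D / (x1 * x2)" by (simp add: zz D_def)
      show ?thesis unfolding zz' using d[folded D_def] x0
        by (simp add: field_simps power2_eq_square power3_eq_cube)
    qed
    finally show ?thesis by (simp add: g1_def g2_def h1_def h2_def)
  qed
qed

text \<open>Up to sign, the right-hand side is the numerator of the bidifferential for
  \<open>\<xi>(x) = x^(n+2)\<close>. It vanishes to third order on the diagonal, and the sum is the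
  quotient. The proof peels off one linear factor of the coefficients at a time: \<open>G\<close> is
  reduced to the sum \<open>T\<close>, and \<open>T\<close> to powers.\<close>

lemma bidifferential_power_identity:
  fixes x y :: "'a :: comm_ring_1"
  shows "(x - y) ^ 3 * (\<Sum>a<n. of_nat ((a + 1) * (n - a)) * (x ^ a * y ^ (n - 1 - a))) =
    of_nat (n + 2) * (x ^ (n + 1) + y ^ (n + 1)) * (x - y) - 2 * (x ^ (n + 2) - y ^ (n + 2))"
proof (induction n)
  case 0
  show ?case by (simp add: algebra_simps power2_eq_square)
next
  case (Suc n)
  define T where "T m = (\<Sum>a<m. of_nat (a + 1) * (x ^ a * y ^ (m - 1 - a)))" for m
  define G where "G m = (\<Sum>a<m. of_nat ((a + 1) * (m - a)) * (x ^ a * y ^ (m - 1 - a)))" for m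
  have shift: "x ^ a * y ^ (m - a) = y * (x ^ a * y ^ (m - 1 - a))" if "a < m" for a m
    using that by (cases "m - a") (simp_all add: algebra_simps Suc_diff_Suc[symmetric])
  have TS: "T (Suc m) = y * T m + of_nat (m + 1) * x ^ m" for m
  proof -
    have "(\<Sum>a<m. of_nat (a + 1) * (x ^ a * y ^ (m - a))) = y * T m"
      unfolding T_def sum_distrib_left
      by (rule sum.cong[OF refl], subst shift) (auto simp: mult_ac)
    thus ?thesis by (simp add: T_def)
  qed
  have T: "(x - y) ^ 2 * T m = of_nat m * x ^ (m + 1) - of_nat (m + 1) * (x ^ m * y) + y ^ (m + 1)" for m
  proof (induction m)
    case 0
    show ?case by (simp add: T_def)
  next
    case (Suc m)
    have "(x - y) ^ 2 * T (Suc m) = y * ((x - y) ^ 2 * T m) + (x - y) ^ 2 * (of_nat (m + 1) * x ^ m)"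
      by (simp add: TS algebra_simps)
    thus ?case unfolding Suc.IH by (simp add: algebra_simps power2_eq_square)
  qed
  \<comment> \<open>Writing \<open>Suc n - a\<close> as \<open>(n - a) + 1\<close> splits the sum;
    the term \<open>a = n\<close> of the first part is zero.\<close>
  have "G (Suc n) = (\<Sum>a<Suc n. of_nat ((a + 1) * (n - a)) * (x ^ a * y ^ (n - a))) + T (Suc n)"
    unfolding G_def T_def sum.distrib[symmetric]
    by (rule sum.cong) (simp_all add: Suc_diff_le algebra_simps)
  also have "(\<Sum>a<Suc n. of_nat ((a + 1) * (n - a)) * (x ^ a * y ^ (n - a))) = y * G n"
  proof -
    have "(\<Sum>a<n. of_nat ((a + 1) * (n - a)) * (x ^ a * y ^ (n - a))) = y * G n"
      unfolding G_def sum_distrib_left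
      by (rule sum.cong[OF refl], subst shift) (auto simp: mult_ac)
    thus ?thesis by simp
  qed
  finally have G: "G (Suc n) = y * G n + T (Suc n)" .
  have "(x - y) ^ 3 * G (Suc n) = y * ((x - y) ^ 3 * G n) + (x - y) * ((x - y) ^ 2 * T (Suc n))"
    by (simp add: G algebra_simps power3_eq_cube power2_eq_square)
  thus ?case
    unfolding T Suc.IH[folded G_def] G_def[symmetric] by (simp add: algebra_simps)
qed

lemma mero_eq_0I:
  assumes "finite S" "\<And>z. z \<notin> S \<Longrightarrow> mval f z = 0"
  shows "f = 0"
proof (rule mero_eqI)
  have "eventually (\<lambda>w. mval f w = mval 0 w) (at z)" for z
  proof -
    have "open (- (S - {z}))"
      using assms(1) by (intro open_Compl finite_imp_closed) simp
    hence "eventually (\<lambda>w. w \<in> - (S - {z})) (at z)"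
      by (rule eventually_at_in_open') simp
    moreover have "eventually (\<lambda>w. w \<noteq> z) (at z)"
      by (rule eventually_neq_at_within)
    ultimately show ?thesis
      by eventually_elim (use assms(2) in auto)
  qed
  thus "\<forall>\<^sub>\<approx>z\<in>UNIV. mval f z = mval 0 z"
    by (auto simp: eventually_cosparse_open_eq)
qed

lemma mderiv_power: "mderiv (f ^ n) = of_nat n * f ^ (n - 1) * mderiv f"
proof (induction n)
  case 0
  show ?case using mderiv_const[of 1] by simp
next
  case (Suc n)
  thus ?case by (cases n) (simp_all add: mderiv_mult algebra_simps)
qed

lemma fls_integral_mult_unit:
  fixes F G :: "complex fls"
  assumes "G \<noteq> 0" "fls_subdegree G = 0"
  shows "fls_subdegree (F * G) \<ge> 0 \<longleftrightarrow> fls_subdegree F \<ge> 0"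
  using assms by (cases "F = 0") auto

context vanishing_coordinate begin

lemma integral_r: "Pt z \<noteq> P \<Longrightarrow> integral_at z r"
  using r_away(1) by (simp add: integral_at_def)

lemma integral_forms_K: "\<alpha> \<in> forms_K P \<Longrightarrow> Pt z \<noteq> P \<Longrightarrow> integral_at z \<alpha>"
  by (auto simp: forms_K_def form_regular_iff integral_at_def chart_deriv_def)

lemma finite_poles_u: "finite {z. Pt z = P \<or> fun_pole (Pt z) u}"
proof -
  obtain Q a b where u: "u = mconst a + mconst b * std_coord Q"
    using coordinate_affine[OF coord] by metis
  have "\<not> fun_pole (Pt z) u" if "Pt z \<noteq> Q" for z
    using integral_std_coord[OF that] unfolding u fun_pole_iff integral_at_def not_less
    by (auto intro!: fls_integral_add fls_mult_subdegree_ge_0)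
  hence "{z. Pt z = P \<or> fun_pole (Pt z) u} \<subseteq> {z. Pt z = P} \<union> {z. Pt z = Q}" by auto
  moreover have "finite {z. Pt z = Q'}" for Q'
    by (cases Q') auto
  ultimately show ?thesis by (meson finite_UnI finite_subset)
qed

definition E :: "int \<Rightarrow> sym_alg" where
  "E k = sym_incl (e k)"

lemma sym_incl_K:
  assumes "\<alpha> \<in> forms_K P" "\<And>k. k > N \<Longrightarrow> \<phi> k \<alpha> = 0"
  shows "sym_incl \<alpha> = (\<Sum>k\<in>{1..N}. sym_const (\<phi> k \<alpha>) * E k)"
proof -
  have "\<alpha> = (\<Sum>k\<in>{1..N}. mconst (\<phi> k \<alpha>) * e k)"
    using polar_proj_eq[OF assms(2)] polar_proj_K[OF assms(1)] by simp
  hence "sym_incl \<alpha> = sym_incl (\<Sum>k\<in>{1..N}. mconst (\<phi> k \<alpha>) * e k)" by simp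
  thus ?thesis by (simp add: sym_incl_sum sym_incl_scale E_def)
qed

text \<open>Uniqueness of \<open>omega\<close>. With one point fixed, the bidifferential is a form
  in the other that vanishes off a finite set, hence everywhere, so \<open>\<phi> j\<close> can be
  applied to it; repeating this in the second variable kills the symmetrised coefficient
  matrix.\<close>

lemma bidifferential_zero_imp_sym_zero:
  fixes A B :: "'i \<Rightarrow> mform"
  assumes K: "\<And>i. i \<in> I \<Longrightarrow> A i \<in> forms_K P" "\<And>i. i \<in> I \<Longrightarrow> B i \<in> forms_K P"
    and zero: "\<And>z1 z2. z1 \<noteq> z2 \<Longrightarrow> Pt z1 \<noteq> P \<Longrightarrow> Pt z2 \<noteq> P \<Longrightarrow>
      \<not> fun_pole (Pt z1) u \<Longrightarrow> \<not> fun_pole (Pt z2) u \<Longrightarrow>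
      (\<Sum>i\<in>I. (mval (A i) z1 * mval (B i) z2 + mval (A i) z2 * mval (B i) z1) / 2) = 0"
  shows "(\<Sum>i\<in>I. sym_incl (A i) * sym_incl (B i)) = 0"
proof (cases "finite I")
  case False
  thus ?thesis by simp
next
  case fin: True
  define S where "S = {z. Pt z = P \<or> fun_pole (Pt z) u}"
  have S: "finite S" unfolding S_def by (rule finite_poles_u)
  have int: "integral_at z (A i)" "integral_at z (B i)" if "z \<notin> S" "i \<in> I" for z i
    using that K integral_forms_K by (auto simp: S_def)
  have 1: "(\<Sum>i\<in>I. (mval (B i) z * \<phi> j (A i) + mval (A i) z * \<phi> j (B i)) / 2) = 0"
    if z: "z \<notin> S" for z j
  proof -
    define \<Theta> where "\<Theta> = (\<Sum>i\<in>I. mconst (mval (B i) z / 2) * A i + mconst (mval (A i) z / 2) * B i)"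
    have "\<Theta> = 0"
    proof (rule mero_eq_0I)
      show "finite (insert z S)" using S by simp
      fix w assume w: "w \<notin> insert z S"
      have "mval \<Theta> w = (\<Sum>i\<in>I. (mval (A i) w * mval (B i) z + mval (A i) z * mval (B i) w) / 2)"
        unfolding \<Theta>_def using w
        by (subst mval_sum) (auto simp: int integral_at_add integral_at_mult mval_add mval_mult
            add_divide_distrib mult.commute intro!: sum.cong)
      also have "\<dots> = 0" using w z by (intro zero) (auto simp: S_def)
      finally show "mval \<Theta> w = 0" .
    qed
    hence "\<phi> j \<Theta> = 0" by simp
    thus ?thesis
      by (simp add: \<Theta>_def \<phi>_sum \<phi>_add \<phi>_scale add_divide_distrib)
  qed
  have 2: "(\<Sum>i\<in>I. (\<phi> j (A i) * \<phi> k (B i) + \<phi> j (B i) * \<phi> k (A i)) / 2) = 0" for j k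
  proof -
    define \<Theta> where "\<Theta> = (\<Sum>i\<in>I. mconst (\<phi> j (A i) / 2) * B i + mconst (\<phi> j (B i) / 2) * A i)"
    have "\<Theta> = 0"
    proof (rule mero_eq_0I[OF S])
      fix w assume w: "w \<notin> S"
      have "mval \<Theta> w = (\<Sum>i\<in>I. (mval (B i) w * \<phi> j (A i) + mval (A i) w * \<phi> j (B i)) / 2)"
        unfolding \<Theta>_def using w
        by (subst mval_sum) (auto simp: int integral_at_add integral_at_mult mval_add mval_mult
            add_divide_distrib mult.commute intro!: sum.cong)
      thus "mval \<Theta> w = 0" using 1[OF w] by simp
    qed
    hence "\<phi> k \<Theta> = 0" by simp
    thus ?thesis
      by (simp add: \<Theta>_def \<phi>_sum \<phi>_add \<phi>_scale add_divide_distrib)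
  qed
  have "\<exists>N. \<forall>k>N. \<phi> k (A i) = 0 \<and> \<phi> k (B i) = 0" for i
    using polar_proj_common[of "A i" "B i"] by metis
  then obtain f where f: "\<And>i k. k > f i \<Longrightarrow> \<phi> k (A i) = 0 \<and> \<phi> k (B i) = 0" by metis
  define N where "N = Max (insert 0 (f ` I))"
  have N: "f i \<le> N" if "i \<in> I" for i using fin that by (simp add: N_def)
  have exp: "sym_incl (A i) = (\<Sum>k\<in>{1..N}. sym_const (\<phi> k (A i)) * E k)"
    "sym_incl (B i) = (\<Sum>k\<in>{1..N}. sym_const (\<phi> k (B i)) * E k)" if "i \<in> I" for i
    using that f N[OF that] K by (auto intro!: sym_incl_K)
  define T where "T = (\<Sum>i\<in>I. sym_incl (A i) * sym_incl (B i))"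
  define M where "M j k = (\<Sum>i\<in>I. \<phi> j (A i) * \<phi> k (B i))" for j k
  have "T = (\<Sum>i\<in>I. \<Sum>j\<in>{1..N}. \<Sum>k\<in>{1..N}. sym_const (\<phi> j (A i) * \<phi> k (B i)) * (E j * E k))"
    unfolding T_def by (rule sum.cong) (simp_all add: exp sum_product sym_const_mult mult_ac)
  also have "\<dots> = (\<Sum>j\<in>{1..N}. \<Sum>i\<in>I. \<Sum>k\<in>{1..N}. sym_const (\<phi> j (A i) * \<phi> k (B i)) * (E j * E k))"
    by (rule sum.swap)
  also have "\<dots> = (\<Sum>j\<in>{1..N}. \<Sum>k\<in>{1..N}. \<Sum>i\<in>I. sym_const (\<phi> j (A i) * \<phi> k (B i)) * (E j * E k))"
    by (rule sum.cong[OF refl], rule sum.swap)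
  finally have T: "T = (\<Sum>j\<in>{1..N}. \<Sum>k\<in>{1..N}. sym_const (M j k) * (E j * E k))"
    by (simp add: M_def sym_const_sum sum_distrib_right)
  \<comment> \<open>Since \<open>E j * E k\<close> is symmetric, \<open>T\<close> equals its
    transpose, and adding the two leaves only the symmetrised matrix.\<close>
  have T': "T = (\<Sum>j\<in>{1..N}. \<Sum>k\<in>{1..N}. sym_const (M k j) * (E j * E k))"
    unfolding T by (subst sum.swap) (simp add: mult.commute)
  have "M j k + M k j = 0" for j k
    using 2[of j k] unfolding sum_divide_distrib[symmetric] by (simp add: M_def sum.distrib mult.commute)
  hence "T + T = 0"
    by (subst T, subst T') (simp add: sum.distrib[symmetric] ring_distribs[symmetric]
        sym_const_add[symmetric])
  hence "sym_const (1/2) * (T + T) = 0" by simp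
  moreover have "sym_const (1/2) * (T + T) = (sym_const (1/2) + sym_const (1/2)) * T"
    by (simp add: ring_distribs)
  moreover have "sym_const (1/2) + sym_const (1/2) = 1"
    by (simp flip: sym_const_add)
  ultimately show ?thesis by (simp add: T_def)
qed

text \<open>The value of \<open>omega\<close> on \<open>r^(k+1) d/dr\<close>. It is an empty sum for
  \<open>k \<le> 1\<close>, which covers the globally regular fields
  \<open>k = -1, 0, 1\<close>.\<close>

definition \<Omega> :: "int \<Rightarrow> sym_alg" where
  "\<Omega> k = (\<Sum>a\<in>{1..k - 1}. sym_const (- (of_int (a * (k - a)) / 2)) * (E a * E (k - a)))"

lemma \<Omega>_0: "k \<le> 1 \<Longrightarrow> \<Omega> k = 0"
  by (simp add: \<Omega>_def)

section \<open>Vector fields in the coordinate \<open>r\<close>\<close>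

lemma vf_regular_away_iff:
  assumes "Q \<noteq> P"
  shows "vf_regular Q X \<longleftrightarrow> fls_subdegree (laurent_at Q (X * mderiv r)) \<ge> 0"
proof -
  have "laurent_at Q (X * mderiv r)
      = (laurent_at Q X / chart_deriv Q) * (laurent_at Q (mderiv r) * chart_deriv Q)"
    by simp
  moreover have "laurent_at Q (mderiv r) * chart_deriv Q \<noteq> 0" by simp
  ultimately show ?thesis
    using r_away(2)[OF assms] by (simp only: vf_regular_iff fls_integral_mult_unit simp_thms)
qed

text \<open>At \<open>P\<close> the form \<open>dr\<close> has a double pole, which the factor
  \<open>u ^ 2\<close> compensates.\<close>

lemma vf_regular_P_iff:
  "vf_regular P X \<longleftrightarrow> fls_subdegree (laurent_at P (X * mderiv r * u ^ 2)) \<ge> 0"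
proof -
  define R where "R = laurent_at P (mderiv r) * chart_deriv P"
  have R: "R = fls_deriv (laurent_at P r)" by (simp add: R_def laurent_at_mderiv)
  have "fls_subdegree R = -2"
    unfolding R
  proof (subst fls_deriv_subdegree')
    show "of_int (fls_subdegree (laurent_at P r)) * laurent_at P r $$ fls_subdegree (laurent_at P r) \<noteq> 0"
      using nth_fls_subdegree_nonzero[of "laurent_at P r"] by (simp add: laurent_r)
  qed (simp add: laurent_r)
  hence "fls_subdegree (R * laurent_at P u ^ 2) = 0"
    by (subst fls_subdegree_mult) (auto simp: fls_subdegree_pow laurent_u R_def)
  moreover have "laurent_at P (X * mderiv r * u ^ 2)
      = (laurent_at P X / chart_deriv P) * (R * laurent_at P u ^ 2)"
    by (simp add: R_def)
  moreover have "R * laurent_at P u ^ 2 \<noteq> 0"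
    by (simp add: R_def)
  ultimately show ?thesis
    by (simp only: vf_regular_iff fls_integral_mult_unit simp_thms)
qed

lemma vf_regular_Pt: "vf_regular (Pt z) X \<longleftrightarrow> integral_at z X"
  by (simp add: vf_regular_iff integral_at_def chart_deriv_def)

text \<open>The vector field \<open>r^i d/dr\<close>.\<close>

definition V :: "nat \<Rightarrow> mvf" where
  "V i = r ^ i / mderiv r"

lemma vf_away_polynomial:
  assumes "\<And>Q. Q \<noteq> P \<Longrightarrow> vf_regular Q X"
  obtains N c where "X = (\<Sum>i=0..N. mconst (c i) * V i)"
proof -
  obtain N c where "X * mderiv r = (\<Sum>i=0..N. mconst (c i) * r ^ i)"
    using away_polynomial[of "X * mderiv r"] assms vf_regular_away_iff by blast
  hence "X = (\<Sum>i=0..N. mconst (c i) * r ^ i) / mderiv r" by (simp add: field_simps)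
  also have "\<dots> = (\<Sum>i=0..N. mconst (c i) * V i)" by (simp add: V_def sum_divide_distrib)
  finally show thesis using that by blast
qed

lemma polynomial_vf_away:
  assumes "Q \<noteq> P"
  shows "vf_regular Q (\<Sum>i\<in>I. mconst (c i) * V i)"
proof -
  have "(\<Sum>i\<in>I. mconst (c i) * V i) * mderiv r = (\<Sum>i\<in>I. mconst (c i) * r ^ i)"
    by (simp add: V_def sum_distrib_right)
  thus ?thesis
    unfolding vf_regular_away_iff[OF assms] using r_away(1)[OF assms]
    by (auto intro!: fls_integral_sum fls_mult_subdegree_ge_0 fls_integral_power)
qed

lemma mval_r_inj:
  assumes "z1 \<noteq> z2" "Pt z1 \<noteq> P" "Pt z2 \<noteq> P"
  shows "mval r z1 \<noteq> mval r z2"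
proof -
  obtain a b where r: "b \<noteq> 0" "r = mconst a + mconst b * std_coord P" by (rule r_affine)
  have "mval r z = a + b * mval (std_coord P) z" if "Pt z \<noteq> P" for z
    using integral_std_coord[OF that] by (simp add: r mval_add mval_mult integral_at_mult)
  moreover have "mval (std_coord P) z1 \<noteq> mval (std_coord P) z2"
    using assms by (cases P) (auto simp: mval_std_coord)
  ultimately show ?thesis using assms r(1) by simp
qed

lemma mval_e: "Pt z \<noteq> P \<Longrightarrow> mval (e (int n + 1)) z = - (mval r z ^ n * mval (mderiv r) z)"
  by (simp add: e_r mval_minus mval_mult mval_power integral_r integral_at_mult integral_at_power
      integral_at_mderiv)

text \<open>The coordinate \<open>r\<close> has its only pole at \<open>P\<close>, so the formula is
  available at all points off \<open>P\<close>. For \<open>r^i d/dr\<close> the numerator is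
  \<open>- (x - y) ^ 3\<close> times the power sum, whence the factor \<open>- 1/2\<close>; the
  signs in \<open>e (a + 1) = - r^a dr\<close> cancel in pairs.\<close>

lemma omega_coeff_r:
  assumes z: "z1 \<noteq> z2" "Pt z1 \<noteq> P" "Pt z2 \<noteq> P"
  shows "omega_coeff r (\<Sum>i=0..N. mconst (c i) * V i) z1 z2 =
    (\<Sum>i=0..N. c i * (\<Sum>a\<in>{1..int i - 2}. - (of_int (a * (int i - 1 - a)) / 2)
      * (mval (e a) z1 * mval (e (int i - 1 - a)) z2)))"
proof -
  define X where "X = (\<Sum>i=0..N. mconst (c i) * V i)"
  define x where "x = mval r z1"
  define y where "y = mval r z2"
  define dx where "dx = mval (mderiv r) z1"
  define dy where "dy = mval (mderiv r) z2"
  define \<xi> where "\<xi> = (\<Sum>i=0..N. mconst (c i) * r ^ i)"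
  define \<xi>' where "\<xi>' = (\<Sum>i=0..N. mconst (c i * of_nat i) * r ^ (i - 1))"
  have X1: "X * mderiv r = \<xi>"
    by (simp add: X_def \<xi>_def V_def sum_distrib_right)
  have mderiv_sum: "mderiv (\<Sum>i\<in>I. f i) = (\<Sum>i\<in>I. mderiv (f i))" for f :: "nat \<Rightarrow> mero" and I
    using mderiv_const[of 0] by (induction I rule: infinite_finite_induct) (auto simp: mderiv_add)
  have "mderiv \<xi> = \<xi>' * mderiv r"
    by (simp add: \<xi>_def \<xi>'_def mderiv_sum mderiv_mult mderiv_power sum_distrib_right mconst_mult
        mconst_of_nat mult.assoc)
  hence X2: "mderiv \<xi> / mderiv r = \<xi>'" by simp
  have d: "x - y \<noteq> 0" using mval_r_inj[OF z] by (simp add: x_def y_def)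
  have \<xi>: "mval \<xi> w = (\<Sum>i=0..N. c i * mval r w ^ i)"
    "mval \<xi>' w = (\<Sum>i=0..N. c i * of_nat i * mval r w ^ (i - 1))" if "Pt w \<noteq> P" for w
    unfolding \<xi>_def \<xi>'_def using that
    by (subst mval_sum; simp add: integral_at_mult integral_at_power integral_r mval_mult mval_power)+
  define S where "S i = (\<Sum>a<i - 2. of_nat ((a + 1) * (i - 2 - a)) * (x ^ a * y ^ (i - 2 - 1 - a)))" for i
  \<comment> \<open>Truncated subtraction does no harm: both sides are 0 for \<open>i = 0\<close>
    and \<open>i = 1\<close>, and from \<open>i = 2\<close> on this is the power identity with
    \<open>n = i - 2\<close>.\<close>
  have ident: "2 * (x ^ i - y ^ i) - of_nat i * (x ^ (i - 1) + y ^ (i - 1)) * (x - y)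
      = - ((x - y) ^ 3 * S i)" for i
  proof -
    consider "i = 0" | "i = 1" | n where "i = n + 2"
      by (metis One_nat_def add_2_eq_Suc' not0_implies_Suc)
    thus ?thesis
    proof cases
      case 3
      thus ?thesis using bidifferential_power_identity[of x y n] by (simp add: S_def algebra_simps)
    qed (simp_all add: S_def)
  qed
  have "2 * (mval \<xi> z1 - mval \<xi> z2) - (mval \<xi>' z1 + mval \<xi>' z2) * (x - y)
      = (\<Sum>i=0..N. c i * (2 * (x ^ i - y ^ i) - of_nat i * (x ^ (i - 1) + y ^ (i - 1)) * (x - y)))"
    using z by (simp add: \<xi> x_def y_def sum_distrib_left sum_distrib_right sum_subtractf
        sum.distrib algebra_simps)
  also have "\<dots> = - ((x - y) ^ 3 * (\<Sum>i=0..N. c i * S i))"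
    unfolding ident by (simp add: sum_distrib_left sum_negf algebra_simps)
  finally have num: "2 * (mval \<xi> z1 - mval \<xi> z2) - (mval \<xi>' z1 + mval \<xi>' z2) * (x - y)
      = - ((x - y) ^ 3 * (\<Sum>i=0..N. c i * S i))" .
  have "omega_coeff r X z1 z2 =
      - ((x - y) ^ 3 * (\<Sum>i=0..N. c i * S i)) / (2 * (x - y)) * (dx * dy / (x - y) ^ 2)"
    unfolding num[symmetric]
    by (simp only: omega_coeff_def contract_def Let_def X1 X2 x_def y_def dx_def dy_def)
  also have "\<dots> = (\<Sum>i=0..N. c i * S i) * (- (dx * dy) / 2)"
  proof -
    have "- (D ^ 3 * T) / (2 * D) * (w / D ^ 2) = T * (- w / 2)" if "D \<noteq> 0" for D T w :: complex
      using that by (simp add: field_simps power3_eq_cube power2_eq_square)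
    thus ?thesis using d by blast
  qed
  also have "\<dots> = (\<Sum>i=0..N. c i * (S i * (- (dx * dy) / 2)))"
    by (simp only: sum_distrib_right mult.assoc)
  also have "\<dots> = (\<Sum>i=0..N. c i * (\<Sum>a\<in>{1..int i - 2}. - (of_int (a * (int i - 1 - a)) / 2)
      * (mval (e a) z1 * mval (e (int i - 1 - a)) z2)))"
  proof (rule sum.cong[OF refl], rule arg_cong[where f = "times _"])
    fix i
    have "(\<Sum>a\<in>{1..int i - 2}. - (of_int (a * (int i - 1 - a)) / 2)
        * (mval (e a) z1 * mval (e (int i - 1 - a)) z2))
      = (\<Sum>a<i - 2. - (of_nat ((a + 1) * (i - 2 - a)) / 2)
        * (x ^ a * dx * (y ^ (i - 2 - 1 - a) * dy)))"
    proof (rule sum.reindex_bij_witness[of _ "\<lambda>a. int a + 1" "\<lambda>a. nat (a - 1)"])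
      fix a assume a: "a \<in> {1..int i - 2}"
      define b where "b = nat (a - 1)"
      define k where "k = i - 2 - 1 - b"
      have ab: "a = int b + 1" using a by (simp add: b_def)
      have k: "int i - 1 - a = int k + 1" "i - 2 - b = k + 1"
        using a ab by (simp_all add: k_def of_nat_diff)
      have "- (of_nat ((b + 1) * (i - 2 - b)) / 2) * (x ^ b * dx * (y ^ (i - 2 - 1 - b) * dy))
        = - (of_int (a * (int i - 1 - a)) / 2) * (mval (e a) z1 * mval (e (int i - 1 - a)) z2)"
        unfolding k k_def[symmetric] unfolding ab
        by (simp only: mval_e[OF z(2)] mval_e[OF z(3)] x_def y_def dx_def dy_def)
          (simp add: algebra_simps)
      thus "- (of_nat ((nat (a - 1) + 1) * (i - 2 - nat (a - 1))) / 2)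
          * (x ^ nat (a - 1) * dx * (y ^ (i - 2 - 1 - nat (a - 1)) * dy))
        = - (of_int (a * (int i - 1 - a)) / 2) * (mval (e a) z1 * mval (e (int i - 1 - a)) z2)"
        unfolding b_def .
    qed auto
    thus "S i * (- (dx * dy) / 2) = (\<Sum>a\<in>{1..int i - 2}. - (of_int (a * (int i - 1 - a)) / 2)
        * (mval (e a) z1 * mval (e (int i - 1 - a)) z2))"
      unfolding S_def sum_distrib_right
      by (simp add: mult_ac del: of_nat_mult of_nat_add)
  qed
  finally show ?thesis by (simp only: X_def)
qed

text \<open>Existence is checked in the coordinate \<open>r\<close> on an explicit list of pairs and
  carried over to every other coordinate. For uniqueness, the difference of two representing lists
  has vanishing bidifferential.\<close>

lemma omega_eq:
  assumes X: "X = (\<Sum>i=0..N. mconst (c i) * V i)"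
  shows "omega P X = (\<Sum>i=0..N. sym_const (c i) * \<Omega> (int i - 1))"
proof -
  define ps where "ps = concat (map (\<lambda>i. map (\<lambda>a.
      (mconst (c i * - (of_int (a * (int i - 1 - a)) / 2)) * e a, e (int i - 1 - a)))
      [1..int i - 2]) [0..<Suc N])"
  have ps_sum: "(\<Sum>(\<alpha>, \<beta>)\<leftarrow>ps. g \<alpha> \<beta>) = (\<Sum>i=0..N. \<Sum>a\<in>{1..int i - 2}.
      g (mconst (c i * - (of_int (a * (int i - 1 - a)) / 2)) * e a) (e (int i - 1 - a)))"
    for g :: "mform \<Rightarrow> mform \<Rightarrow> 'b :: comm_monoid_add"
  proof -
    have "sum_list (map h (concat xss)) = (\<Sum>xs\<leftarrow>xss. sum_list (map h xs))"
      for h :: "mform \<times> mform \<Rightarrow> 'b" and xss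
      by (induction xss) simp_all
    thus ?thesis
      unfolding ps_def map_map o_def split
      by (simp only: map_map o_def split interv_sum_list_conv_sum_set_int
          interv_sum_list_conv_sum_set_nat set_upto set_upt atLeastLessThanSuc_atLeastAtMost)
  qed
  have psK: "set ps \<subseteq> forms_K P \<times> forms_K P"
    by (auto simp: ps_def intro!: forms_K_scale e_in_forms_K)
  have int: "integral_at z X" if "Pt z \<noteq> P" for z
    using polynomial_vf_away[OF that] unfolding X vf_regular_Pt .
  \<comment> \<open>\<open>omega_coeff_affine\<close> rewrites both sides to the same expression in
    the affine coordinate.\<close>
  have coeff: "omega_coeff v X z1 z2 = omega_coeff r X z1 z2"
    if v: "coordinate v" and z: "z1 \<noteq> z2" "Pt z1 \<noteq> P" "Pt z2 \<noteq> P"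
      and np: "\<not> fun_pole (Pt z1) v" "\<not> fun_pole (Pt z2) v" for v z1 z2
  proof -
    obtain Q a b where vQ: "b \<noteq> 0" "v = mconst a + mconst b * std_coord Q"
      using coordinate_affine[OF v] .
    have "fun_pole Q v"
    proof -
      have "laurent_at Q v $$ (-1) \<noteq> 0" using vQ by simp
      thus ?thesis unfolding fun_pole_iff by (metis fls_integral_iff not_less zero_less_one neg_less_0_iff_less)
    qed
    hence zQ: "Pt z1 \<noteq> Q" "Pt z2 \<noteq> Q" using np by auto
    obtain a' b' where r: "b' \<noteq> 0" "r = mconst a' + mconst b' * std_coord P" by (rule r_affine)
    show ?thesis
      using omega_coeff_affine[OF vQ z(1) zQ int[OF z(2)] int[OF z(3)]]
        omega_coeff_affine[OF r z int[OF z(2)] int[OF z(3)]] by simp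
  qed
  have bidiff: "(\<Sum>(\<alpha>, \<beta>)\<leftarrow>ps. (mval \<alpha> z1 * mval \<beta> z2 + mval \<alpha> z2 * mval \<beta> z1) / 2)
      = omega_coeff r X z1 z2" if z: "z1 \<noteq> z2" "Pt z1 \<noteq> P" "Pt z2 \<noteq> P" for z1 z2
    unfolding ps_sum X omega_coeff_r[OF z] sum_distrib_left
  proof (rule sum.cong[OF refl])
    fix i
    define k where "k = int i - 1"
    define t where "t a = - (of_int (a * (k - a)) / 2 :: complex)" for a
    have ie: "integral_at z (e a)" if "a \<in> {1..k - 1}" "Pt z \<noteq> P" for a z
      using that e_in_forms_K[of a] integral_forms_K by simp
    \<comment> \<open>The reflection \<open>a \<mapsto> k - a\<close> exchanges the two points, so
      averaging over both orders changes nothing.\<close>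
    have "(\<Sum>a\<in>{1..k - 1}. t a * (mval (e a) z2 * mval (e (k - a)) z1))
        = (\<Sum>a\<in>{1..k - 1}. t a * (mval (e a) z1 * mval (e (k - a)) z2))"
      by (rule sum.reindex_bij_witness[of _ "\<lambda>a. k - a" "\<lambda>a. k - a"]) (auto simp: t_def mult_ac)
    hence "(\<Sum>a\<in>{1..k - 1}. (t a * (mval (e a) z1 * mval (e (k - a)) z2)
          + t a * (mval (e a) z2 * mval (e (k - a)) z1)) / 2)
        = (\<Sum>a\<in>{1..k - 1}. t a * (mval (e a) z1 * mval (e (k - a)) z2))"
      by (simp add: sum.distrib flip: sum_divide_distrib)
    hence "(\<Sum>a\<in>{1..k - 1}. c i * ((t a * (mval (e a) z1 * mval (e (k - a)) z2)
          + t a * (mval (e a) z2 * mval (e (k - a)) z1)) / 2))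
        = (\<Sum>a\<in>{1..k - 1}. c i * (t a * (mval (e a) z1 * mval (e (k - a)) z2)))"
      by (simp only: sum_distrib_left[symmetric])
    moreover have "(\<Sum>a\<in>{1..k - 1}. (mval (mconst (c i * t a) * e a) z1 * mval (e (k - a)) z2
          + mval (mconst (c i * t a) * e a) z2 * mval (e (k - a)) z1) / 2)
        = (\<Sum>a\<in>{1..k - 1}. c i * ((t a * (mval (e a) z1 * mval (e (k - a)) z2)
          + t a * (mval (e a) z2 * mval (e (k - a)) z1)) / 2))"
    proof (rule sum.cong[OF refl])
      fix a assume a: "a \<in> {1..k - 1}"
      have "mval (mconst (c i * t a) * e a) z1 = c i * t a * mval (e a) z1"
        "mval (mconst (c i * t a) * e a) z2 = c i * t a * mval (e a) z2"
        using z by (auto intro!: mval_scale ie[OF a])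
      thus "(mval (mconst (c i * t a) * e a) z1 * mval (e (k - a)) z2
          + mval (mconst (c i * t a) * e a) z2 * mval (e (k - a)) z1) / 2
        = c i * ((t a * (mval (e a) z1 * mval (e (k - a)) z2)
          + t a * (mval (e a) z2 * mval (e (k - a)) z1)) / 2)"
        by (simp only:) (simp add: algebra_simps)
    qed
    ultimately show "(\<Sum>a\<in>{1..int i - 2}.
        (mval (mconst (c i * - (of_int (a * (int i - 1 - a)) / 2)) * e a) z1 * mval (e (int i - 1 - a)) z2
          + mval (mconst (c i * - (of_int (a * (int i - 1 - a)) / 2)) * e a) z2 * mval (e (int i - 1 - a)) z1) / 2)
      = (\<Sum>a\<in>{1..int i - 2}. c i * (- (of_int (a * (int i - 1 - a)) / 2)
          * (mval (e a) z1 * mval (e (int i - 1 - a)) z2)))"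
      by (simp add: k_def t_def)
  qed
  have val: "(\<Sum>(\<alpha>, \<beta>)\<leftarrow>ps. sym_incl \<alpha> * sym_incl \<beta>) = (\<Sum>i=0..N. sym_const (c i) * \<Omega> (int i - 1))"
    unfolding ps_sum \<Omega>_def sum_distrib_left
  proof (rule sum.cong[OF refl])
    fix i
    have "int i - 1 - 1 = int i - 2" by simp
    thus "(\<Sum>a\<in>{1..int i - 2}. sym_incl (mconst (c i * - (of_int (a * (int i - 1 - a)) / 2)) * e a)
          * sym_incl (e (int i - 1 - a)))
        = (\<Sum>a\<in>{1..int i - 1 - 1}. sym_const (c i) *
          (sym_const (- (of_int (a * (int i - 1 - a)) / 2)) * (E a * E (int i - 1 - a))))"
      by (simp only: sym_incl_scale sym_const_mult E_def mult.assoc)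
  qed
  show ?thesis
    unfolding omega_def
  proof (rule the_equality)
    show "\<exists>ps. set ps \<subseteq> forms_K P \<times> forms_K P \<and>
      (\<Sum>i=0..N. sym_const (c i) * \<Omega> (int i - 1)) = (\<Sum>(\<alpha>, \<beta>)\<leftarrow>ps. sym_incl \<alpha> * sym_incl \<beta>) \<and>
      (\<forall>u. coordinate u \<longrightarrow> (\<forall>z1 z2. z1 \<noteq> z2 \<longrightarrow> Pt z1 \<noteq> P \<longrightarrow> Pt z2 \<noteq> P \<longrightarrow>
          \<not> fun_pole (Pt z1) u \<longrightarrow> \<not> fun_pole (Pt z2) u \<longrightarrow>
          (\<Sum>(\<alpha>, \<beta>)\<leftarrow>ps. (mval \<alpha> z1 * mval \<beta> z2 + mval \<alpha> z2 * mval \<beta> z1) / 2)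
            = omega_coeff u X z1 z2))"
      using psK val bidiff coeff by (intro exI[of _ ps]) auto
  next
    fix w
    assume "\<exists>ps. set ps \<subseteq> forms_K P \<times> forms_K P \<and>
      w = (\<Sum>(\<alpha>, \<beta>)\<leftarrow>ps. sym_incl \<alpha> * sym_incl \<beta>) \<and>
      (\<forall>u. coordinate u \<longrightarrow> (\<forall>z1 z2. z1 \<noteq> z2 \<longrightarrow> Pt z1 \<noteq> P \<longrightarrow> Pt z2 \<noteq> P \<longrightarrow>
          \<not> fun_pole (Pt z1) u \<longrightarrow> \<not> fun_pole (Pt z2) u \<longrightarrow>
          (\<Sum>(\<alpha>, \<beta>)\<leftarrow>ps. (mval \<alpha> z1 * mval \<beta> z2 + mval \<alpha> z2 * mval \<beta> z1) / 2)
            = omega_coeff u X z1 z2))"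
    then obtain qs where qs: "set qs \<subseteq> forms_K P \<times> forms_K P"
      "w = (\<Sum>(\<alpha>, \<beta>)\<leftarrow>qs. sym_incl \<alpha> * sym_incl \<beta>)"
      "\<And>z1 z2. z1 \<noteq> z2 \<Longrightarrow> Pt z1 \<noteq> P \<Longrightarrow> Pt z2 \<noteq> P \<Longrightarrow>
          \<not> fun_pole (Pt z1) u \<Longrightarrow> \<not> fun_pole (Pt z2) u \<Longrightarrow>
          (\<Sum>(\<alpha>, \<beta>)\<leftarrow>qs. (mval \<alpha> z1 * mval \<beta> z2 + mval \<alpha> z2 * mval \<beta> z1) / 2)
            = omega_coeff u X z1 z2"
      using coord by blast
    \<comment> \<open>The difference of the two representations, written as one list of pairs of
      forms.\<close>
    define ds where "ds = qs @ map (\<lambda>(\<alpha>, \<beta>). (mconst (- 1) * \<alpha>, \<beta>)) ps"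
    have dsK: "set ds \<subseteq> forms_K P \<times> forms_K P"
      using qs(1) psK by (auto simp: ds_def intro!: forms_K_scale)
    have sum_ds: "(\<Sum>i<length ds. g (fst (ds ! i)) (snd (ds ! i)))
        = (\<Sum>(\<alpha>, \<beta>)\<leftarrow>qs. g \<alpha> \<beta>) + (\<Sum>(\<alpha>, \<beta>)\<leftarrow>ps. g (mconst (- 1) * \<alpha>) \<beta>)"
      for g :: "mform \<Rightarrow> mform \<Rightarrow> 'b :: comm_monoid_add"
    proof -
      have "(\<Sum>i<length ds. g (fst (ds ! i)) (snd (ds ! i))) = (\<Sum>(\<alpha>, \<beta>)\<leftarrow>ds. g \<alpha> \<beta>)"
        by (simp add: sum_list_sum_nth case_prod_unfold atLeast0LessThan)
      also have "\<dots> = (\<Sum>(\<alpha>, \<beta>)\<leftarrow>qs. g \<alpha> \<beta>) + (\<Sum>(\<alpha>, \<beta>)\<leftarrow>ps. g (mconst (- 1) * \<alpha>) \<beta>)"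
        by (simp add: ds_def o_def case_prod_unfold)
      finally show ?thesis .
    qed
    have "(\<Sum>i<length ds. sym_incl (fst (ds ! i)) * sym_incl (snd (ds ! i))) = 0"
    proof (rule bidifferential_zero_imp_sym_zero)
      fix i assume "i \<in> {..<length ds}"
      hence "ds ! i \<in> set ds" by simp
      thus "fst (ds ! i) \<in> forms_K P" "snd (ds ! i) \<in> forms_K P" using dsK by auto
    next
      fix z1 z2
      assume z: "z1 \<noteq> z2" "Pt z1 \<noteq> P" "Pt z2 \<noteq> P" and np: "\<not> fun_pole (Pt z1) u" "\<not> fun_pole (Pt z2) u"
      have "(\<Sum>(\<alpha>, \<beta>)\<leftarrow>ps. (mval (mconst (- 1) * \<alpha>) z1 * mval \<beta> z2
          + mval (mconst (- 1) * \<alpha>) z2 * mval \<beta> z1) / 2)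
        = (\<Sum>(\<alpha>, \<beta>)\<leftarrow>ps. - ((mval \<alpha> z1 * mval \<beta> z2 + mval \<alpha> z2 * mval \<beta> z1) / 2))"
      proof (intro arg_cong[where f = sum_list] map_cong refl)
        fix p assume p: "p \<in> set ps"
        obtain \<alpha> \<beta> where \<alpha>\<beta>: "p = (\<alpha>, \<beta>)" by (cases p)
        have "\<alpha> \<in> forms_K P" using p \<alpha>\<beta> psK by auto
        hence "mval (mconst (- 1) * \<alpha>) z1 = - mval \<alpha> z1" "mval (mconst (- 1) * \<alpha>) z2 = - mval \<alpha> z2"
          using z mval_scale[of _ \<alpha> "-1"] integral_forms_K by simp_all
        thus "(case p of (\<alpha>, \<beta>) \<Rightarrow> (mval (mconst (- 1) * \<alpha>) z1 * mval \<beta> z2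
            + mval (mconst (- 1) * \<alpha>) z2 * mval \<beta> z1) / 2)
          = (case p of (\<alpha>, \<beta>) \<Rightarrow> - ((mval \<alpha> z1 * mval \<beta> z2 + mval \<alpha> z2 * mval \<beta> z1) / 2))"
          unfolding \<alpha>\<beta> prod.case by (simp only:) (simp add: field_simps)
      qed
      also have "\<dots> = - omega_coeff r X z1 z2"
        unfolding bidiff[OF z, symmetric]
        by (simp add: case_prod_unfold uminus_sum_list_map o_def)
      finally show "(\<Sum>i<length ds. (mval (fst (ds ! i)) z1 * mval (snd (ds ! i)) z2
          + mval (fst (ds ! i)) z2 * mval (snd (ds ! i)) z1) / 2) = 0"
        using sum_ds[of "\<lambda>\<alpha> \<beta>. (mval \<alpha> z1 * mval \<beta> z2 + mval \<alpha> z2 * mval \<beta> z1) / 2"]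
          qs(3)[OF z np] coeff[OF coord z np] by simp
    qed
    moreover have "(\<Sum>(\<alpha>, \<beta>)\<leftarrow>ps. sym_incl (mconst (- 1) * \<alpha>) * sym_incl \<beta>)
        = - (\<Sum>(\<alpha>, \<beta>)\<leftarrow>ps. sym_incl \<alpha> * sym_incl \<beta>)"
      by (simp add: case_prod_unfold uminus_sum_list_map o_def sym_incl_scale sym_const_minus)
    ultimately have "w = (\<Sum>(\<alpha>, \<beta>)\<leftarrow>ps. sym_incl \<alpha> * sym_incl \<beta>)"
      using sum_ds[of "\<lambda>\<alpha> \<beta>. sym_incl \<alpha> * sym_incl \<beta>"] qs(2) by simp
    thus "w = (\<Sum>i=0..N. sym_const (c i) * \<Omega> (int i - 1))" using val by simp
  qed
qed

end

section \<open>Derivations of the symmetric algebra\<close>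

definition sym_linear :: "(mform \<Rightarrow> sym_alg) \<Rightarrow> bool" where
  "sym_linear f \<longleftrightarrow> (\<forall>\<alpha> \<beta>. f (\<alpha> + \<beta>) = f \<alpha> + f \<beta>) \<and> (\<forall>c \<alpha>. f (mconst c * \<alpha>) = sym_const c * f \<alpha>)"

definition free_linear :: "(mform multiset \<Rightarrow> sym_alg) \<Rightarrow> free_alg \<Rightarrow> sym_alg" where
  "free_linear h p = (\<Sum>m\<in>Poly_Mapping.keys p. sym_const (Poly_Mapping.lookup p m) * h m)"

lemma free_linear_superset:
  assumes "finite S" "Poly_Mapping.keys p \<subseteq> S"
  shows "free_linear h p = (\<Sum>m\<in>S. sym_const (Poly_Mapping.lookup p m) * h m)"
  unfolding free_linear_def using assms
  by (intro sum.mono_neutral_left) (auto simp: in_keys_iff)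

lemma free_linear_0 [simp]: "free_linear h 0 = 0"
  by (simp add: free_linear_def)

lemma free_linear_single [simp]: "free_linear h (Poly_Mapping.single m c) = sym_const c * h m"
  by (subst free_linear_superset[of "{m}"]) auto

lemma free_linear_add: "free_linear h (p + q) = free_linear h p + free_linear h q"
proof -
  define S where "S = Poly_Mapping.keys p \<union> Poly_Mapping.keys q"
  have S: "finite S" "Poly_Mapping.keys p \<subseteq> S" "Poly_Mapping.keys q \<subseteq> S"
    "Poly_Mapping.keys (p + q) \<subseteq> S"
    using keys_add[of p q] by (auto simp: S_def)
  show ?thesis
    using S by (simp add: free_linear_superset[of S] lookup_add sym_const_add ring_distribs
        sum.distrib)
qed

lemma free_linear_uminus: "free_linear h (- p) = - free_linear h p"
  using free_linear_add[of h p "- p"] by (simp add: add_eq_0_iff)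

lemma free_linear_diff: "free_linear h (p - q) = free_linear h p - free_linear h q"
  using free_linear_add[of h p "- q"] by (simp add: free_linear_uminus)

lemma free_alg_induct [case_names zero single add]:
  assumes "P 0" "\<And>m c. P (Poly_Mapping.single m c)" "\<And>p q. P p \<Longrightarrow> P q \<Longrightarrow> P (p + q)"
  shows "P (p :: free_alg)"
proof (induction p rule: Poly_Mapping.update_induct)
  case const
  show ?case by (rule assms)
next
  case (update f a b)
  have "Poly_Mapping.update a b f = f + Poly_Mapping.single a b"
    using update(1)
    by (intro poly_mapping_eqI) (auto simp: lookup_update lookup_add lookup_single when_def in_keys_iff)
  thus ?case using assms update by simp
qed

definition mset_incl :: "mform multiset \<Rightarrow> sym_alg" where
  "mset_incl m = (\<Prod>\<alpha>\<in>#m. sym_incl \<alpha>)"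

lemma mset_incl_simps [simp]:
  "mset_incl {#} = 1" "mset_incl (add_mset \<alpha> m) = sym_incl \<alpha> * mset_incl m"
  "mset_incl (m + n) = mset_incl m * mset_incl n"
  by (simp_all add: mset_incl_def)

lemma abs_single: "abs_sym_alg (Poly_Mapping.single m c) = sym_const c * mset_incl m"
proof (induction m)
  case empty
  show ?case by (simp add: sym_const.abs_eq)
next
  case (add \<alpha> m)
  have "abs_sym_alg (Poly_Mapping.single {#\<alpha>#} 1 * Poly_Mapping.single m c)
      = sym_incl \<alpha> * abs_sym_alg (Poly_Mapping.single m c)"
    by (simp only: times_sym_alg.abs_eq sym_incl.abs_eq)
  thus ?case by (simp add: mult_single add mult.left_commute)
qed

lemma abs_free: "abs_sym_alg p = free_linear mset_incl p"
  by (induction p rule: free_alg_induct)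
    (simp_all add: abs_single free_linear_add zero_sym_alg.abs_eq[symmetric]
      plus_sym_alg.abs_eq[symmetric])

text \<open>The Leibniz rule on a monomial; a repeated factor is counted with its
  multiplicity.\<close>

definition mset_deriv :: "(mform \<Rightarrow> sym_alg) \<Rightarrow> mform multiset \<Rightarrow> sym_alg" where
  "mset_deriv f m = (\<Sum>\<alpha>\<in>#m. f \<alpha> * mset_incl (m - {#\<alpha>#}))"

lemma mset_deriv_empty [simp]: "mset_deriv f {#} = 0"
  by (simp add: mset_deriv_def)

lemma mset_deriv_add_mset [simp]:
  "mset_deriv f (add_mset \<beta> m) = f \<beta> * mset_incl m + sym_incl \<beta> * mset_deriv f m"
proof -
  have "(\<Sum>\<alpha>\<in>#m. f \<alpha> * mset_incl (add_mset \<beta> m - {#\<alpha>#}))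
      = (\<Sum>\<alpha>\<in>#m. sym_incl \<beta> * (f \<alpha> * mset_incl (m - {#\<alpha>#})))"
  proof (rule arg_cong[where f = sum_mset], rule image_mset_cong)
    fix \<alpha> assume "\<alpha> \<in># m"
    hence "add_mset \<beta> m - {#\<alpha>#} = add_mset \<beta> (m - {#\<alpha>#})"
      by (metis diff_union_swap2 add_mset_remove_trivial insert_DiffM)
    thus "f \<alpha> * mset_incl (add_mset \<beta> m - {#\<alpha>#}) = sym_incl \<beta> * (f \<alpha> * mset_incl (m - {#\<alpha>#}))"
      by (simp add: mult.left_commute)
  qed
  thus ?thesis by (simp add: mset_deriv_def sum_mset_distrib_left)
qed

lemma mset_deriv_add: "mset_deriv f (m + n) = mset_deriv f m * mset_incl n + mset_incl m * mset_deriv f n"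
  by (induction m) (simp_all add: algebra_simps)

definition free_deriv :: "(mform \<Rightarrow> sym_alg) \<Rightarrow> free_alg \<Rightarrow> sym_alg" where
  "free_deriv f = free_linear (mset_deriv f)"

lemma free_deriv_mult: "free_deriv f (p * q) = free_deriv f p * abs_sym_alg q + abs_sym_alg p * free_deriv f q"
proof (induction p rule: free_alg_induct)
  case (single m c)
  show ?case
  proof (induction q rule: free_alg_induct)
    case (single n d)
    show ?case
      by (simp add: free_deriv_def mult_single mset_deriv_add abs_single sym_const_mult algebra_simps)
  next
    case (add p q)
    thus ?case
      by (simp add: free_deriv_def free_linear_add abs_free algebra_simps)
  qed (simp add: free_deriv_def abs_free)
next
  case (add p q)
  thus ?case
    by (simp add: free_deriv_def free_linear_add abs_free algebra_simps)
qed (simp add: free_deriv_def abs_free)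

lemma abs_ideal:
  assumes "p \<in> sym_ideal"
  shows "abs_sym_alg p = 0"
proof -
  have "abs_sym_alg p = abs_sym_alg 0"
    unfolding sym_alg.abs_eq_iff sym_rel_def using assms by simp
  thus ?thesis by (simp add: zero_sym_alg.abs_eq)
qed

text \<open>Because \<open>free_deriv\<close> takes values in the quotient, the Leibniz rule on
  \<open>r * a\<close> has two vanishing terms: \<open>a\<close> is zero there, and so is its
  derivative by induction. The linear generators are covered by \<open>sym_linear\<close>.\<close>

lemma free_deriv_ideal:
  assumes "sym_linear f" "p \<in> sym_ideal"
  shows "free_deriv f p = 0"
  using assms(2)
proof induction
  case (mult a r)
  thus ?case by (simp add: free_deriv_mult abs_ideal)
qed (use assms(1) in \<open>simp_all add: free_deriv_def free_linear_add free_linear_diff sym_linear_def\<close>)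

text \<open>Independence of the representative depends on linearity of \<open>f\<close>, hence a
  chosen representative instead of a lifted definition.\<close>

definition sym_deriv :: "(mform \<Rightarrow> sym_alg) \<Rightarrow> sym_alg \<Rightarrow> sym_alg" where
  "sym_deriv f w = free_deriv f (rep_sym_alg w)"

lemma sym_deriv_abs:
  assumes "sym_linear f"
  shows "sym_deriv f (abs_sym_alg p) = free_deriv f p"
proof -
  have "abs_sym_alg (rep_sym_alg (abs_sym_alg p)) = abs_sym_alg p"
    by (rule Quotient3_abs_rep[OF Quotient3_sym_alg])
  hence "rep_sym_alg (abs_sym_alg p) - p \<in> sym_ideal"
    unfolding sym_alg.abs_eq_iff sym_rel_def .
  hence "free_deriv f (rep_sym_alg (abs_sym_alg p) - p) = 0"
    by (rule free_deriv_ideal[OF assms])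
  thus ?thesis by (simp add: sym_deriv_def free_deriv_def free_linear_diff)
qed

definition derivation :: "(sym_alg \<Rightarrow> sym_alg) \<Rightarrow> bool" where
  "derivation T \<longleftrightarrow> (\<forall>v w. T (v + w) = T v + T w) \<and> (\<forall>v w. T (v * w) = T v * w + v * T w)
     \<and> (\<forall>c. T (sym_const c) = 0)"

lemma derivation_sym_deriv:
  assumes "sym_linear f"
  shows "derivation (sym_deriv f)"
  unfolding derivation_def
proof (intro conjI allI)
  fix v w :: sym_alg
  obtain p q where v: "v = abs_sym_alg p" and w: "w = abs_sym_alg q"
    by (metis Quotient3_abs_rep[OF Quotient3_sym_alg])
  have "sym_deriv f (abs_sym_alg (p + q)) = sym_deriv f v + sym_deriv f w"
    unfolding v w sym_deriv_abs[OF assms] by (simp add: free_deriv_def free_linear_add)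
  thus "sym_deriv f (v + w) = sym_deriv f v + sym_deriv f w"
    by (simp add: v w plus_sym_alg.abs_eq)
  have "sym_deriv f (abs_sym_alg (p * q)) = sym_deriv f v * w + v * sym_deriv f w"
    unfolding v w sym_deriv_abs[OF assms] by (rule free_deriv_mult)
  thus "sym_deriv f (v * w) = sym_deriv f v * w + v * sym_deriv f w"
    by (simp add: v w times_sym_alg.abs_eq)
next
  fix c
  show "sym_deriv f (sym_const c) = 0"
    unfolding sym_const.abs_eq sym_deriv_abs[OF assms] by (simp add: free_deriv_def)
qed

lemma sym_deriv_incl:
  assumes "sym_linear f"
  shows "sym_deriv f (sym_incl \<alpha>) = f \<alpha>"
  unfolding sym_incl.abs_eq sym_deriv_abs[OF assms] by (simp add: free_deriv_def)

lemma derivationD: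
  assumes "derivation T"
  shows "T (v + w) = T v + T w" "T (v * w) = T v * w + v * T w" "T (sym_const c) = 0"
    "T 0 = 0" "T 1 = 0" "T (sym_const c * w) = sym_const c * T w" "T (- w) = - T w"
    "T (v - w) = T v - T w"
proof -
  note T = assms[unfolded derivation_def]
  show add: "T (v + w) = T v + T w" for v w using T by blast
  show mult: "T (v * w) = T v * w + v * T w" for v w using T by blast
  show const: "T (sym_const c) = 0" for c using T by blast
  show 0: "T 0 = 0" using const[of 0] by simp
  show "T 1 = 0" using const[of 1] by simp
  show "T (sym_const c * w) = sym_const c * T w" by (simp add: mult const)
  show minus: "T (- w) = - T w" for w using add[of w "- w"] 0 by (simp add: add_eq_0_iff)
  show "T (v - w) = T v - T w" using add[of v "- w"] by (simp add: minus)
qed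

lemma derivation_sum: "derivation T \<Longrightarrow> T (sum f A) = (\<Sum>i\<in>A. T (f i))"
  by (induction A rule: infinite_finite_induct) (simp_all add: derivationD)

lemma derivation_commutator:
  assumes "derivation S" "derivation T"
  shows "derivation (\<lambda>w. S (T w) - T (S w))"
  unfolding derivation_def
  by (auto simp: derivationD[OF assms(1)] derivationD[OF assms(2)] algebra_simps)

lemma derivation_scale: "derivation T \<Longrightarrow> derivation (\<lambda>w. sym_const c * T w)"
  unfolding derivation_def by (simp add: algebra_simps)

lemma derivation_zero: "derivation (\<lambda>w. 0)"
  by (simp add: derivation_def)

lemma sym_prod_Nil [simp]: "sym_prod [] = 1"
  and sym_prod_Cons [simp]: "sym_prod (\<alpha> # \<alpha>s) = sym_incl \<alpha> * sym_prod \<alpha>s"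
  and sym_prod_append: "sym_prod (\<alpha>s @ \<beta>s) = sym_prod \<alpha>s * sym_prod \<beta>s"
  by (simp_all add: sym_prod_def)

lemma sum_lessThan_length_Cons:
  "(\<Sum>i<length (x # xs). f i) = f 0 + (\<Sum>i<length xs. f (Suc i))"
  by (simp only: length_Cons sum.lessThan_Suc_shift)

lemma derivation_sym_prod_update:
  assumes "derivation T" "\<And>\<alpha>. \<alpha> \<in> set \<alpha>s \<Longrightarrow> T (sym_incl \<alpha>) = sym_incl (\<psi> \<alpha>)"
  shows "T (sym_prod \<alpha>s) = (\<Sum>i<length \<alpha>s. sym_prod (\<alpha>s[i := \<psi> (\<alpha>s ! i)]))"
  using assms(2)
proof (induction \<alpha>s)
  case (Cons \<alpha> \<alpha>s)
  thus ?case
    unfolding sum_lessThan_length_Cons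
    by (simp add: derivationD[OF assms(1)] sum_distrib_left)
qed (simp add: derivationD[OF assms(1)])

text \<open>Products over index sets, as in \<open>X_minus\<close>; the \<open>Cons\<close> rules
  below shift the indices so that induction on the list is possible.\<close>

definition omit :: "nat set \<Rightarrow> mform list \<Rightarrow> sym_alg" where
  "omit I \<alpha>s = (\<Prod>k\<in>{..<length \<alpha>s} - I. sym_incl (\<alpha>s ! k))"

lemma omit_Cons_Suc: "omit (Suc ` I) (\<alpha> # \<alpha>s) = sym_incl \<alpha> * omit I \<alpha>s"
proof -
  have "{..<length (\<alpha> # \<alpha>s)} - Suc ` I = insert 0 (Suc ` ({..<length \<alpha>s} - I))"
    by (auto simp: lessThan_Suc_eq_insert_0)
  thus ?thesis
    unfolding omit_def by (simp add: prod.reindex)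
qed

lemma omit_empty: "omit {} \<alpha>s = sym_prod \<alpha>s"
proof (induction \<alpha>s)
  case Nil
  show ?case by (simp add: omit_def)
next
  case (Cons \<alpha> \<alpha>s)
  thus ?case using omit_Cons_Suc[of "{}" \<alpha> \<alpha>s] by simp
qed

lemma omit_Cons_0: "omit (insert 0 (Suc ` I)) (\<alpha> # \<alpha>s) = omit I \<alpha>s"
proof -
  have "{..<length (\<alpha> # \<alpha>s)} - insert 0 (Suc ` I) = Suc ` ({..<length \<alpha>s} - I)"
    by (auto simp: lessThan_Suc_eq_insert_0)
  thus ?thesis
    unfolding omit_def by (simp add: prod.reindex)
qed

lemma derivation_sym_prod:
  assumes "derivation T"
  shows "T (sym_prod \<alpha>s) = (\<Sum>i<length \<alpha>s. T (sym_incl (\<alpha>s ! i)) * omit {i} \<alpha>s)"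
proof (induction \<alpha>s)
  case (Cons \<alpha> \<alpha>s)
  have "omit {Suc i} (\<alpha> # \<alpha>s) = sym_incl \<alpha> * omit {i} \<alpha>s" for i
    using omit_Cons_Suc[of "{i}"] by simp
  moreover have "omit {0} (\<alpha> # \<alpha>s) = sym_prod \<alpha>s"
    using omit_Cons_0[of "{}"] by (simp add: omit_empty)
  ultimately show ?case
    unfolding sum_lessThan_length_Cons
    by (simp add: derivationD[OF assms] Cons sum_distrib_left mult.left_commute)
qed (simp add: derivationD[OF assms])

section \<open>Operators on the Fock space\<close>

text \<open>The subalgebra \<open>sym_W\<close> described as a linear span of products of forms. In
  this shape a linear operator is visibly determined by its values on products.\<close>

inductive_set sym_span :: "cp1 \<Rightarrow> sym_alg set" for P where
  prod: "set \<alpha>s \<subseteq> forms_K P \<Longrightarrow> sym_const c * sym_prod \<alpha>s \<in> sym_span P"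
| plus: "v \<in> sym_span P \<Longrightarrow> w \<in> sym_span P \<Longrightarrow> v + w \<in> sym_span P"

lemma sym_span_mult:
  assumes "v \<in> sym_span P" "w \<in> sym_span P"
  shows "v * w \<in> sym_span P"
  using assms(1)
proof induction
  case v: (prod \<alpha>s c)
  show ?case using assms(2)
  proof induction
    case (prod \<beta>s d)
    have "sym_const c * sym_prod \<alpha>s * (sym_const d * sym_prod \<beta>s)
        = sym_const (c * d) * sym_prod (\<alpha>s @ \<beta>s)"
      by (simp add: sym_const_mult sym_prod_append mult_ac)
    thus ?case using sym_span.prod[of "\<alpha>s @ \<beta>s" P "c * d"] v prod by simp
  qed (simp add: ring_distribs sym_span.plus)
qed (simp add: ring_distribs sym_span.plus)

lemma sym_W_eq_span: "sym_W P = sym_span P"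
proof
  show "sym_W P \<subseteq> sym_span P"
  proof
    fix w assume "w \<in> sym_W P"
    thus "w \<in> sym_span P"
    proof induction
      case (const c)
      show ?case using sym_span.prod[of "[]" P c] by simp
    next
      case (incl \<alpha>)
      thus ?case using sym_span.prod[of "[\<alpha>]" P 1] by simp
    qed (auto intro: sym_span.plus sym_span_mult)
  qed
  show "sym_span P \<subseteq> sym_W P"
  proof
    fix w assume "w \<in> sym_span P"
    thus "w \<in> sym_W P"
    proof induction
      case (prod \<alpha>s c)
      have "sym_prod \<alpha>s \<in> sym_W P"
        using prod
      proof (induction \<alpha>s)
        case Nil
        show ?case using sym_W.const[of 1] by simp
      qed (auto intro: sym_W.mult sym_W.incl)
      thus ?case by (intro sym_W.mult sym_W.const)
    qed (rule sym_W.plus)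
  qed
qed

lemma sym_W_scale: "w \<in> sym_W P \<Longrightarrow> sym_const c * w \<in> sym_W P"
  by (intro sym_W.mult sym_W.const)

lemma sym_W_0: "0 \<in> sym_W P" and sym_W_1: "1 \<in> sym_W P"
  using sym_W.const[of 0 P] sym_W.const[of 1 P] by simp_all

lemma sym_W_sum: "(\<And>i. i \<in> A \<Longrightarrow> f i \<in> sym_W P) \<Longrightarrow> sum f A \<in> sym_W P"
  by (induction A rule: infinite_finite_induct) (auto intro: sym_W.plus sym_W_0)

text \<open>The restriction of \<open>T\<close> proves existence, so the values \<open>F\<close>
  need no separate check of multilinearity or symmetry; uniqueness holds because the products span
  \<open>sym_W\<close>.\<close>

lemma operator_W_eq:
  assumes W: "\<And>v. v \<in> sym_W P \<Longrightarrow> T v \<in> sym_W P"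
    and add: "\<And>v w. T (v + w) = T v + T w"
    and scale: "\<And>c v. T (sym_const c * v) = sym_const c * T v"
    and prod: "\<And>\<alpha>s. set \<alpha>s \<subseteq> forms_K P \<Longrightarrow> T (sym_prod \<alpha>s) = F \<alpha>s"
    and w: "w \<in> sym_W P"
  shows "operator_W P F w = T w"
proof -
  have prodW: "sym_prod \<alpha>s \<in> sym_W P" if "set \<alpha>s \<subseteq> forms_K P" for \<alpha>s
    using sym_span.prod[OF that, of 1] unfolding sym_W_eq_span by simp
  have "operator_W P F = (\<lambda>v. if v \<in> sym_W P then T v else 0)"
    unfolding operator_W_def
  proof (rule the_equality, goal_cases)
    case 1
    show ?case
      using W prodW by (auto simp: add scale prod sym_W.plus sym_W_scale)
  next
    case (2 T')
    show ?case
    proof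
      fix v
      have "T' v = T v" if "v \<in> sym_W P"
        using that unfolding sym_W_eq_span
      proof induction
        case (prod \<alpha>s c)
        thus ?case using 2 prodW assms(4) scale by simp
      next
        case (plus v w)
        have "T' (v + w) = T' v + T' w"
          using 2 plus.hyps unfolding sym_W_eq_span by blast
        thus ?case using plus.IH add by simp
      qed
      thus "T' v = (if v \<in> sym_W P then T v else 0)" using 2 by auto
    qed
  qed
  thus ?thesis using w by simp
qed

lemma form_residue_mderiv: "form_residue Q (mderiv f) = 0"
  unfolding form_residue_laurent laurent_at_mderiv by (rule fls_residue_deriv)

text \<open>Cartan's formula in dimension one, where every 1-form is closed. Lie derivatives are
  thus exact and have no residues.\<close>

lemma lie_deriv_eq: "lie_deriv X \<alpha> = mderiv (X * \<alpha>)"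
  by (simp add: lie_deriv_def mderiv_mult)

lemma second_kind_lie_deriv: "second_kind (lie_deriv X \<alpha>)"
  by (simp add: second_kind_def lie_deriv_eq form_residue_mderiv)

lemma lie_deriv_add: "lie_deriv X (\<alpha> + \<beta>) = lie_deriv X \<alpha> + lie_deriv X \<beta>"
  by (simp add: lie_deriv_eq mderiv_add ring_distribs)

lemma lie_deriv_scale: "lie_deriv X (mconst c * \<alpha>) = mconst c * lie_deriv X \<alpha>"
  by (simp add: lie_deriv_eq mderiv_mult algebra_simps)

context vanishing_coordinate begin

section \<open>Linear maps given by their values on the basis, and the vacuum value of the creation
  part\<close>

definition coeff_sum :: "(int \<Rightarrow> sym_alg) \<Rightarrow> mform \<Rightarrow> sym_alg" where
  "coeff_sum G \<eta> = (\<Sum>k | k \<ge> 1 \<and> \<phi> k \<eta> \<noteq> 0. sym_const (\<phi> k \<eta>) * G k)"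

lemma coeff_sum_eq:
  assumes "\<And>k. k > N \<Longrightarrow> \<phi> k \<eta> = 0"
  shows "coeff_sum G \<eta> = (\<Sum>k\<in>{1..N}. sym_const (\<phi> k \<eta>) * G k)"
  unfolding coeff_sum_def
  by (rule sum.mono_neutral_left) (use assms in \<open>force simp: not_le\<close>)+

lemma coeff_sum_add: "coeff_sum G (\<eta> + \<theta>) = coeff_sum G \<eta> + coeff_sum G \<theta>"
proof -
  obtain N where N: "\<And>k. k > N \<Longrightarrow> \<phi> k \<eta> = 0" "\<And>k. k > N \<Longrightarrow> \<phi> k \<theta> = 0"
    using polar_proj_common[of \<eta> \<theta>] by metis
  have "coeff_sum G (\<eta> + \<theta>) = (\<Sum>k\<in>{1..N}. sym_const (\<phi> k (\<eta> + \<theta>)) * G k)"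
    by (rule coeff_sum_eq) (simp add: \<phi>_add N)
  thus ?thesis
    by (simp add: coeff_sum_eq[OF N(1)] coeff_sum_eq[OF N(2)] \<phi>_add sym_const_add ring_distribs
        sum.distrib)
qed

lemma coeff_sum_scale: "coeff_sum G (mconst c * \<eta>) = sym_const c * coeff_sum G \<eta>"
proof -
  obtain N where N: "\<And>k. k > N \<Longrightarrow> \<phi> k \<eta> = 0"
    using \<phi>_large by blast
  have "coeff_sum G (mconst c * \<eta>) = (\<Sum>k\<in>{1..N}. sym_const (\<phi> k (mconst c * \<eta>)) * G k)"
    by (rule coeff_sum_eq) (simp add: \<phi>_scale N)
  thus ?thesis
    by (simp add: coeff_sum_eq[OF N] \<phi>_scale sym_const_mult sum_distrib_left mult.assoc)
qed

lemma coeff_sum_0 [simp]: "coeff_sum G 0 = 0"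
  by (simp add: coeff_sum_def)

lemma coeff_sum_sum: "coeff_sum G (sum f A) = (\<Sum>i\<in>A. coeff_sum G (f i))"
  by (induction A rule: infinite_finite_induct) (simp_all add: coeff_sum_add)

lemma coeff_sum_e: "coeff_sum G (e j) = (if j \<ge> 1 then G j else 0)"
proof -
  have "coeff_sum G (e j) = (\<Sum>k\<in>{1..j}. sym_const (\<phi> k (e j)) * G k)"
    by (rule coeff_sum_eq) (simp add: \<phi>_e)
  also have "\<dots> = (\<Sum>k\<in>{1..j}. if k = j then G k else 0)"
    by (intro sum.cong) (auto simp: \<phi>_e)
  finally show ?thesis by simp
qed

text \<open>For \<open>X = \<xi> d/dr\<close> the argument is the form \<open>\<xi> du\<close>. It
  equals \<open>e (i - 1)\<close> for \<open>\<xi> = r^i\<close>, so that \<open>r^i d/dr\<close> is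
  sent to \<open>\<Omega> (i - 1)\<close>, as \<open>omega\<close> demands.\<close>

definition vac :: "mvf \<Rightarrow> sym_alg" where
  "vac X = coeff_sum \<Omega> (mderiv u * (X * mderiv r))"

lemma vac_add: "vac (X + Y) = vac X + vac Y"
  and vac_scale: "vac (mconst c * X) = sym_const c * vac X"
  by (simp_all add: vac_def ring_distribs coeff_sum_add mult.assoc
      mult.left_commute[of "mderiv u" "mconst c"] coeff_sum_scale)

lemma vac_sum: "vac (sum f A) = (\<Sum>i\<in>A. vac (f i))"
  by (simp add: vac_def sum_distrib_left sum_distrib_right coeff_sum_sum)

text \<open>Regularity at \<open>P\<close> means that \<open>\<xi> u^2\<close> is regular, which
  kills all coefficients with \<open>k \<ge> 2\<close>. The remaining index 1 contributes nothing
  because \<open>\<Omega> 1 = 0\<close>.\<close>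

lemma vac_regular:
  assumes "vf_regular P X"
  shows "vac X = 0"
proof -
  have "\<phi> k (mderiv u * (X * mderiv r)) = 0" if "k > 1" for k
  proof -
    have "u powi k = u powi (k - 2) * u ^ 2"
      using power_int_add[of u "k - 2" 2] by simp
    hence eq: "laurent_at P (u powi k * (mderiv u * (X * mderiv r))) * chart_deriv P
        = laurent_at P (u powi (k - 2)) * (laurent_at P (X * mderiv r * u ^ 2)
          * (laurent_at P (mderiv u) * chart_deriv P))"
      by (simp add: mult_ac)
    have "fls_subdegree (fls_deriv (laurent_at P u)) \<ge> 0"
      by (subst fls_deriv_subdegree')
        (use nth_fls_subdegree_nonzero[of "laurent_at P u"] in \<open>auto simp: laurent_u\<close>)
    moreover have "fls_subdegree (laurent_at P (u powi (k - 2))) \<ge> 0"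
      using that by (simp add: laurent_u)
    ultimately show ?thesis
      using assms unfolding \<phi>_def form_residue_laurent eq laurent_at_mderiv vf_regular_P_iff
      by (intro fls_residue_power_series fls_mult_subdegree_ge_0)
  qed
  hence "vac X = (\<Sum>k\<in>{1..1}. sym_const (\<phi> k (mderiv u * (X * mderiv r))) * \<Omega> k)"
    unfolding vac_def by (rule coeff_sum_eq)
  thus ?thesis by (simp add: \<Omega>_0)
qed

lemma vac_V: "vac (V i) = \<Omega> (int i - 1)"
proof -
  have "mderiv u * (V i * mderiv r) = e (int i - 1)"
    by (simp add: V_def e_def r_power mult.commute)
  thus ?thesis by (simp add: vac_def coeff_sum_e \<Omega>_0)
qed

lemma vac_away:
  assumes "\<And>Q. Q \<noteq> P \<Longrightarrow> vf_regular Q X"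
  shows "vac X = omega P X"
proof -
  obtain N c where X: "X = (\<Sum>i=0..N. mconst (c i) * V i)"
    using vf_away_polynomial assms by blast
  show ?thesis
    unfolding omega_eq[OF X] by (simp add: X vac_sum vac_scale vac_V)
qed

text \<open>This splitting makes \<open>X_plus_vac\<close> unique: its values are prescribed on both
  summands. The field \<open>Y\<close> carries the polar part in powers of \<open>r\<close>.\<close>

lemma vf_decompose:
  obtains Y where "\<And>Q. Q \<noteq> P \<Longrightarrow> vf_regular Q Y" "vf_regular P (X - Y)"
proof -
  obtain N c where c: "fls_subdegree (laurent_at P (X * mderiv r)
      - (\<Sum>i=1..N. fls_const (c i) * laurent_at P r ^ i)) \<ge> 0"
    using fls_polar_part[OF laurent_r] by blast
  define Y where "Y = (\<Sum>i=1..N. mconst (c i) * V i)"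
  have "(X - Y) * mderiv r = X * mderiv r - (\<Sum>i=1..N. mconst (c i) * r ^ i)"
    by (simp add: Y_def V_def left_diff_distrib sum_distrib_right)
  hence "fls_subdegree (laurent_at P ((X - Y) * mderiv r)) \<ge> 0"
    using c by simp
  moreover have "fls_subdegree (laurent_at P (u ^ 2)) \<ge> 0"
    by (simp add: laurent_u fls_subdegree_pow)
  ultimately have "vf_regular P (X - Y)"
    unfolding vf_regular_P_iff laurent_at_mult[of P "(X - Y) * mderiv r"]
    by (rule fls_mult_subdegree_ge_0)
  thus thesis using that[of Y] polynomial_vf_away by (simp add: Y_def)
qed

lemma X_plus_vac_eq: "X_plus_vac P = vac"
  unfolding X_plus_vac_def
proof (rule the_equality, goal_cases)
  case 1
  show ?case using vac_add vac_scale vac_regular vac_away by blast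
next
  case (2 F)
  show ?case
  proof
    fix X
    obtain Y where Y: "\<And>Q. Q \<noteq> P \<Longrightarrow> vf_regular Q Y" "vf_regular P (X - Y)"
      using vf_decompose by blast
    have "F (Y + (X - Y)) = F Y + F (X - Y)" using 2 by blast
    also have "F (X - Y) = 0" using 2 Y(2) by blast
    also have "F Y = vac Y" using 2 Y(1) vac_away[OF Y(1)] by simp
    also have "vac Y + 0 = vac (Y + (X - Y))"
      unfolding vac_add using vac_regular[OF Y(2)] by simp
    finally show "F X = vac X" by simp
  qed
qed

section \<open>The three parts of the operator as differential operators\<close>

definition X :: "int \<Rightarrow> mvf" where
  "X n = vf_in_coord u (- (u powi (n + 1)))"

lemma X_eq: "X n = - (u powi (n + 1)) / mderiv u"
  by (simp add: X_def vf_in_coord_def)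

text \<open>In the coordinate \<open>r = 1/u\<close> the field \<open>X n\<close> becomes
  \<open>r^(1-n) d/dr\<close>.\<close>

lemma vac_X: "vac (X n) = \<Omega> (- n)"
proof -
  have "mderiv u * (X n * mderiv r) = u powi (n + 1) * u powi (- 2) * mderiv u"
    by (simp add: X_eq mderiv_r_eq)
  also have "\<dots> = e (- n)" by (simp add: e_def flip: power_int_add)
  finally show ?thesis by (simp add: vac_def coeff_sum_e \<Omega>_0)
qed

lemma X_times_e: "X n * e k = - (u powi (n - k))"
proof -
  have "X n * e k = - (u powi (n + 1) * u powi (- k - 1))"
    by (simp add: X_eq e_def)
  thus ?thesis by (simp flip: power_int_add)
qed

lemma lie_deriv_X_e: "lie_deriv (X n) (e k) = mconst (of_int (k - n)) * e (k - n)"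
proof -
  have "mderiv (- (u powi (n - k))) = mderiv (mconst (- 1) * u powi (n - k))"
    by (simp add: mconst_minus)
  also have "\<dots> = mconst (- 1) * mderiv (u powi (n - k))"
    by (simp only: mderiv_mult mderiv_const mult_zero_left add_0_right)
  also have "\<dots> = - of_int (n - k) * (u powi (n - k - 1) * mderiv u)"
    unfolding mderiv_power_int[OF u_nonzero] by (simp add: mconst_minus algebra_simps)
  also have "\<dots> = mconst (of_int (k - n)) * e (k - n)"
    by (simp add: mconst_of_int mconst_diff e_def algebra_simps)
  finally show ?thesis by (simp add: lie_deriv_eq X_times_e)
qed

lemma E_in_W: "k \<ge> 1 \<Longrightarrow> E k \<in> sym_W P"
  unfolding E_def by (intro sym_W.incl e_in_forms_K)

lemma \<Omega>_in_W: "\<Omega> n \<in> sym_W P"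
  unfolding \<Omega>_def by (intro sym_W_sum sym_W_scale sym_W.mult E_in_W) auto

text \<open>The partial derivative by \<open>E k\<close>, extended through the functional
  \<open>\<phi> k\<close> to the symmetric algebra of all meromorphic forms.\<close>

definition d :: "int \<Rightarrow> sym_alg \<Rightarrow> sym_alg" where
  "d k = sym_deriv (\<lambda>\<alpha>. sym_const (\<phi> k \<alpha>))"

lemma d_linear: "sym_linear (\<lambda>\<alpha>. sym_const (\<phi> k \<alpha>))"
  by (simp add: sym_linear_def \<phi>_add \<phi>_scale sym_const_add sym_const_mult)

lemma derivation_d: "derivation (d k)"
  unfolding d_def by (rule derivation_sym_deriv[OF d_linear])

lemma d_incl: "d k (sym_incl \<alpha>) = sym_const (\<phi> k \<alpha>)"
  unfolding d_def by (rule sym_deriv_incl[OF d_linear])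

lemma d_E: "d k (E j) = (if k = j then 1 else 0)"
  by (simp add: E_def d_incl \<phi>_e)

text \<open>\<open>polar_proj\<close> is linear on all forms, as a derivation demands, and agrees
  with \<open>principal_part\<close> on Lie derivatives, which are of the second kind.\<close>

definition D :: "int \<Rightarrow> sym_alg \<Rightarrow> sym_alg" where
  "D n = sym_deriv (\<lambda>\<alpha>. sym_incl (polar_proj (lie_deriv (X n) \<alpha>)))"

lemma D_linear: "sym_linear (\<lambda>\<alpha>. sym_incl (polar_proj (lie_deriv (X n) \<alpha>)))"
  by (simp add: sym_linear_def lie_deriv_add lie_deriv_scale polar_proj_add polar_proj_scale
      sym_incl_add sym_incl_scale)

lemma derivation_D: "derivation (D n)"
  unfolding D_def by (rule derivation_sym_deriv[OF D_linear])

lemma D_incl: "D n (sym_incl \<alpha>) = sym_incl (polar_proj (lie_deriv (X n) \<alpha>))"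
  unfolding D_def by (rule sym_deriv_incl[OF D_linear])

text \<open>Indices below 1 occur when the Lie derivative along \<open>X n\<close> lowers the index
  past 1; the projection discards them.\<close>

lemma polar_proj_e: "polar_proj (e k) = (if k \<ge> 1 then e k else 0)"
proof (cases "k \<ge> 1")
  case True
  thus ?thesis using polar_proj_K[OF e_in_forms_K] by simp
next
  case False
  have "polar_proj (e k) = (\<Sum>j\<in>{1..0}. mconst (\<phi> j (e k)) * e j)"
    by (rule polar_proj_eq) (use False in \<open>simp add: \<phi>_e\<close>)
  thus ?thesis using False by simp
qed

lemma D_E: "D n (E k) = (if k > n then of_int (k - n) * E (k - n) else 0)"
  unfolding E_def D_incl lie_deriv_X_e polar_proj_scale polar_proj_e
  by (simp add: sym_incl_scale flip: sym_const_of_int)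

lemma derivation_W:
  assumes "derivation T" "\<And>\<alpha>. \<alpha> \<in> forms_K P \<Longrightarrow> T (sym_incl \<alpha>) \<in> sym_W P" "w \<in> sym_W P"
  shows "T w \<in> sym_W P"
  using assms(3)
proof induction
  case (const c)
  show ?case by (simp add: derivationD[OF assms(1)] sym_W_0)
qed (auto simp: derivationD[OF assms(1)] intro: sym_W.plus sym_W.mult assms(2))

lemma d_W: "w \<in> sym_W P \<Longrightarrow> d k w \<in> sym_W P"
  by (rule derivation_W[OF derivation_d]) (simp_all add: d_incl sym_W.const)

lemma D_W: "w \<in> sym_W P \<Longrightarrow> D n w \<in> sym_W P"
  by (rule derivation_W[OF derivation_D]) (simp_all add: D_incl sym_W.incl polar_proj_in_K)

text \<open>The second-order operator meets each pair of factors in both orders, whence the factor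
  1/2. The sign is that of \<open>X n\<close>.\<close>

definition A :: "int \<Rightarrow> sym_alg \<Rightarrow> sym_alg" where
  "A n w = sym_const (- 1 / 2) * (\<Sum>a\<in>{1..n - 1}. d a (d (n - a) w))"

lemma A_W: "w \<in> sym_W P \<Longrightarrow> A n w \<in> sym_W P"
  unfolding A_def by (intro sym_W_scale sym_W_sum d_W)

lemma A_add: "A n (v + w) = A n v + A n w"
  and A_scale: "A n (sym_const c * w) = sym_const c * A n w"
  by (simp_all add: A_def derivationD[OF derivation_d] sum.distrib ring_distribs
      mult.left_commute sum_distrib_left)

lemma X_plus_eq: "w \<in> sym_W P \<Longrightarrow> X_plus P (X n) w = \<Omega> (- n) * w"
  unfolding X_plus_def X_plus_vac_eq vac_X
  by (rule operator_W_eq) (auto intro: sym_W.mult \<Omega>_in_W simp: ring_distribs mult.left_commute)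

lemma X_zero_eq: "w \<in> sym_W P \<Longrightarrow> X_zero P (X n) w = D n w"
  unfolding X_zero_def
proof (rule operator_W_eq[of P "D n"])
  fix \<alpha>s :: "mform list"
  show "D n (sym_prod \<alpha>s) = (\<Sum>i<length \<alpha>s.
      sym_prod (\<alpha>s[i := principal_part P (lie_deriv (X n) (\<alpha>s ! i))]))"
    by (rule derivation_sym_prod_update[OF derivation_D])
      (simp add: D_incl principal_part_eq second_kind_lie_deriv)
qed (auto intro: D_W simp: derivationD[OF derivation_D])

text \<open>Contraction turns \<open>e k\<close> into \<open>- u powi (n - k)\<close>, and the
  residue of its product with \<open>\<beta>\<close> is
  \<open>- \<phi> (n - k) \<beta>\<close>.\<close>

lemma residue_X:
  assumes "\<alpha> \<in> forms_K P" "\<beta> \<in> forms_K P"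
  shows "form_residue P (contract (X n) \<alpha> * \<beta>) = - (\<Sum>a\<in>{1..n - 1}. \<phi> a \<alpha> * \<phi> (n - a) \<beta>)"
proof -
  obtain N where N: "\<alpha> = (\<Sum>k\<in>{1..N}. mconst (\<phi> k \<alpha>) * e k)" "\<And>k. k > N \<Longrightarrow> \<phi> k \<alpha> = 0"
    using forms_K_span[OF assms(1)] by metis
  have \<beta>: "\<phi> k \<beta> = 0" if "k < 1" for k
    using forms_K_span[OF assms(2)] that by metis
  have "contract (X n) \<alpha> * \<beta> = (\<Sum>k\<in>{1..N}. mconst (- \<phi> k \<alpha>) * (u powi (n - k) * \<beta>))"
  proof -
    have "contract (X n) \<alpha> * \<beta> = X n * (\<Sum>k\<in>{1..N}. mconst (\<phi> k \<alpha>) * e k) * \<beta>"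
      unfolding contract_def by (subst N(1)) (rule refl)
    also have "\<dots> = (\<Sum>k\<in>{1..N}. mconst (\<phi> k \<alpha>) * (X n * e k) * \<beta>)"
      by (simp add: sum_distrib_left sum_distrib_right mult_ac)
    finally show ?thesis by (simp add: X_times_e mconst_minus mult.assoc)
  qed
  hence "form_residue P (contract (X n) \<alpha> * \<beta>) = - (\<Sum>k\<in>{1..N}. \<phi> k \<alpha> * \<phi> (n - k) \<beta>)"
    by (simp add: form_residue_sum form_residue_scale \<phi>_def sum_negf)
  \<comment> \<open>The range is first enlarged, where \<open>\<phi> k \<alpha>\<close> vanishes,
    and then cut to \<open>k \<le> n - 1\<close>, since \<open>\<phi> (n - k) \<beta>\<close>
    vanishes for \<open>n - k < 1\<close>.\<close>
  also have "(\<Sum>k\<in>{1..N}. \<phi> k \<alpha> * \<phi> (n - k) \<beta>) = (\<Sum>k\<in>{1..max N (n - 1)}. \<phi> k \<alpha> * \<phi> (n - k) \<beta>)"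
    by (rule sum.mono_neutral_left) (auto simp: N(2))
  also have "\<dots> = (\<Sum>k\<in>{1..n - 1}. \<phi> k \<alpha> * \<phi> (n - k) \<beta>)"
    by (rule sum.mono_neutral_right) (auto simp: \<beta>)
  finally show ?thesis .
qed

text \<open>The commutator of a second-order operator with a multiplication is of first order. Its
  two mixed terms agree after \<open>a \<mapsto> n - a\<close>, which cancels the factor
  1/2.\<close>

lemma A_incl_mult:
  "A n (sym_incl \<alpha> * w) = sym_incl \<alpha> * A n w - (\<Sum>a\<in>{1..n - 1}. sym_const (\<phi> a \<alpha>) * d (n - a) w)"
proof -
  have swap: "(\<Sum>a\<in>{1..n - 1}. sym_const (\<phi> (n - a) \<alpha>) * d a w)
      = (\<Sum>a\<in>{1..n - 1}. sym_const (\<phi> a \<alpha>) * d (n - a) w)"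
    by (rule sum.reindex_bij_witness[of _ "\<lambda>a. n - a" "\<lambda>a. n - a"]) auto
  define T where "T = (\<Sum>a\<in>{1..n - 1}. sym_const (\<phi> a \<alpha>) * d (n - a) w)"
  have "(\<Sum>a\<in>{1..n - 1}. d a (d (n - a) (sym_incl \<alpha> * w)))
      = (\<Sum>a\<in>{1..n - 1}. sym_const (\<phi> (n - a) \<alpha>) * d a w + sym_const (\<phi> a \<alpha>) * d (n - a) w
          + sym_incl \<alpha> * d a (d (n - a) w))"
    by (rule sum.cong) (simp_all add: derivationD[OF derivation_d] d_incl algebra_simps)
  also have "\<dots> = T + T + sym_incl \<alpha> * (\<Sum>a\<in>{1..n - 1}. d a (d (n - a) w))"
    by (simp add: sum.distrib swap T_def sum_distrib_left)
  finally have 1: "A n (sym_incl \<alpha> * w) = sym_const (- 1 / 2) * (T + T) + sym_incl \<alpha> * A n w"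
    by (simp add: A_def ring_distribs mult_ac)
  have "sym_const (- 1 / 2) * (T + T) = (sym_const (- 1 / 2) + sym_const (- 1 / 2)) * T"
    by (simp only: ring_distribs)
  also have "sym_const (- 1 / 2) + sym_const (- 1 / 2) = - 1"
    using sym_const_add[of "- 1 / 2" "- 1 / 2"] sym_const_minus[of 1] by simp
  finally have 2: "sym_const (- 1 / 2) * (T + T) = - T" by simp
  show ?thesis unfolding 1 2 by (simp add: T_def)
qed

text \<open>Induction on the list: a form put in front adds the pairs that contain it, which are the
  first-order terms of \<open>A_incl_mult\<close>, and multiplies the contributions of all older
  pairs.\<close>

lemma X_minus_eq:
  assumes "w \<in> sym_W P"
  shows "X_minus P (X n) w = A n w"
  unfolding X_minus_def
proof (rule operator_W_eq[of P "A n"])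
  fix \<alpha>s :: "mform list"
  define R where "R \<alpha> \<beta> = sym_const (form_residue P (contract (X n) \<alpha> * \<beta>))" for \<alpha> \<beta>
  assume "set \<alpha>s \<subseteq> forms_K P"
  hence "A n (sym_prod \<alpha>s) = (\<Sum>j<length \<alpha>s. \<Sum>i<j. R (\<alpha>s ! i) (\<alpha>s ! j) * omit {i, j} \<alpha>s)"
  proof (induction \<alpha>s)
    case Nil
    show ?case by (simp add: A_def derivationD[OF derivation_d])
  next
    case (Cons \<alpha> \<alpha>s)
    have "(\<Sum>a\<in>{1..n - 1}. sym_const (\<phi> a \<alpha>) * d (n - a) (sym_prod \<alpha>s))
        = (\<Sum>a\<in>{1..n - 1}. \<Sum>j<length \<alpha>s. sym_const (\<phi> a \<alpha> * \<phi> (n - a) (\<alpha>s ! j)) * omit {j} \<alpha>s)"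
      by (simp add: derivation_sym_prod[OF derivation_d] d_incl sum_distrib_left sym_const_mult mult.assoc)
    also have "\<dots> = (\<Sum>j<length \<alpha>s. \<Sum>a\<in>{1..n - 1}. sym_const (\<phi> a \<alpha> * \<phi> (n - a) (\<alpha>s ! j)) * omit {j} \<alpha>s)"
      by (rule sum.swap)
    also have "\<dots> = (\<Sum>j<length \<alpha>s. - R \<alpha> (\<alpha>s ! j) * omit {j} \<alpha>s)"
    proof (rule sum.cong[OF refl])
      fix j assume "j \<in> {..<length \<alpha>s}"
      hence "\<alpha>s ! j \<in> forms_K P" using Cons.prems by auto
      thus "(\<Sum>a\<in>{1..n - 1}. sym_const (\<phi> a \<alpha> * \<phi> (n - a) (\<alpha>s ! j)) * omit {j} \<alpha>s)
          = - R \<alpha> (\<alpha>s ! j) * omit {j} \<alpha>s"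
        using Cons.prems
        by (simp add: R_def residue_X sym_const_minus sym_const_sum sum_distrib_right)
    qed
    finally have 1: "A n (sym_prod (\<alpha> # \<alpha>s))
        = sym_incl \<alpha> * A n (sym_prod \<alpha>s) + (\<Sum>j<length \<alpha>s. R \<alpha> (\<alpha>s ! j) * omit {j} \<alpha>s)"
      by (simp add: A_incl_mult sum_negf)
    have o1: "omit {0, Suc j} (\<alpha> # \<alpha>s) = omit {j} \<alpha>s" for j
      using omit_Cons_0[of "{j}"] by simp
    have o2: "omit {Suc i, Suc j} (\<alpha> # \<alpha>s) = sym_incl \<alpha> * omit {i, j} \<alpha>s" for i j
      using omit_Cons_Suc[of "{i, j}"] by simp
    have "(\<Sum>j<length (\<alpha> # \<alpha>s). \<Sum>i<j. R ((\<alpha> # \<alpha>s) ! i) ((\<alpha> # \<alpha>s) ! j) * omit {i, j} (\<alpha> # \<alpha>s))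
        = (\<Sum>j<length \<alpha>s. R \<alpha> (\<alpha>s ! j) * omit {j} \<alpha>s
          + (\<Sum>i<j. sym_incl \<alpha> * (R (\<alpha>s ! i) (\<alpha>s ! j) * omit {i, j} \<alpha>s)))"
      unfolding sum_lessThan_length_Cons
      by (simp add: sum.lessThan_Suc_shift o1 o2 mult.left_commute del: sum.lessThan_Suc)
    also have "\<dots> = (\<Sum>j<length \<alpha>s. R \<alpha> (\<alpha>s ! j) * omit {j} \<alpha>s)
        + sym_incl \<alpha> * (\<Sum>j<length \<alpha>s. \<Sum>i<j. R (\<alpha>s ! i) (\<alpha>s ! j) * omit {i, j} \<alpha>s)"
      by (simp add: sum.distrib sum_distrib_left)
    finally show ?case using Cons 1 by simp
  qed
  thus "A n (sym_prod \<alpha>s) = (\<Sum>j<length \<alpha>s. \<Sum>i<j.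
       form_residue P (contract (X n) (\<alpha>s ! i) * \<alpha>s ! j)
         \<bullet>\<^sub>S (\<Prod>k\<in>{..<length \<alpha>s} - {i, j}. sym_incl (\<alpha>s ! k)))"
    by (simp add: R_def omit_def)
qed (use assms in \<open>auto intro: A_W simp: A_add A_scale\<close>)

definition Lop :: "int \<Rightarrow> sym_alg \<Rightarrow> sym_alg" where
  "Lop n w = A n w + D n w + \<Omega> (- n) * w"

lemma L_op_eq: "w \<in> sym_W P \<Longrightarrow> L_op P (X n) w = Lop n w"
  by (simp add: L_op_def Lop_def X_minus_eq X_zero_eq X_plus_eq)

end

section \<open>Commutators\<close>

text \<open>Power sums, multiplied by 6 to stay in the integers. Half of this sum is the central
  term.\<close>

lemma sum_mult_complement: "(\<Sum>a\<in>{1..n - 1}. a * (n - a)) * 6 = n ^ 3 - n" if "n \<ge> 1" for n :: int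
proof -
  have 1: "(\<Sum>a\<in>{1..int m}. a) * 2 = int m * (int m + 1)" for m
    by (induction m) (simp_all add: algebra_simps atLeastAtMostPlus1_int_conv)
  have 2: "(\<Sum>a\<in>{1..int m}. a ^ 2) * 6 = int m * (int m + 1) * (2 * int m + 1)" for m
    by (induction m) (simp_all add: algebra_simps power2_eq_square atLeastAtMostPlus1_int_conv)
  define m where "m = nat (n - 1)"
  have n: "n = int m + 1" using that by (simp add: m_def)
  have "(\<Sum>a\<in>{1..n - 1}. a * (n - a)) * 6
      = n * 3 * ((\<Sum>a\<in>{1..int m}. a) * 2) - (\<Sum>a\<in>{1..int m}. a ^ 2) * 6"
  proof -
    have "(\<Sum>a\<in>{1..n - 1}. a * (n - a)) = (\<Sum>a\<in>{1..int m}. n * a - a ^ 2)"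
      by (rule sum.cong) (simp_all add: n algebra_simps power2_eq_square)
    also have "\<dots> = n * (\<Sum>a\<in>{1..int m}. a) - (\<Sum>a\<in>{1..int m}. a ^ 2)"
      by (simp add: sum_subtractf sum_distrib_left)
    finally show ?thesis by simp
  qed
  also have "\<dots> = n ^ 3 - n"
    unfolding 1 2 n by (simp add: algebra_simps power2_eq_square power3_eq_cube)
  finally show ?thesis .
qed

context vanishing_coordinate begin

text \<open>Every form regular off \<open>P\<close> is a finite combination of the
  \<open>e k\<close>, so the \<open>E k\<close> generate \<open>sym_W\<close> as an algebra.\<close>

lemma derivation_eqI:
  assumes "derivation S" "derivation T" "\<And>k. k \<ge> 1 \<Longrightarrow> S (E k) = T (E k)" "w \<in> sym_W P"
  shows "S w = T w"
  using assms(4)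
proof induction
  case (incl \<alpha>)
  obtain N where N: "\<And>k. k > N \<Longrightarrow> \<phi> k \<alpha> = 0" using \<phi>_large by blast
  have "sym_incl \<alpha> = (\<Sum>k\<in>{1..N}. sym_const (\<phi> k \<alpha>) * E k)"
    by (rule sym_incl_K[OF incl]) (rule N)
  thus ?case
    by (simp add: derivation_sum[OF assms(1)] derivation_sum[OF assms(2)]
        derivationD[OF assms(1)] derivationD[OF assms(2)] assms(3))
qed (simp_all add: derivationD[OF assms(1)] derivationD[OF assms(2)])

lemma d_commute:
  assumes "w \<in> sym_W P"
  shows "d j (d k w) = d k (d j w)"
proof -
  have "d j (d k w) - d k (d j w) = 0"
    by (rule derivation_eqI[OF derivation_commutator[OF derivation_d derivation_d] derivation_zero _ assms])
      (simp add: d_E derivationD[OF derivation_d])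
  thus ?thesis by simp
qed

lemma d_A:
  assumes "w \<in> sym_W P"
  shows "d k (A n w) = A n (d k w)"
proof -
  have "d k (d a (d b w)) = d a (d b (d k w))" for a b
    using d_commute[of w k b] d_commute[of "d b w" k a] assms d_W by simp
  thus ?thesis
    by (simp add: A_def derivationD[OF derivation_d] derivation_sum[OF derivation_d])
qed

text \<open>Both sides are derivations in \<open>w\<close>, so generators suffice. On
  \<open>E j\<close> only \<open>j = k + n\<close> contributes, with the factor
  \<open>j - n = k\<close> produced by \<open>D n\<close>.\<close>

lemma d_D_commutator:
  assumes "w \<in> sym_W P" "k \<ge> 1"
  shows "d k (D n w) - D n (d k w) = (if k + n \<ge> 1 then of_int k * d (k + n) w else 0)"
proof -
  let ?T = "\<lambda>w. if k + n \<ge> 1 then sym_const (of_int k) * d (k + n) w else 0"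
  have "derivation ?T"
    using derivation_scale[OF derivation_d] derivation_zero by (cases "k + n \<ge> 1") simp_all
  moreover have "d k (D n (E j)) - D n (d k (E j)) = ?T (E j)" if "j \<ge> 1" for j
    using that assms(2)
    by (auto simp: D_E d_E derivationD[OF derivation_D] derivationD[OF derivation_d]
        simp flip: sym_const_of_int)
  ultimately have "d k (D n w) - D n (d k w) = ?T w"
    by (rule derivation_eqI[OF derivation_commutator[OF derivation_d derivation_D] _ _ assms(1)])
  thus ?thesis by (simp add: sym_const_of_int)
qed

lemma d_\<Omega>:
  assumes "k \<ge> 1"
  shows "d k (\<Omega> N) = (if k < N then - of_int (k * (N - k)) * E (N - k) else 0)"
proof -
  define t where "t a = sym_const (- (of_int (a * (N - a)) / 2))" for a
  \<comment> \<open>The index \<open>k\<close> can occur in either factor, and the two equal terms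
    absorb the factor 1/2. For \<open>N = 2 * k\<close> both fall on the same \<open>a\<close>, as
    for the derivative of a square.\<close>
  have "d k (\<Omega> N) = (\<Sum>a\<in>{1..N - 1}. (if a = k then t k * E (N - k) else 0)
      + (if a = N - k then t k * E (N - k) else 0))"
    unfolding \<Omega>_def derivation_sum[OF derivation_d]
    by (rule sum.cong) (auto simp: derivationD[OF derivation_d] d_E t_def mult.commute)
  also have "\<dots> = (if k < N then (t k + t k) * E (N - k) else 0)"
    using assms by (simp add: sum.distrib ring_distribs)
  also have "t k + t k = - of_int (k * (N - k))"
    unfolding t_def sym_const_add[symmetric] by (simp add: sym_const_minus flip: sym_const_of_int)
  finally show ?thesis .
qed

lemma Lop_W: "w \<in> sym_W P \<Longrightarrow> Lop n w \<in> sym_W P"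
  unfolding Lop_def by (intro sym_W.plus A_W D_W sym_W.mult \<Omega>_in_W)

lemma Lop_add: "Lop n (v + w) = Lop n v + Lop n w"
  and Lop_scale: "Lop n (sym_const c * w) = sym_const c * Lop n w"
  by (simp_all add: Lop_def A_add A_scale derivationD[OF derivation_D] ring_distribs
      mult.left_commute)

lemma Lop_of_int: "Lop n (of_int i * w) = of_int i * Lop n w"
  using Lop_scale[of n "of_int i"] by (simp add: sym_const_of_int)

lemma Lop_0: "Lop n 0 = 0"
  using Lop_scale[of n 0 0] by simp

text \<open>The modes of a free boson. Their commutation relation with the Virasoro operators is uniform in
  the sign of \<open>j\<close>.\<close>

definition mode :: "int \<Rightarrow> sym_alg \<Rightarrow> sym_alg" where
  "mode j w = (if j > 0 then of_int j * (E j * w) else if j < 0 then - d (- j) w else 0)"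

lemma mode_add: "mode j (v + w) = mode j v + mode j w"
  and mode_diff: "mode j (v - w) = mode j v - mode j w"
  by (simp_all add: mode_def derivationD[OF derivation_d] algebra_simps)

lemma mode_of_int: "mode j (of_int i * w) = of_int i * mode j w"
  unfolding sym_const_of_int[symmetric]
  by (simp add: mode_def derivationD[OF derivation_d] mult.left_commute flip: sym_const_of_int)

text \<open>For \<open>j < n\<close> the mode comes from contraction by \<open>A n\<close>, for
  \<open>j > n\<close> from the derivation \<open>D n\<close>; for \<open>j = n\<close> both are
  silent and \<open>mode 0\<close> is zero.\<close>

lemma Lop_E_mult:
  assumes "j \<ge> 1"
  shows "Lop n (E j * w) = E j * Lop n w + mode (j - n) w"
proof -
  have "(\<Sum>a\<in>{1..n - 1}. sym_const (\<phi> a (e j)) * d (n - a) w)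
      = (\<Sum>a\<in>{1..n - 1}. if a = j then d (n - j) w else 0)"
    by (rule sum.cong) (auto simp: \<phi>_e)
  also have "\<dots> = (if j < n then d (n - j) w else 0)"
    using assms by simp
  finally have "A n (E j * w) = E j * A n w - (if j < n then d (n - j) w else 0)"
    unfolding E_def A_incl_mult by simp
  moreover have "D n (E j * w) = E j * D n w
      + (if j > n then of_int (j - n) * (E (j - n) * w) else 0)"
    by (simp add: derivationD[OF derivation_D] D_E mult.assoc)
  moreover have "\<Omega> (- n) * (E j * w) = E j * (\<Omega> (- n) * w)"
    by (rule mult.left_commute)
  moreover define v where "v = E j * w"
  ultimately show ?thesis
    unfolding v_def[symmetric]
    by (cases j n rule: linorder_cases) (simp_all add: Lop_def mode_def algebra_simps)
qed

text \<open>Here \<open>A n\<close> commutes with \<open>d k\<close>. The mode comes from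
  \<open>D n\<close> if \<open>k + n > 0\<close> and from differentiating
  \<open>\<Omega> (- n)\<close> if \<open>k + n < 0\<close>.\<close>

lemma Lop_d:
  assumes "k \<ge> 1" "w \<in> sym_W P"
  shows "Lop n (d k w) = d k (Lop n w) + of_int k * mode (- k - n) w"
proof -
  have D: "D n (d k w) = d k (D n w) - (if k + n \<ge> 1 then of_int k * d (k + n) w else 0)"
    using d_D_commutator[OF assms(2,1), of n] by (simp add: algebra_simps)
  have "d k (Lop n w) = A n (d k w) + d k (D n w) + d k (\<Omega> (- n)) * w + \<Omega> (- n) * d k w"
    using d_A[OF assms(2)] by (simp add: Lop_def derivationD[OF derivation_d])
  hence "Lop n (d k w) = d k (Lop n w) - (if k + n \<ge> 1 then of_int k * d (k + n) w else 0)
      - d k (\<Omega> (- n)) * w"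
    by (simp add: Lop_def D)
  moreover have "- (if k + n \<ge> 1 then of_int k * d (k + n) w else 0) - d k (\<Omega> (- n)) * w
      = of_int k * mode (- k - n) w"
  proof -
    define g where "g = - k - n"
    have e: "- n - k = g" and g: "k < - n \<longleftrightarrow> g > 0" "k + n \<ge> 1 \<longleftrightarrow> g < 0" "- g = k + n"
      by (auto simp: g_def)
    show ?thesis
      unfolding d_\<Omega>[OF assms(1), of "- n", unfolded e] g_def[symmetric] g
      by (auto simp: mode_def g mult_ac)
  qed
  ultimately show ?thesis by (simp only: diff_conv_add_uminus add.assoc)
qed

lemma Lop_mode:
  assumes "w \<in> sym_W P"
  shows "Lop n (mode j w) = mode j (Lop n w) + of_int j * mode (j - n) w"
proof -
  consider "j > 0" | "j = 0" | "j < 0" by linarith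
  thus ?thesis
  proof cases
    case 1
    hence "Lop n (mode j w) = of_int j * Lop n (E j * w)"
      by (simp add: mode_def Lop_of_int)
    also have "\<dots> = of_int j * (E j * Lop n w) + of_int j * mode (j - n) w"
      using 1 by (simp add: Lop_E_mult ring_distribs)
    finally show ?thesis using 1 by (simp add: mode_def)
  next
    case 2
    thus ?thesis by (simp add: mode_def Lop_0)
  next
    case 3
    hence "Lop n (mode j w) = - Lop n (d (- j) w)"
      using Lop_of_int[of n "-1" "d (- j) w"] by (simp add: mode_def)
    also have "\<dots> = - d (- j) (Lop n w) + of_int j * mode (j - n) w"
      using Lop_d[of "- j" w n] assms 3 by simp
    finally show ?thesis using 3 by (simp add: mode_def)
  qed
qed

section \<open>The anomaly is a multiplication operator\<close>

definition anomaly :: "int \<Rightarrow> int \<Rightarrow> sym_alg \<Rightarrow> sym_alg" where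
  "anomaly l m w = Lop l (Lop m w) - Lop m (Lop l w) - of_int (l - m) * Lop (l + m) w"

text \<open>In the twofold commutation the terms with \<open>mode (j - l) (Lop m w)\<close> and
  \<open>mode (j - m) (Lop l w)\<close> are symmetric in \<open>l\<close> and \<open>m\<close> and
  cancel. The rest is matched by the term with \<open>Lop (l + m)\<close>.\<close>

lemma anomaly_mode:
  assumes "w \<in> sym_W P"
  shows "anomaly l m (mode j w) = mode j (anomaly l m w)"
proof -
  have two: "Lop l (Lop m (mode j w)) = mode j (Lop l (Lop m w)) + of_int j * mode (j - l) (Lop m w)
      + of_int j * (mode (j - m) (Lop l w) + of_int (j - m) * mode (j - (l + m)) w)" for l m
  proof -
    have "j - m - l = j - (l + m)" by simp
    hence "Lop l (mode (j - m) w) = mode (j - m) (Lop l w) + of_int (j - m) * mode (j - (l + m)) w"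
      using Lop_mode[OF assms, of l "j - m"] by (simp only:)
    thus ?thesis
      unfolding Lop_mode[OF assms, of m j] Lop_add Lop_of_int
        Lop_mode[OF Lop_W[OF assms, of m], of l j] by (simp only:)
  qed
  show ?thesis
    unfolding anomaly_def mode_diff mode_of_int two[of l m] two[of m l, unfolded add.commute[of m l]]
      Lop_mode[OF assms, of "l + m" j]
    by (simp add: algebra_simps)
qed

lemma anomaly_add: "anomaly l m (v + w) = anomaly l m v + anomaly l m w"
  and anomaly_scale: "anomaly l m (sym_const c * w) = sym_const c * anomaly l m w"
  unfolding anomaly_def Lop_add Lop_scale by (simp_all add: algebra_simps)

lemma anomaly_E_mult:
  assumes "w \<in> sym_W P" "j \<ge> 1"
  shows "anomaly l m (E j * w) = E j * anomaly l m w"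
proof -
  have inv: "sym_const (1 / of_int j) * (of_int j * v) = v" for v
    using assms(2) by (simp add: mult.assoc[symmetric] flip: sym_const_of_int sym_const_mult)
  have "E j * w = sym_const (1 / of_int j) * mode j w"
    using assms(2) by (simp add: mode_def inv)
  hence "anomaly l m (E j * w) = sym_const (1 / of_int j) * mode j (anomaly l m w)"
    by (simp add: anomaly_scale anomaly_mode[OF assms(1)])
  thus ?thesis using assms(2) by (simp add: mode_def inv)
qed

lemma anomaly_mult:
  assumes "w \<in> sym_W P" "v \<in> sym_W P"
  shows "anomaly l m (w * v) = w * anomaly l m v"
  using assms
proof (induction arbitrary: v)
  case (const c)
  show ?case by (rule anomaly_scale)
next
  case (incl \<alpha>)
  obtain N where N: "\<And>k. k > N \<Longrightarrow> \<phi> k \<alpha> = 0" using \<phi>_large by blast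
  have sum: "anomaly l m (sum f I) = (\<Sum>i\<in>I. anomaly l m (f i))" for f :: "int \<Rightarrow> sym_alg" and I
    using anomaly_scale[of l m 0 0]
    by (induction I rule: infinite_finite_induct) (simp_all add: anomaly_add)
  have \<alpha>: "sym_incl \<alpha> = (\<Sum>k\<in>{1..N}. sym_const (\<phi> k \<alpha>) * E k)"
    by (rule sym_incl_K[OF incl.hyps]) (rule N)
  show ?case
    unfolding \<alpha> sum_distrib_right sum
    by (rule sum.cong) (simp_all add: mult.assoc anomaly_scale anomaly_E_mult incl.prems)
next
  case (mult w w')
  thus ?case by (simp add: mult.assoc sym_W.mult)
qed (simp add: ring_distribs anomaly_add)

text \<open>The negative modes annihilate 1 and commute with the anomaly.\<close>

lemma d_anomaly_1:
  assumes "k \<ge> 1"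
  shows "d k (anomaly l m 1) = 0"
proof -
  have "mode (- k) 1 = 0" using assms by (simp add: mode_def derivationD[OF derivation_d])
  hence "mode (- k) (anomaly l m 1) = anomaly l m 0"
    using anomaly_mode[OF sym_W_1, of l m "- k"] by simp
  also have "\<dots> = 0" by (simp add: anomaly_def Lop_0)
  finally show ?thesis using assms by (simp add: mode_def)
qed

text \<open>Quadratic elements are characterised by Euler's relation, so that no grading is needed.\<close>

definition quadratic :: "sym_alg \<Rightarrow> bool" where
  "quadratic w \<longleftrightarrow> (\<exists>N. \<forall>M\<ge>N. (\<Sum>k\<in>{1..M}. E k * d k w) = 2 * w)"

lemma quadratic_add:
  assumes "quadratic v" "quadratic w"
  shows "quadratic (v + w)"
proof -
  obtain N N' where "\<forall>M\<ge>N. (\<Sum>k\<in>{1..M}. E k * d k v) = 2 * v"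
    "\<forall>M\<ge>N'. (\<Sum>k\<in>{1..M}. E k * d k w) = 2 * w"
    using assms unfolding quadratic_def by blast
  hence "\<forall>M\<ge>max N N'. (\<Sum>k\<in>{1..M}. E k * d k (v + w)) = 2 * (v + w)"
    by (simp add: derivationD[OF derivation_d] ring_distribs sum.distrib)
  thus ?thesis unfolding quadratic_def by blast
qed

lemma quadratic_scale:
  assumes "quadratic w"
  shows "quadratic (sym_const c * w)"
proof -
  obtain N where "\<forall>M\<ge>N. (\<Sum>k\<in>{1..M}. E k * d k w) = 2 * w"
    using assms unfolding quadratic_def by blast
  hence "\<forall>M\<ge>N. (\<Sum>k\<in>{1..M}. E k * d k (sym_const c * w)) = 2 * (sym_const c * w)"
    by (simp add: derivationD[OF derivation_d] mult.left_commute[of _ "sym_const c"]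
        flip: sum_distrib_left)
  thus ?thesis unfolding quadratic_def by blast
qed

lemma quadratic_0: "quadratic 0"
  by (simp add: quadratic_def derivationD[OF derivation_d])

lemma quadratic_of_int: "quadratic w \<Longrightarrow> quadratic (of_int i * w)"
  using quadratic_scale[of w "of_int i"] by (simp add: sym_const_of_int)

lemma quadratic_diff: "quadratic v \<Longrightarrow> quadratic w \<Longrightarrow> quadratic (v - w)"
  using quadratic_add[of v "of_int (- 1) * w"] quadratic_of_int[of w "- 1"] by simp

lemma quadratic_sum: "(\<And>i. i \<in> I \<Longrightarrow> quadratic (f i)) \<Longrightarrow> quadratic (sum f I)"
  by (induction I rule: infinite_finite_induct) (auto intro: quadratic_add quadratic_0)

lemma quadratic_EE:
  assumes "a \<ge> 1" "b \<ge> 1"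
  shows "quadratic (E a * E b)"
  unfolding quadratic_def
proof (intro exI[of _ "max a b"] allI impI)
  fix M assume M: "max a b \<le> M"
  have "(\<Sum>k\<in>{1..M}. E k * d k (E a * E b))
      = (\<Sum>k\<in>{1..M}. (if k = a then E a * E b else 0) + (if k = b then E a * E b else 0))"
    by (rule sum.cong) (auto simp: derivationD[OF derivation_d] d_E mult.commute)
  also have "\<dots> = 2 * (E a * E b)"
    using M assms by (simp add: sum.distrib)
  finally show "(\<Sum>k\<in>{1..M}. E k * d k (E a * E b)) = 2 * (E a * E b)" .
qed

lemma quadratic_\<Omega>: "quadratic (\<Omega> N)"
  unfolding \<Omega>_def by (intro quadratic_sum quadratic_scale quadratic_EE) auto

text \<open>\<open>D n\<close> sends each generator to a multiple of a generator or to 0, so it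
  preserves the degree.\<close>

lemma quadratic_D_\<Omega>: "quadratic (D n (\<Omega> N))"
proof -
  have "quadratic (D n (E a * E b))" if "a \<ge> 1" "b \<ge> 1" for a b
  proof -
    have 1: "quadratic (D n (E i) * E j)" if "i \<ge> 1" "j \<ge> 1" for i j
    proof (cases "i > n")
      case True
      have "quadratic (of_int (i - n) * (E (i - n) * E j))"
        using True that by (intro quadratic_of_int quadratic_EE) auto
      thus ?thesis using True by (simp add: D_E mult.assoc)
    qed (simp add: D_E quadratic_0)
    have "D n (E a * E b) = D n (E a) * E b + D n (E b) * E a"
      by (simp add: derivationD[OF derivation_D] mult.commute)
    thus ?thesis using 1 that by (simp add: quadratic_add)
  qed
  thus ?thesis
    unfolding \<Omega>_def
    by (auto simp: derivation_sum[OF derivation_D] derivationD(6)[OF derivation_D]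
        intro!: quadratic_sum quadratic_scale)
qed

lemma quadratic_eq_0:
  assumes "quadratic w" "\<And>k. k \<ge> 1 \<Longrightarrow> d k w = 0"
  shows "w = 0"
proof -
  obtain N where "(\<Sum>k\<in>{1..N}. E k * d k w) = 2 * w"
    using assms(1) unfolding quadratic_def by blast
  moreover have "(\<Sum>k\<in>{1..N}. E k * d k w) = 0"
    using assms(2) by simp
  ultimately have "2 * w = 0" by simp
  hence "sym_const (1 / 2) * (2 * w) = 0" by simp
  moreover have "sym_const (1 / 2) * (2 * w) = w"
    using sym_const_of_nat[of 2] sym_const_mult[of "1 / 2" 2] by (simp add: mult.assoc[symmetric])
  ultimately show ?thesis by simp
qed

text \<open>Contracting both factors of \<open>E a * E b\<close> gives \<open>-1\<close> exactly
  when \<open>a + b = n\<close>, which leaves half the sum of \<open>a (n - a)\<close>.\<close>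

lemma A_\<Omega>:
  "A n (\<Omega> N) = sym_const (if N = n \<and> n \<ge> 1 then (of_int n ^ 3 - of_int n) / 12 else 0)"
proof -
  have EE: "A n (E a * E b) = - (if a + b = n then 1 else 0)" if ab: "a \<ge> 1" "b \<ge> 1" for a b
  proof -
    have "(\<Sum>c\<in>{1..n - 1}. sym_const (\<phi> c (e a)) * d (n - c) (E b))
        = (\<Sum>c\<in>{1..n - 1}. if c = a then (if a + b = n then 1 else 0) else 0)"
      by (rule sum.cong) (auto simp: \<phi>_e d_E)
    also have "\<dots> = (if a + b = n then 1 else 0)" using ab by auto
    finally have s: "(\<Sum>c\<in>{1..n - 1}. sym_const (\<phi> c (e a)) * d (n - c) (E b))
        = (if a + b = n then 1 else 0)" .
    have "A n (E b) = 0"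
      by (simp add: A_def d_E if_distrib derivationD[OF derivation_d] cong: if_cong)
    thus ?thesis using s unfolding E_def[of a] A_incl_mult by simp
  qed
  have A_sum: "A n (sum f I) = (\<Sum>i\<in>I. A n (f i))" for f :: "int \<Rightarrow> sym_alg" and I
    using A_scale[of n 0 0] by (induction I rule: infinite_finite_induct) (simp_all add: A_add)
  have "A n (\<Omega> N) = (\<Sum>a\<in>{1..N - 1}. sym_const (if N = n then of_int (a * (N - a)) / 2 else 0))"
    unfolding \<Omega>_def A_sum
  proof (rule sum.cong[OF refl])
    fix a assume "a \<in> {1..N - 1}"
    hence "A n (E a * E (N - a)) = - (if N = n then 1 else 0)" by (subst EE) auto
    thus "A n (sym_const (- (of_int (a * (N - a)) / 2)) * (E a * E (N - a)))
        = sym_const (if N = n then of_int (a * (N - a)) / 2 else 0)"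
      unfolding A_scale by (simp only:) (simp add: sym_const_minus)
  qed
  also have "\<dots> = sym_const (if N = n then of_int (\<Sum>a\<in>{1..n - 1}. a * (n - a)) / 2 else 0)"
    by (simp flip: sym_const_sum sum_divide_distrib)
  also have "(if N = n then of_int (\<Sum>a\<in>{1..n - 1}. a * (n - a)) / 2 else 0 :: complex)
      = (if N = n \<and> n \<ge> 1 then (of_int n ^ 3 - of_int n) / 12 else 0)"
  proof (cases "n \<ge> 1")
    case True
    have "of_int ((\<Sum>a\<in>{1..n - 1}. a * (n - a)) * 6) = (of_int (n ^ 3 - n) :: complex)"
      by (simp only: sum_mult_complement[OF True])
    thus ?thesis using True by (simp add: field_simps del: of_int_sum)
  qed simp
  finally show ?thesis .
qed

text \<open>The quartic products of two \<open>\<Omega>\<close> cancel by commutativity. What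
  remains is a constant \<open>c\<close> and a quadratic \<open>Q\<close>; the latter vanishes by
  its partial derivatives, without evaluating \<open>D l (\<Omega> (- m))\<close>.\<close>

lemma anomaly_1: "anomaly l m 1 = sym_const (if l + m = 0 then of_int (l ^ 3 - l) / 12 else 0)"
proof -
  define c where "c = A l (\<Omega> (- m)) - A m (\<Omega> (- l))"
  define Q where "Q = D l (\<Omega> (- m)) - D m (\<Omega> (- l)) - of_int (l - m) * \<Omega> (- (l + m))"
  have Lop_1: "Lop n 1 = \<Omega> (- n)" for n
    by (simp add: Lop_def A_def derivationD[OF derivation_D] derivationD[OF derivation_d])
  have cQ: "anomaly l m 1 = c + Q"
    unfolding anomaly_def Lop_1 by (simp add: Lop_def c_def Q_def algebra_simps)
  have c: "c = sym_const (if l + m = 0 then of_int (l ^ 3 - l) / 12 else 0)"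
  proof (cases "l + m = 0")
    case True
    hence m: "m = - l" by simp
    \<comment> \<open>For positive \<open>l\<close> only the first contraction contributes, for
      negative \<open>l\<close> only the second. Since \<open>l^3 - l\<close> is odd, the two cases
      share one formula.\<close>
    consider "l \<ge> 1" | "l = 0" | "l \<le> -1" by linarith
    thus ?thesis
      unfolding c_def A_\<Omega> m sym_const_diff[symmetric]
      by (cases; intro arg_cong[where f = sym_const]) (auto simp: field_simps)
  next
    case False
    hence "- m \<noteq> l" "- l \<noteq> m" by auto
    thus ?thesis using False by (simp add: c_def A_\<Omega>)
  qed
  have dQ: "d k Q = 0" if "k \<ge> 1" for k
    using d_anomaly_1[OF that, of l m] unfolding cQ c by (simp add: derivationD[OF derivation_d])
  have "quadratic Q"
    unfolding Q_def by (intro quadratic_diff quadratic_D_\<Omega> quadratic_of_int quadratic_\<Omega>)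
  hence "Q = 0" by (rule quadratic_eq_0) (rule dQ)
  thus ?thesis using cQ c by simp
qed

lemma Lop_commutator:
  assumes "w \<in> sym_W P"
  shows "Lop l (Lop m w) - Lop m (Lop l w) =
    of_int (l - m) * Lop (l + m) w
    + sym_const (if l + m = 0 then of_int (l ^ 3 - l) / 12 else 0) * w"
proof -
  have "anomaly l m w = anomaly l m 1 * w"
    using anomaly_mult[OF assms sym_W_1] by (simp add: mult.commute)
  thus ?thesis unfolding anomaly_1 unfolding anomaly_def by (simp only: diff_eq_eq add.commute)
qed

end

theorem proposition5p16:
  fixes P :: cp1 and u :: mero and L :: "int \<Rightarrow> sym_alg \<Rightarrow> sym_alg"
  assumes "coordinate u" and "vanishes_at P u"
    and "\<And>n. L n = L_op P (vf_in_coord u (- (u powi (n + 1))))"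
  shows "\<forall>l m. \<forall>w\<in>sym_W P.
     L l (L m w) - L m (L l w) =
       of_int (l - m) \<bullet>\<^sub>S L (l + m) w
       + (if l + m = 0 then of_int (l ^ 3 - l) / 12 else 0) \<bullet>\<^sub>S w"
proof -
  interpret vanishing_coordinate P u
    using assms(1,2) by unfold_locales
  have L: "L n w = Lop n w" if "w \<in> sym_W P" for n w
    using L_op_eq[OF that] assms(3) by (simp add: X_def)
  show ?thesis
    using Lop_commutator by (simp add: L Lop_W sym_const_of_int del: of_int_diff)
qed

end
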